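(* Suppose that $T\colon M\to M$, with invariant probability measure $m$, is a nonuniformly hyperbolic map (in the sense of the context) with return time $\tau$ and $F$-invariant measure $\mu$. Then there exist a Markov shift tower $f\colon\Delta\to\Delta$ (given by $(\mathcal A,\mathbb P_{\mathcal A})$, $h_{\mathcal A}$, $\xi$, with $f$-invariant probability measure $\mathbb P$ and metric $d$) and a map $\pi\colon\Delta\to M$, defined $\mathbb P$-almost surely on $\Delta$, such that: - $\pi$ is a semiconjugacy, i.e. $\pi\circ f=T\circ\pi$; - $\pi$ is measure preserving, i.e. $\pi_*\mathbb P=m$; - $\pi$ is Lipschitz. Moreover, the return time tails satisfy: - if $\mu(\tau\ge n)=O(n^{-\beta}L(n))$ with $\beta>0$ and $L$ a slowly varying function at infinity, then $\mathbb P_{\mathcal A}(h_{\mathcal A}\ge n)=O(n^{-\beta}L(n))$; - if $\int\tau^\beta\,d\mu<\infty$ with $\beta>0$, then $\int h_{\mathcal A}^\beta\,d\mathbb P_{\mathcal A}<\infty$; - if $\int e^{\beta\tau^\delta}\,d\mu<\infty$ with $\beta>0$ and $\delta\in(0,1]$, then $\int e^{\beta'h_{\mathcal A}^\delta}\,d\mathbb P_{\mathcal A}<\infty$ for some $0<\beta'\le\beta$.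
   Context: **Nonuniformly hyperbolic maps.** Let $(M,d_0)$ be a bounded metric space with a Borel probability measure $m$ such that $(M,m)$ is a Lebesgue space. A Borel measurable, $m$-preserving, ergodic $T\colon M\to M$ is nonuniformly hyperbolic if: (1) There is a measurable $Y\subset M$, $m(Y)>0$, with an at most countable partition $\alpha$ and a return time $\tau\colon Y\to\{1,2,\dots\}$, constant on each $a\in\alpha$ with value $\tau(a)$, with $T^{\tau(y)}(y)\in Y$ for all $y\in Y$. Let $F(y)=T^{\tau(y)}(y)$ be the induced map. There is an $F$-invariant probability measure $\mu$ on $Y$ with $\int\tau\,d\mu<\infty$ and $m=\bigl(\int\tau\,d\mu\bigr)^{-1}\sum_{a\in\alpha}\sum_{k=0}^{\tau(a)-1}(T^k)_*\mu_a$, where $\mu_a$ is the restriction of $\mu$ to $a$. (2) The set of $(\dots,a_{-1},a_0,a_1,\dots)\in\alpha^{\mathbb Z}$ for which there is $(y_n)_{n\in\mathbb Z}\in Y^{\mathbb Z}$ with $y_n\in a_n$ and $F(y_n)=y_{n+1}$ is Borel measurable in $\alpha^{\mathbb Z}$ (product topology, $\alpha$ discrete). (3) For $y,z\in Y$ let $s(y,z)$ be the least $n\ge0$ such that $F^n(y),F^n(z)$ lie in different elements of $\alpha$ ($\infty$ if there is none). There are $K\ge1$, $\gamma\in(0,1)$ such that $d_0(F^j(y),F^j(z))\le K(\gamma^{s(y,z)-j}+\gamma^j)$ for all $y,z\in Y$, $j\ge0$; and $d_0(T^jy,T^jz)\le K[d_0(y,z)+d_0(F(y),F(z))]$ for all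 $y,z\in a$, $a\in\alpha$, $0\le j\le\tau(a)$. (4) There is a partition $\mathcal W^s$ of $Y$ into "stable leaves", refining $\alpha$, with $F(W^s_y)\subset W^s_{F(y)}$ where $W^s_y$ is the leaf containing $y$. Let $\bar Y=Y/\sim$ with $y\sim z$ iff $y\in W^s_z$, $\bar\pi\colon Y\to\bar Y$ the projection, $\bar F\colon\bar Y\to\bar Y$ the quotient map with quotient partition $\bar\alpha$ and separation time $s$. The probability measure $\bar\mu=\bar\pi_*\mu$ is $\bar F$-invariant; for each $a\in\bar\alpha$, $\bar F\colon a\to\bar Y$ is a bijection modulo $\bar\mu$-null sets, and its inverse Jacobian $\zeta_a=\frac{d\bar\mu}{d\bar\mu\circ\bar F}$ satisfies $|\log\zeta_a(y)-\log\zeta_a(z)|\le K\gamma^{s(y,z)}$ for all $y,z\in a$. **Markov shift towers.** A Markov shift tower $f\colon\Delta\to\Delta$ is determined by a finite or countable probability space $(\mathcal A,\mathbb P_{\mathcal A})$, an integrable function $h_{\mathcal A}\colon\mathcal A\to\{1,2,\dots\}$ and a constant $\xi\in(0,1)$, as follows. Let $(X,\mathbb P_X)=(\mathcal A^{\mathbb Z},\mathbb P_{\mathcal A}^{\mathbb Z})$, let $f_X\colon X\to X$ be the left shift, and $h(\dots,a_{-1},a_0,a_1,\dots)=h_{\mathcal A}(a_0)$. Then $\Delta=\{(x,\ell)\in X\times\mathbb Z:0\le\ell<h(x)\}$, and $f(x,\ell)=(x,\ell+1)$ if $\ell<h(x)-1$, $f(x,\ell)=(f_X(x),0)$ if $\ell=h(x)-1$.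 The $f$-invariant probability measure $\mathbb P$ on $\Delta$ is $\mathbb P(A\times\{\ell\})=\bigl(\int h\,d\mathbb P_X\bigr)^{-1}\mathbb P_X(A)$ for $\ell\ge0$ and measurable $A\subset\{x\in X:h(x)\ge\ell+1\}$. The metric on $X$ is $d(x,y)=\xi^{s(x,y)}$ with $s((a_n)_n,(b_n)_n)=\inf\{j\ge0:a_j\ne b_j\text{ or }a_{-j}\ne b_{-j}\}$, and on $\Delta$ it is $d((x,k),(y,j))=1$ if $k\ne j$ and $d((x,k),(y,k))=d(x,y)$. *)

theory Defs
  imports "HOL-Probability.Probability" "HOL-Library.Landau_Symbols" "HOL-Library.Disjoint_Sets"
begin

section \<open>Lebesgue spaces and slowly varying functions\<close>

definition isomorphic_mod_0 :: "'a measure \<Rightarrow> 'b measure \<Rightarrow> bool" where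
  "isomorphic_mod_0 M N \<longleftrightarrow> (\<exists>A\<in>null_sets M. \<exists>B\<in>null_sets N. \<exists>\<phi>.
     bij_betw \<phi> (space M - A) (space N - B) \<and>
     (\<forall>E. E \<subseteq> space M - A \<longrightarrow> (E \<in> sets M \<longleftrightarrow> \<phi> ` E \<in> sets N)) \<and>
     (\<forall>E\<in>sets M. E \<subseteq> space M - A \<longrightarrow> emeasure N (\<phi> ` E) = emeasure M E))"

text \<open>The interval \<open>[0,c]\<close> with Lebesgue measure, together with countably many atoms, which are
  placed at the negative integers so that they are disjoint from the interval.\<close>

definition interval_with_atoms :: "real \<Rightarrow> (nat \<Rightarrow> real) \<Rightarrow> real measure" where
  "interval_with_atoms c p = measure_of UNIV (sets borel)
     (\<lambda>A. emeasure lborel (A \<inter> {0..c}) + (\<Sum>n. ennreal (p n) * indicator A (- real (Suc n))))"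

lemma emeasure_interval_with_atoms:
  assumes A: "A \<in> sets borel"
  shows "emeasure (interval_with_atoms c p) A =
    emeasure lborel (A \<inter> {0..c}) + (\<Sum>n. ennreal (p n) * indicator A (- real (Suc n)))"
proof (rule emeasure_measure_of[OF interval_with_atoms_def])
  let ?\<mu> = "\<lambda>A. emeasure lborel (A \<inter> {0..c}) + (\<Sum>n. ennreal (p n) * indicator A (- real (Suc n)))"
  show "countably_additive (sets (interval_with_atoms c p)) ?\<mu>"
  proof (rule countably_additiveI)
    fix E :: "nat \<Rightarrow> real set"
    assume E: "range E \<subseteq> sets (interval_with_atoms c p)" "disjoint_family E"
    have S: "sets (interval_with_atoms c p) = sets borel"
      using sets.sigma_sets_eq[of "borel :: real measure"]
      by (simp add: interval_with_atoms_def)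
    have 1: "(\<Sum>i. emeasure lborel (E i \<inter> {0..c})) = emeasure lborel ((\<Union>i. E i) \<inter> {0..c})"
      using E S by (subst suminf_emeasure) (auto simp: disjoint_family_on_def)
    have 2: "(\<Sum>i. \<Sum>n. ennreal (p n) * indicator (E i) (- real (Suc n))) =
             (\<Sum>n. ennreal (p n) * indicator (\<Union>i. E i) (- real (Suc n)))"
    proof -
      let ?g = "\<lambda>i n. ennreal (p n) * indicator (E i) (- real (Suc n))"
      have "(\<Sum>i. \<Sum>n. ?g i n) = (\<integral>\<^sup>+ i. (\<Sum>n. ?g i n) \<partial>count_space UNIV)"
        by (simp only: nn_integral_count_space_nat)
      also have "\<dots> = (\<Sum>n. \<integral>\<^sup>+ i. ?g i n \<partial>count_space UNIV)"
        by (rule nn_integral_suminf) simp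
      also have "\<dots> = (\<Sum>n. \<Sum>i. ?g i n)"
        by (simp only: nn_integral_count_space_nat)
      also have "\<dots> = (\<Sum>n. ennreal (p n) * indicator (\<Union>i. E i) (- real (Suc n)))"
        by (simp add: suminf_indicator[OF E(2)])
      finally show ?thesis .
    qed
    show "(\<Sum>i. ?\<mu> (E i)) = ?\<mu> (\<Union>i. E i)"
      by (subst suminf_add[symmetric]) (use 1 2 in auto)
  qed
qed (use A sets.sigma_sets_eq[of "borel :: real measure"] in
      \<open>auto simp: positive_def interval_with_atoms_def\<close>)

text \<open>Lebesgue spaces in the sense of Rokhlin; a measure given on a smaller $\sigma$-algebra, such as
  the Borel sets, is completed first.\<close>

definition lebesgue_space :: "'a measure \<Rightarrow> bool" where
  "lebesgue_space M \<longleftrightarrow> (\<exists>c p. 0 \<le> c \<and> (\<forall>n. 0 \<le> p n) \<and> prob_space (interval_with_atoms c p) \<and>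
     isomorphic_mod_0 (completion M) (completion (interval_with_atoms c p)))"

definition slowly_varying :: "(real \<Rightarrow> real) \<Rightarrow> bool" where
  "slowly_varying L \<longleftrightarrow>
     (\<exists>X. (\<forall>x\<ge>X. 0 < L x) \<and> L \<in> borel_measurable (restrict_space borel {X..})) \<and>
     (\<forall>c>0. ((\<lambda>x. L (c * x) / L x) \<longlongrightarrow> 1) at_top)"


section \<open>Nonuniformly hyperbolic maps\<close>

definition ergodic :: "'a measure \<Rightarrow> ('a \<Rightarrow> 'a) \<Rightarrow> bool" where
  "ergodic M T \<longleftrightarrow> (\<forall>A\<in>sets M. T -` A \<inter> space M = A \<longrightarrow> emeasure M A = 0 \<or> emeasure M (space M - A) = 0)"

definition induced_map :: "('a \<Rightarrow> 'a) \<Rightarrow> ('a \<Rightarrow> nat) \<Rightarrow> 'a \<Rightarrow> 'a" where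
  "induced_map T \<tau> y = (T ^^ \<tau> y) y"

definition value_on :: "('a \<Rightarrow> 'b) \<Rightarrow> 'a set \<Rightarrow> 'b" where
  "value_on g a = the_elem (g ` a)"

definition separation_time :: "('a \<Rightarrow> 'a) \<Rightarrow> 'a set set \<Rightarrow> 'a \<Rightarrow> 'a \<Rightarrow> enat" where
  "separation_time F \<alpha> y z =
     Inf (enat ` {n. \<exists>a\<in>\<alpha>. \<exists>b\<in>\<alpha>. a \<noteq> b \<and> (F ^^ n) y \<in> a \<and> (F ^^ n) z \<in> b})"

text \<open>\<open>gap_power \<gamma> s j\<close> is $\gamma^{s-j}$, where $s - j$ is a possibly negative integer and
  $\gamma^\infty = 0$.\<close>

definition gap_power :: "real \<Rightarrow> enat \<Rightarrow> nat \<Rightarrow> real" where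
  "gap_power \<gamma> s j = (case s of enat n \<Rightarrow> \<gamma> powi (int n - int j) | \<infinity> \<Rightarrow> 0)"

definition itineraries :: "('a \<Rightarrow> 'a) \<Rightarrow> 'a set \<Rightarrow> 'a set set \<Rightarrow> (int \<Rightarrow> 'a set) set" where
  "itineraries F Y \<alpha> = {A. (\<forall>n. A n \<in> \<alpha>) \<and>
     (\<exists>y. \<forall>n. y n \<in> Y \<and> y n \<in> A n \<and> F (y n) = y (n + 1))}"

definition borel_sets_of :: "'a topology \<Rightarrow> 'a set set" where
  "borel_sets_of X = sigma_sets (topspace X) {U. openin X U}"

text \<open>The points of the quotient space are the leaves themselves, so the quotient space is the
  partition \<open>W\<close> and the projection is \<open>leaf W\<close>.\<close>

definition leaf :: "'a set set \<Rightarrow> 'a \<Rightarrow> 'a set" where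
  "leaf W y = (THE w. w \<in> W \<and> y \<in> w)"

definition leaf_map :: "('a \<Rightarrow> 'a) \<Rightarrow> 'a set set \<Rightarrow> 'a set \<Rightarrow> 'a set" where
  "leaf_map F W w = (THE w'. w' \<in> W \<and> F ` w \<subseteq> w')"

definition quotient_partition :: "'a set set \<Rightarrow> 'a set set \<Rightarrow> 'a set set set" where
  "quotient_partition \<alpha> W = (\<lambda>a. leaf W ` a) ` \<alpha>"

text \<open>The quotient $\sigma$-algebra consists of the sets whose preimage is measurable for the
  completed measure, which is the convention for factors of Lebesgue spaces.\<close>

definition quotient_measure :: "'a measure \<Rightarrow> 'a set set \<Rightarrow> 'a set measure" where
  "quotient_measure \<mu> W = distr (completion \<mu>)
     (sigma W {B \<in> Pow W. leaf W -` B \<inter> space \<mu> \<in> sets (completion \<mu>)}) (leaf W)"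

text \<open>For \<open>G\<close> injective on \<open>A\<close> and mapping measurable subsets of \<open>A\<close> to measurable sets, the measure
  $\nu \circ G$ on \<open>A\<close>, and the derivative $d\nu / d(\nu \circ G)$ on \<open>A\<close>.\<close>

definition comp_measure :: "'a measure \<Rightarrow> ('a \<Rightarrow> 'a) \<Rightarrow> 'a set \<Rightarrow> 'a measure" where
  "comp_measure \<nu> G A = measure_of A (sets (restrict_space \<nu> A)) (\<lambda>B. emeasure \<nu> (G ` B))"

definition inverse_jacobian :: "'a measure \<Rightarrow> ('a \<Rightarrow> 'a) \<Rightarrow> 'a set \<Rightarrow> ('a \<Rightarrow> real) \<Rightarrow> bool" where
  "inverse_jacobian \<nu> G A \<zeta> \<longleftrightarrow> \<zeta> \<in> borel_measurable (restrict_space \<nu> A) \<and>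
     density (comp_measure \<nu> G A) (\<lambda>x. ennreal (\<zeta> x)) = restrict_space \<nu> A"

text \<open>The measures \<open>m\<close> and \<open>\<mu>\<close> are given on Borel sets; measurability of \<open>Y\<close> and of the elements of
  \<open>\<alpha>\<close> refers to the completions, as is usual in Lebesgue spaces.
  In \<open>jacobian\<close>, the map of \<open>a\<close> to the quotient space is a bijection off the null sets \<open>N\<close> and \<open>N'\<close>,
  and $\bar\mu \circ \bar F$ is formed on \<open>a - N\<close>, where $\bar F$ is injective.\<close>

locale nonuniformly_hyperbolic =
  fixes m :: "'a::metric_space measure" and T :: "'a \<Rightarrow> 'a"
    and Y :: "'a set" and \<alpha> :: "'a set set" and \<tau> :: "'a \<Rightarrow> nat" and \<mu> :: "'a measure"
    and W :: "'a set set" and K \<gamma> :: real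
  assumes bounded_space: "bounded (UNIV :: 'a set)"
    and sets_m: "sets m = sets borel"
    and prob_m: "prob_space m"
    and lebesgue_m: "lebesgue_space m"
    and T_measurable: "T \<in> borel_measurable borel"
    and T_preserving: "distr m m T = m"
    and T_ergodic: "ergodic m T"
    and Y_measurable: "Y \<in> sets (completion m)"
    and Y_pos: "emeasure (completion m) Y > 0"
    and \<alpha>_partition: "partition_on Y \<alpha>"
    and \<alpha>_countable: "countable \<alpha>"
    and \<tau>_pos: "\<And>y. y \<in> Y \<Longrightarrow> \<tau> y \<ge> 1"
    and \<tau>_constant: "\<And>a. a \<in> \<alpha> \<Longrightarrow> \<tau> constant_on a"
    and return: "\<And>y. y \<in> Y \<Longrightarrow> induced_map T \<tau> y \<in> Y"
    and sets_\<mu>: "sets \<mu> = sets (restrict_space borel Y)"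
    and prob_\<mu>: "prob_space \<mu>"
    and \<alpha>_measurable: "\<And>a. a \<in> \<alpha> \<Longrightarrow> a \<in> sets (completion \<mu>)"
    and F_measurable: "induced_map T \<tau> \<in> completion \<mu> \<rightarrow>\<^sub>M \<mu>"
    and F_preserving: "distr (completion \<mu>) \<mu> (induced_map T \<tau>) = \<mu>"
    and \<tau>_integrable: "(\<integral>\<^sup>+ y. of_nat (\<tau> y) \<partial>completion \<mu>) < \<infinity>"
    and m_eq: "\<And>A. A \<in> sets m \<Longrightarrow> emeasure m A =
        (\<integral>\<^sup>+ a. (\<Sum>k<value_on \<tau> a. emeasure (distr (restrict_space (completion \<mu>) a) m (T ^^ k)) A)
           \<partial>count_space \<alpha>) / (\<integral>\<^sup>+ y. of_nat (\<tau> y) \<partial>completion \<mu>)"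
    and itineraries_borel: "itineraries (induced_map T \<tau>) Y \<alpha> \<in>
        borel_sets_of (product_topology (\<lambda>_::int. discrete_topology \<alpha>) UNIV)"
    and K_ge_1: "K \<ge> 1"
    and \<gamma>_bounds: "0 < \<gamma>" "\<gamma> < 1"
    and hyperbolic: "\<And>y z j. y \<in> Y \<Longrightarrow> z \<in> Y \<Longrightarrow>
        dist ((induced_map T \<tau> ^^ j) y) ((induced_map T \<tau> ^^ j) z)
          \<le> K * (gap_power \<gamma> (separation_time (induced_map T \<tau>) \<alpha> y z) j + \<gamma> ^ j)"
    and excursion: "\<And>a y z j. a \<in> \<alpha> \<Longrightarrow> y \<in> a \<Longrightarrow> z \<in> a \<Longrightarrow> j \<le> value_on \<tau> a \<Longrightarrow>
        dist ((T ^^ j) y) ((T ^^ j) z)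
          \<le> K * (dist y z + dist (induced_map T \<tau> y) (induced_map T \<tau> z))"
    and W_refines: "refines Y W \<alpha>"
    and W_invariant: "\<And>y. y \<in> Y \<Longrightarrow> induced_map T \<tau> ` leaf W y \<subseteq> leaf W (induced_map T \<tau> y)"
    and Fbar_measurable:
      "leaf_map (induced_map T \<tau>) W \<in> quotient_measure \<mu> W \<rightarrow>\<^sub>M quotient_measure \<mu> W"
    and Fbar_preserving:
      "distr (quotient_measure \<mu> W) (quotient_measure \<mu> W) (leaf_map (induced_map T \<tau>) W)
         = quotient_measure \<mu> W"
    and jacobian: "\<And>a. a \<in> quotient_partition \<alpha> W \<Longrightarrow>
        \<exists>N\<in>null_sets (quotient_measure \<mu> W). \<exists>N'\<in>null_sets (quotient_measure \<mu> W). \<exists>\<zeta>.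
          bij_betw (leaf_map (induced_map T \<tau>) W) (a - N) (W - N') \<and>
          (\<forall>B\<in>sets (quotient_measure \<mu> W). B \<subseteq> a - N \<longrightarrow>
             leaf_map (induced_map T \<tau>) W ` B \<in> sets (quotient_measure \<mu> W)) \<and>
          inverse_jacobian (quotient_measure \<mu> W) (leaf_map (induced_map T \<tau>) W) (a - N) \<zeta> \<and>
          (\<forall>y\<in>a. 0 < \<zeta> y) \<and>
          (\<forall>y\<in>a. \<forall>z\<in>a. \<bar>ln (\<zeta> y) - ln (\<zeta> z)\<bar> \<le> K * gap_power \<gamma>
             (separation_time (leaf_map (induced_map T \<tau>) W) (quotient_partition \<alpha> W) y z) 0)"


section \<open>Markov shift towers\<close>

locale markov_shift_tower =
  fixes PA :: "'c measure" and hA :: "'c \<Rightarrow> nat" and \<xi> :: real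
  assumes prob_PA: "prob_space PA"
    and countable_PA: "countable (space PA)"
    and sets_PA: "sets PA = Pow (space PA)"
    and hA_pos: "\<And>a. a \<in> space PA \<Longrightarrow> hA a \<ge> 1"
    and hA_integrable: "integrable PA (\<lambda>a. real (hA a))"
    and \<xi>_bounds: "0 < \<xi>" "\<xi> < 1"

definition shift_measure :: "'c measure \<Rightarrow> (int \<Rightarrow> 'c) measure" where
  "shift_measure PA = (\<Pi>\<^sub>M n\<in>UNIV. PA)"

definition left_shift :: "(int \<Rightarrow> 'c) \<Rightarrow> int \<Rightarrow> 'c" where
  "left_shift x = (\<lambda>n. x (n + 1))"

definition shift_height :: "('c \<Rightarrow> nat) \<Rightarrow> (int \<Rightarrow> 'c) \<Rightarrow> nat" where
  "shift_height hA x = hA (x 0)"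

definition tower :: "'c measure \<Rightarrow> ('c \<Rightarrow> nat) \<Rightarrow> ((int \<Rightarrow> 'c) \<times> nat) set" where
  "tower PA hA = {(x, l). x \<in> space (shift_measure PA) \<and> l < shift_height hA x}"

definition tower_map :: "('c \<Rightarrow> nat) \<Rightarrow> (int \<Rightarrow> 'c) \<times> nat \<Rightarrow> (int \<Rightarrow> 'c) \<times> nat" where
  "tower_map hA = (\<lambda>(x, l). if l < shift_height hA x - 1 then (x, l + 1) else (left_shift x, 0))"

definition tower_measure :: "'c measure \<Rightarrow> ('c \<Rightarrow> nat) \<Rightarrow> ((int \<Rightarrow> 'c) \<times> nat) measure" where
  "tower_measure PA hA =
     scale_measure (inverse (\<integral>\<^sup>+ x. of_nat (shift_height hA x) \<partial>shift_measure PA))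
       (restrict_space (shift_measure PA \<Otimes>\<^sub>M count_space UNIV) (tower PA hA))"

definition symbolic_separation :: "(int \<Rightarrow> 'c) \<Rightarrow> (int \<Rightarrow> 'c) \<Rightarrow> enat" where
  "symbolic_separation x y =
     Inf (enat ` {j. x (int j) \<noteq> y (int j) \<or> x (- int j) \<noteq> y (- int j)})"

definition shift_dist :: "real \<Rightarrow> (int \<Rightarrow> 'c) \<Rightarrow> (int \<Rightarrow> 'c) \<Rightarrow> real" where
  "shift_dist \<xi> x y = gap_power \<xi> (symbolic_separation x y) 0"

definition tower_dist :: "real \<Rightarrow> (int \<Rightarrow> 'c) \<times> nat \<Rightarrow> (int \<Rightarrow> 'c) \<times> nat \<Rightarrow> real" where
  "tower_dist \<xi> = (\<lambda>(x, k) (y, j). if k = j then shift_dist \<xi> x y else 1)"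

context markov_shift_tower
begin

lemma tower_in_sets: "tower PA hA \<in> sets (shift_measure PA \<Otimes>\<^sub>M count_space UNIV)"
proof -
  let ?Q = "shift_measure PA \<Otimes>\<^sub>M count_space (UNIV :: nat set)"
  have [measurable]: "hA \<in> PA \<rightarrow>\<^sub>M count_space UNIV"
    by (simp add: measurable_def sets_PA)
  have [measurable]: "shift_height hA \<in> shift_measure PA \<rightarrow>\<^sub>M count_space UNIV"
    unfolding shift_height_def shift_measure_def by measurable
  have 1: "(\<lambda>q. real (shift_height hA (fst q))) \<in> borel_measurable ?Q"
    by (intro measurable_compose[OF measurable_fst] measurable_compose[OF _ borel_measurable_count_space])
      measurable
  have 2: "(\<lambda>q. real (snd q)) \<in> borel_measurable ?Q"
    by (rule measurable_compose[OF measurable_snd borel_measurable_count_space])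
  have "tower PA hA = {q \<in> space ?Q. real (snd q) < real (shift_height hA (fst q))}"
    by (auto simp: tower_def space_pair_measure)
  also have "\<dots> \<in> sets ?Q"
    using 2 1 by (rule borel_measurable_less)
  finally show ?thesis .
qed

lemma emeasure_tower_measure:
  assumes "A \<in> sets (shift_measure PA)" "\<And>x. x \<in> A \<Longrightarrow> l + 1 \<le> shift_height hA x"
  shows "emeasure (tower_measure PA hA) (A \<times> {l}) =
    inverse (\<integral>\<^sup>+ x. of_nat (shift_height hA x) \<partial>shift_measure PA) * emeasure (shift_measure PA) A"
proof -
  have "A \<times> {l} \<subseteq> tower PA hA"
    using assms sets.sets_into_space by (fastforce simp: tower_def)
  moreover have "sigma_finite_measure (count_space (UNIV :: nat set))"
    by (rule sigma_finite_measure_count_space)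
  ultimately show ?thesis
    using assms(1) tower_in_sets
    by (simp add: tower_measure_def emeasure_restrict_space sigma_finite_measure.emeasure_pair_measure_Times)
qed

end

end

theory Submission
  imports Defs "HOL-Real_Asymp.Real_Asymp"
begin

text \<open>
Code a point of \<open>Y\<close> by its itinerary, the sequence of elements of \<open>\<alpha>\<close> that its orbit under the
induced map \<open>F\<close> visits, and let \<open>lam u\<close> be the \<open>\<mu>\<close>-measure of the points whose itinerary begins with
the word \<open>u\<close>. The Jacobian bounds on the space of stable leaves say that prepending a letter changes
\<open>lam\<close> by a factor which depends on the distant letters only through an exponentially small amount
(\<open>lam_distortion\<close>). The theorem follows from this and from the contraction of \<open>F\<close> in four steps.

\<^bold>\<open>Independent words.\<close> Read an itinerary letter by letter. Given the history, the law of the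
future has a density with respect to \<open>lam\<close>, and the oscillation of its logarithm satisfies a
recursion in which the old oscillation is multiplied by \<open>\<gamma>\<close> and a bounded amount is added. The
density therefore stays above a constant, so that after every letter a coin with a fixed probability
\<open>\<epsilon>\<close> of heads can be tossed: on heads the future is drawn afresh from \<open>lam\<close>, on tails from the
remainder, which is again of the same kind (\<open>regular_step\<close>). Heads cut the itinerary into
independent identically distributed words of geometric length. The coins are such that the future at
any position inside a word in progress has, averaged over the history, exactly the law \<open>lam\<close>: the
future after one more letter is \<open>lam\<close> by invariance, its heads part is \<open>lam\<close> by construction, hence so
is its tails part (\<open>emeasure_level_reads\<close>). Consequently the letters read along the tower over the
shift on words, with the length of the word as height, form a two-sided stationary process with the
law of the itineraries (\<open>emeasure_Q_reads\<close>).

\<^bold>\<open>Points.\<close> The letters at the times from \<open>- n\<close> to \<open>n\<close> determine the point at time 0 up to an error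
\<open>2 * K * \<gamma> ^ n\<close>. These nested sets of candidates shrink, but in an incomplete space they may have
no point in their closures. Since \<open>M\<close> is a Lebesgue space, there are compact sets of measure close to
one on which \<open>F\<close> is continuous and the elements of \<open>\<alpha>\<close> are relatively closed (\<open>lusin_F\<close>). By
stationarity, the probability that all candidate sets meet a given compact set is at least the
measure of that set (\<open>hits_measure\<close>), and then the limit point exists and lies in it
(\<open>hits_near\<close>). The same inequality, applied to compact subsets of an arbitrary set, shows that the
limit point is distributed according to \<open>\<mu>\<close> (\<open>point_law\<close>); continuity on the compact sets shows that
moving one letter forward moves the limit point by \<open>F\<close> (\<open>F_point\<close>).

\<^bold>\<open>The semiconjugacy.\<close> The required tower has the same words as alphabet and the total return time of
a word as height; its level \<open>l\<close> over \<open>x\<close> is sent to the \<open>l\<close>-th iterate under \<open>T\<close> of the point of \<open>x\<close>.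
Each letter accounts for as many levels as its return time, which reproduces the formula for \<open>m\<close>
(\<open>proj_preserving\<close>). Sequences of words that agree near the origin give itineraries that agree for at least as many
letters, so the projection is Lipschitz for \<open>\<xi> = \<gamma>\<close> (\<open>proj_lipschitz\<close>).

\<^bold>\<open>Tails.\<close> Counting from 0, a word has an \<open>i\<close>-th letter with probability \<open>(1 - \<epsilon>) ^ i\<close>, and that letter
then has the law of the first letter of an itinerary. As \<open>1 / ((i + 1) * (i + 2))\<close> sums to one, a word of height
\<open>n\<close> has a letter number \<open>i\<close> of return time at least \<open>n / ((i + 1) * (i + 2))\<close>; this polynomial loss
is absorbed by the geometric factor. Exponential moments are instead multiplied along the word, each
letter contributing a factor close to one when the exponent is small.
\<close>

section \<open>Words cut by independent coins\<close>

text \<open>\<open>lam u\<close> stands for the probability that a one-sided stationary sequence of letters begins with \<open>u\<close>: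
the two integral conditions are additivity in the last letter and invariance under the shift. The
inequality bounds the distortion of the conditional probability of a letter given the letters that
follow it.\<close>

locale gibbs_words =
  fixes \<alpha> :: "'l set" and lam :: "'l list \<Rightarrow> real" and K \<gamma> :: real
  assumes countable_alphabet: "countable \<alpha>"
    and lam_Nil: "lam [] = 1"
    and lam_pos: "u \<in> lists \<alpha> \<Longrightarrow> 0 < lam u"
    and lam_append: "u \<in> lists \<alpha> \<Longrightarrow>
        has_bochner_integral (count_space \<alpha>) (\<lambda>a. lam (u @ [a])) (lam u)"
    and lam_Cons: "u \<in> lists \<alpha> \<Longrightarrow>
        has_bochner_integral (count_space \<alpha>) (\<lambda>a. lam (a # u)) (lam u)"
    and distortion: "a \<in> \<alpha> \<Longrightarrow> u \<in> lists \<alpha> \<Longrightarrow> v \<in> lists \<alpha> \<Longrightarrow> v' \<in> lists \<alpha> \<Longrightarrow>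
        lam (a # u @ v) * lam (u @ v') \<le> exp (K * \<gamma> ^ length u) * (lam (a # u @ v') * lam (u @ v))"
    and K_nonneg: "0 \<le> K" and \<gamma>_pos: "0 < \<gamma>" and \<gamma>_less_1: "\<gamma> < 1"
begin

text \<open>If \<open>R\<close> bounds the oscillation of the logarithm of the density of the future, then reading a letter
turns it into \<open>R * \<gamma> + K\<close>. The choice of \<open>R\<close> makes this equal to \<open>R - 1\<close>; the gap of one is what
subtracting the fraction \<open>\<epsilon>\<close> may cost.\<close>

definition R :: real where "R = (K + 1) / (1 - \<gamma>)"

definition \<epsilon> :: real where "\<epsilon> = exp (- (2 * R)) / R"

lemma R_contraction: "R * \<gamma> + K = R - 1"
  using \<gamma>_less_1 by (simp add: R_def field_simps)

lemma R_ge_1: "1 \<le> R"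
  using \<gamma>_less_1 \<gamma>_pos K_nonneg by (simp add: R_def field_simps)

lemma \<epsilon>_pos: "0 < \<epsilon>" and \<epsilon>_less_1: "\<epsilon> < 1" and \<epsilon>_less: "\<epsilon> < exp (- (R - 1))"
proof -
  show "0 < \<epsilon>" using R_ge_1 by (simp add: \<epsilon>_def)
  have "\<epsilon> \<le> exp (- (2 * R)) / 1"
    unfolding \<epsilon>_def using R_ge_1 by (intro divide_left_mono) auto
  also have "\<dots> < exp (- (R - 1))" using R_ge_1 by simp
  finally show "\<epsilon> < exp (- (R - 1))" .
  also have "\<dots> \<le> 1" using R_ge_1 by simp
  finally show "\<epsilon> < 1" .
qed

text \<open>The densities \<open>f / lam\<close> on words have logarithmic oscillation at most \<open>R * \<gamma> ^ n\<close> on cylinders of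
length \<open>n\<close>. The inequality is stated without division, for two extensions of the same word.\<close>

definition regular :: "('l list \<Rightarrow> real) \<Rightarrow> bool" where
  "regular f \<longleftrightarrow> f [] = 1 \<and> (\<forall>u\<in>lists \<alpha>. 0 < f u \<and>
       has_bochner_integral (count_space \<alpha>) (\<lambda>a. f (u @ [a])) (f u)) \<and>
     (\<forall>u\<in>lists \<alpha>. \<forall>v\<in>lists \<alpha>. \<forall>v'\<in>lists \<alpha>.
        f (u @ v) * lam (u @ v') \<le> exp (R * \<gamma> ^ length u) * (f (u @ v') * lam (u @ v)))"

lemma regularD:
  assumes "regular f"
  shows regular_Nil: "f [] = 1"
    and regular_pos: "u \<in> lists \<alpha> \<Longrightarrow> 0 < f u"
    and regular_append: "u \<in> lists \<alpha> \<Longrightarrow>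
      has_bochner_integral (count_space \<alpha>) (\<lambda>a. f (u @ [a])) (f u)"
  using assms by (auto simp: regular_def)

lemma regular_lam: "regular lam"
proof -
  have "lam (u @ v) * lam (u @ v') \<le> exp (R * \<gamma> ^ length u) * (lam (u @ v') * lam (u @ v))"
    if "u \<in> lists \<alpha>" "v \<in> lists \<alpha>" "v' \<in> lists \<alpha>" for u v v'
  proof -
    have "1 * (lam (u @ v') * lam (u @ v)) \<le> exp (R * \<gamma> ^ length u) * (lam (u @ v') * lam (u @ v))"
      using that lam_pos[of "u @ v"] lam_pos[of "u @ v'"] R_ge_1 \<gamma>_pos
      by (intro mult_right_mono) auto
    then show ?thesis by (simp add: mult.commute)
  qed
  then show ?thesis
    unfolding regular_def using lam_Nil lam_pos lam_append by auto
qed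

text \<open>Subtracting \<open>\<epsilon>\<close> from a function that oscillates by a factor \<open>exp ((R - 1) * t)\<close> and stays above
\<open>exp (- (R - 1))\<close> increases the oscillation at most to \<open>exp (R * t)\<close>: both the gain and the loss are
of first order in \<open>t\<close>, and \<open>\<epsilon>\<close> is chosen so that the former dominates.\<close>

lemma exp_gap:
  assumes t: "0 \<le> t" "t \<le> 1" and g: "exp (- (R - 1)) \<le> g"
  shows "exp ((R - 1) * t) * g - \<epsilon> \<le> exp (R * t) * (g - \<epsilon>)"
proof -
  have 1: "exp (R * t) - 1 \<le> R * t * exp R"
  proof -
    have "exp (R * t) * (1 - R * t) \<le> exp (R * t) * exp (- (R * t))"
      using exp_ge_add_one_self[of "- (R * t)"] by (intro mult_left_mono) auto
    then have "exp (R * t) - 1 \<le> R * t * exp (R * t)"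
      by (simp add: exp_minus field_simps)
    also have "\<dots> \<le> R * t * exp R"
      using t R_ge_1 by (intro mult_left_mono) (auto simp: mult_left_le)
    finally show ?thesis .
  qed
  have 2: "t \<le> exp (R * t) - exp ((R - 1) * t)"
  proof -
    have "1 * (exp t - 1) \<le> exp ((R - 1) * t) * (exp t - 1)"
      using t R_ge_1 by (intro mult_right_mono) auto
    then have "exp t - 1 \<le> exp (R * t) - exp ((R - 1) * t)"
      by (simp add: right_diff_distrib left_diff_distrib flip: exp_add)
    moreover have "1 + t \<le> exp t" by simp
    ultimately show ?thesis by linarith
  qed
  have "\<epsilon> * (exp (R * t) - 1) \<le> \<epsilon> * (R * t * exp R)"
    using 1 \<epsilon>_pos by (intro mult_left_mono) auto
  also have "\<dots> = exp (- R) * t"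
    using R_ge_1 by (simp add: \<epsilon>_def exp_minus field_simps exp_double[symmetric] power2_eq_square
        flip: exp_add)
  also have "\<dots> \<le> g * (exp (R * t) - exp ((R - 1) * t))"
    using 2 t g less_imp_le[OF order.strict_trans2[OF exp_gt_zero g]]
    by (intro mult_mono order_trans[OF _ g]) auto
  finally show ?thesis by (simp add: algebra_simps)
qed

text \<open>The law of the letters after \<open>b\<close>, conditioned on tails: the conditional law given the letter \<open>b\<close> is
\<open>\<epsilon>\<close> times \<open>lam\<close> plus \<open>1 - \<epsilon>\<close> times this law.\<close>

definition step :: "('l list \<Rightarrow> real) \<Rightarrow> 'l \<Rightarrow> 'l list \<Rightarrow> real" where
  "step f b u = (f (b # u) / f [b] - \<epsilon> * lam u) / (1 - \<epsilon>)"

text \<open>Passing from \<open>f\<close> to its conditional law after \<open>b\<close> multiplies the density \<open>f (b # u) / lam (b # u)\<close> by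
\<open>lam (b # u) / lam u\<close>. The logarithm of the first factor oscillates less, by the factor \<open>\<gamma>\<close>, because
the common word has become one letter longer; that of the second one oscillates within the distortion
bound. Then \<open>exp_gap\<close> applies.\<close>

lemma regular_step:
  assumes f: "regular f" and b: "b \<in> \<alpha>"
  shows "regular (step f b)"
proof -
  define \<rho> where "\<rho> u = f (b # u) / f [b] / lam u" for u
  have fb: "0 < f [b]" using f b by (auto simp: regular_def)
  have f_pos: "0 < f u" if "u \<in> lists \<alpha>" for u using f that by (auto simp: regular_def)
  have osc: "\<rho> (u @ v) \<le> exp ((R - 1) * \<gamma> ^ length u) * \<rho> (u @ v')"
    if uv: "u \<in> lists \<alpha>" "v \<in> lists \<alpha>" "v' \<in> lists \<alpha>" for u v v'
  proof -
    note pos = lam_pos[of "u @ v"] lam_pos[of "u @ v'"] lam_pos[of "b # u @ v"]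
      lam_pos[of "b # u @ v'"] f_pos[of "b # u @ v"] f_pos[of "b # u @ v'"]
    have pos': "0 < lam (u @ v)" "0 < lam (u @ v')" "0 < lam (b # u @ v)" "0 < lam (b # u @ v')"
      "0 < f (b # u @ v)" "0 < f (b # u @ v')"
      using pos uv b by auto
    have "f (b # u @ v) * lam (b # u @ v') \<le>
        exp (R * \<gamma> ^ Suc (length u)) * (f (b # u @ v') * lam (b # u @ v))"
      using f uv b unfolding regular_def
      by (metis (no_types, lifting) append_Cons length_Cons lists.Cons)
    then have 1: "f (b # u @ v) / lam (b # u @ v) \<le>
        exp (R * \<gamma> ^ Suc (length u)) * (f (b # u @ v') / lam (b # u @ v'))"
      using pos' by (simp add: field_simps)
    have 2: "lam (b # u @ v) / lam (u @ v) \<le>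
        exp (K * \<gamma> ^ length u) * (lam (b # u @ v') / lam (u @ v'))"
      using distortion[OF b uv] pos' by (simp add: field_simps)
    have "\<rho> (u @ v) = f (b # u @ v) / lam (b # u @ v) * (lam (b # u @ v) / lam (u @ v)) / f [b]"
      using pos' by (simp add: \<rho>_def field_simps)
    also have "\<dots> \<le> exp (R * \<gamma> ^ Suc (length u)) * (f (b # u @ v') / lam (b # u @ v')) *
        (exp (K * \<gamma> ^ length u) * (lam (b # u @ v') / lam (u @ v'))) / f [b]"
      using 1 2 fb pos' by (intro divide_right_mono mult_mono) auto
    also have "\<dots> = exp ((R * \<gamma> + K) * \<gamma> ^ length u) * \<rho> (u @ v')"
      using pos' fb by (simp add: \<rho>_def field_simps flip: exp_add)
    finally show ?thesis unfolding R_contraction .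
  qed
  have \<rho>_Nil: "\<rho> [] = 1" using fb by (simp add: \<rho>_def lam_Nil)
  have \<rho>_ge: "exp (- (R - 1)) \<le> \<rho> u" if "u \<in> lists \<alpha>" for u
    using osc[of "[]" "[]" u] that \<rho>_Nil by (simp add: exp_minus field_simps del: minus_diff_eq)
  have step_eq: "step f b u = (\<rho> u - \<epsilon>) * lam u / (1 - \<epsilon>)" if "u \<in> lists \<alpha>" for u
    using lam_pos[OF that] by (simp add: step_def \<rho>_def field_simps)
  show ?thesis
    unfolding regular_def
  proof (intro conjI ballI)
    show "step f b [] = 1" using fb \<epsilon>_less_1 by (simp add: step_def lam_Nil)
  next
    fix u assume u: "u \<in> lists \<alpha>"
    show "0 < step f b u"
      unfolding step_eq[OF u] using \<rho>_ge[OF u] \<epsilon>_less \<epsilon>_less_1 lam_pos[OF u] by (auto intro!: mult_pos_pos divide_pos_pos)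
    have 1: "has_bochner_integral (count_space \<alpha>) (\<lambda>a. f ((b # u) @ [a])) (f (b # u))"
      using regular_append[OF f, of "b # u"] u b by simp
    have "has_bochner_integral (count_space \<alpha>)
        (\<lambda>a. ((1 / f [b]) * f ((b # u) @ [a]) - \<epsilon> * lam (u @ [a])) / (1 - \<epsilon>))
        (((1 / f [b]) * f (b # u) - \<epsilon> * lam u) / (1 - \<epsilon>))"
      by (intro has_bochner_integral_divide_zero has_bochner_integral_diff
          has_bochner_integral_mult_right 1 lam_append u)
    then show "has_bochner_integral (count_space \<alpha>) (\<lambda>a. step f b (u @ [a])) (step f b u)"
      by (simp add: step_def)
  next
    fix u v v' assume uv: "u \<in> lists \<alpha>" "v \<in> lists \<alpha>" "v' \<in> lists \<alpha>"
    let ?t = "\<gamma> ^ length u"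
    have t: "0 \<le> ?t" "?t \<le> 1" using \<gamma>_pos \<gamma>_less_1 by (auto simp: power_le_one)
    have "\<rho> (u @ v) - \<epsilon> \<le> exp ((R - 1) * ?t) * \<rho> (u @ v') - \<epsilon>"
      using osc[OF uv] by simp
    also have "\<dots> \<le> exp (R * ?t) * (\<rho> (u @ v') - \<epsilon>)"
      using t uv by (intro exp_gap \<rho>_ge) auto
    finally have 1: "\<rho> (u @ v) - \<epsilon> \<le> exp (R * ?t) * (\<rho> (u @ v') - \<epsilon>)" .
    have "(\<rho> (u @ v) - \<epsilon>) * (lam (u @ v) * lam (u @ v') / (1 - \<epsilon>)) \<le>
      exp (R * ?t) * (\<rho> (u @ v') - \<epsilon>) * (lam (u @ v) * lam (u @ v') / (1 - \<epsilon>))"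
      using uv lam_pos[of "u @ v"] lam_pos[of "u @ v'"] \<epsilon>_less_1
      by (intro mult_right_mono 1) auto
    then show "step f b (u @ v) * lam (u @ v') \<le> exp (R * ?t) * (step f b (u @ v') * lam (u @ v))"
      using uv by (simp add: step_eq ac_simps)
  qed
qed

lemma regular_le: 
  assumes "regular f" "u \<in> lists \<alpha>"
  shows "f u \<le> exp R * lam u"
proof -
  have "f ([] @ u) * lam ([] @ []) \<le> exp (R * \<gamma> ^ length ([]::'l list)) * (f ([] @ []) * lam ([] @ u))"
    using assms unfolding regular_def by blast
  moreover have "f [] = 1" using assms by (simp add: regular_def)
  ultimately show ?thesis by (simp add: lam_Nil)
qed

text \<open>The argument lists the letters of the unfinished word backwards, the latest one first, so that
reading a letter is consing.\<close>

primrec future :: "'l list \<Rightarrow> 'l list \<Rightarrow> real" where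
  "future [] = lam"
| "future (b # v) = step (future v) b"

lemma regular_future: "v \<in> lists \<alpha> \<Longrightarrow> regular (future v)"
  by (induction v) (auto intro: regular_lam regular_step)

lemma future_pos: "v \<in> lists \<alpha> \<Longrightarrow> u \<in> lists \<alpha> \<Longrightarrow> 0 < future v u"
  using regular_future by (auto simp: regular_def)

lemma future_Cons:
  assumes "v \<in> lists \<alpha>" "b \<in> \<alpha>"
  shows "future v (b # u) = future v [b] * (\<epsilon> * lam u + (1 - \<epsilon>) * future (b # v) u)"
  using future_pos[OF assms(1), of "[b]"] assms \<epsilon>_less_1 by (simp add: step_def field_simps)

definition next_letter :: "'l list \<Rightarrow> 'l pmf" where
  "next_letter v = embed_pmf (\<lambda>b. if b \<in> \<alpha> then future v [b] else 0)"

lemma pmf_next_letter: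
  assumes v: "v \<in> lists \<alpha>"
  shows "pmf (next_letter v) b = (if b \<in> \<alpha> then future v [b] else 0)"
  unfolding next_letter_def
proof (rule pmf_embed_pmf)
  show "0 \<le> (if b \<in> \<alpha> then future v [b] else 0)" for b
    using future_pos[OF v, of "[b]"] by auto
  have "has_bochner_integral (count_space \<alpha>) (\<lambda>a. future v ([] @ [a])) (future v [])"
    "future v [] = 1"
    using regular_future[OF v] unfolding regular_def by blast+
  then have hs: "has_bochner_integral (count_space \<alpha>) (\<lambda>a. future v [a]) 1" by simp
  have "(\<integral>\<^sup>+ x. ennreal (if x \<in> \<alpha> then future v [x] else 0) \<partial>count_space UNIV) =
     (\<integral>\<^sup>+ x. ennreal (future v [x]) \<partial>count_space \<alpha>)"
    by (subst nn_integral_count_space_indicator) (auto intro!: nn_integral_cong simp: indicator_def)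
  also have "\<dots> = 1"
    using hs nn_integral_eq_integral[of "count_space \<alpha>" "\<lambda>a. future v [a]"] future_pos[OF v]
    by (auto simp: has_bochner_integral_iff AE_count_space less_imp_le)
  finally show "(\<integral>\<^sup>+ x. ennreal (if x \<in> \<alpha> then future v [x] else 0) \<partial>count_space UNIV) = 1" .
qed

text \<open>The unfinished word after \<open>n\<close> letters, read backwards, conditioned on \<open>n\<close> tails.\<close>

primrec history :: "nat \<Rightarrow> 'l list pmf" where
  "history 0 = return_pmf []"
| "history (Suc n) = history n \<bind> (\<lambda>v. map_pmf (\<lambda>b. b # v) (next_letter v))"

lemma set_next_letter: "v \<in> lists \<alpha> \<Longrightarrow> set_pmf (next_letter v) = \<alpha>"
proof -
  assume v: "v \<in> lists \<alpha>"
  have "future v [b] \<noteq> 0" if "b \<in> \<alpha>" for b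
    using future_pos[OF v, of "[b]"] that by auto
  then show ?thesis by (auto simp: set_pmf_iff pmf_next_letter[OF v] split: if_splits)
qed

lemma set_history: "v \<in> set_pmf (history n) \<Longrightarrow> v \<in> lists \<alpha> \<and> length v = n"
proof (induction n arbitrary: v)
  case (Suc n)
  then obtain v' b where v': "v' \<in> set_pmf (history n)" "b \<in> set_pmf (next_letter v')" "v = b # v'"
    by auto
  with Suc.IH[of v'] set_next_letter[of v'] show ?case by auto
qed simp

lemma pmf_history_Cons:
  assumes "v \<in> lists \<alpha>" "b \<in> \<alpha>"
  shows "pmf (history (Suc n)) (b # v) = pmf (history n) v * future v [b]"
proof -
  have "ennreal (pmf (history (Suc n)) (b # v)) =
      (\<integral>\<^sup>+ v'. ennreal (pmf (map_pmf (\<lambda>b. b # v') (next_letter v')) (b # v)) \<partial>history n)"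
    by (simp add: ennreal_pmf_bind)
  also have "\<dots> = (\<integral>\<^sup>+ v'. ennreal (future v [b]) * indicator {v} v' \<partial>history n)"
  proof (intro nn_integral_cong)
    fix v'
    have "pmf (map_pmf (\<lambda>b. b # v) (next_letter v)) (b # v) = pmf (next_letter v) b"
      by (rule pmf_map_inj') (auto simp: inj_def)
    moreover have "pmf (map_pmf (\<lambda>b. b # v') (next_letter v')) (b # v) = 0" if "v' \<noteq> v"
      using that by (subst pmf_eq_0_set_pmf) auto
    ultimately show "ennreal (pmf (map_pmf (\<lambda>b. b # v') (next_letter v')) (b # v)) =
        ennreal (future v [b]) * indicator {v} v'"
      using assms by (auto simp: indicator_def pmf_next_letter)
  qed
  also have "\<dots> = ennreal (future v [b]) * ennreal (pmf (history n) v)"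
    by (simp add: nn_integral_cmult_indicator emeasure_pmf_single)
  finally show ?thesis
    using future_pos[OF assms(1), of "[b]"] assms(2) by (simp add: mult.commute flip: ennreal_mult)
qed

text \<open>The coins do not influence the letters that precede them.\<close>

lemma map_drop_history: "map_pmf (drop m) (history (m + n)) = history n"
proof (induction m)
  case 0
  then show ?case by (simp add: drop_0[abs_def] map_pmf_idI)
next
  case (Suc m)
  have "map_pmf (drop (Suc m)) (history (Suc m + n)) =
      history (m + n) \<bind> (\<lambda>v. map_pmf (\<lambda>b. drop m v) (next_letter v))"
    by (simp add: map_bind_pmf pmf.map_comp o_def)
  also have "\<dots> = map_pmf (drop m) (history (m + n))"
    by (simp add: map_pmf_def)
  finally show ?case using Suc.IH by simp
qed

text \<open>The number of tails before the first heads is geometric, and heads are possible only after a letter.\<close>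

definition word_pmf :: "'l list pmf" where
  "word_pmf = geometric_pmf \<epsilon> \<bind> (\<lambda>n. map_pmf rev (history (Suc n)))"

lemma set_word_pmf: "w \<in> set_pmf word_pmf \<Longrightarrow> w \<in> lists \<alpha> \<and> w \<noteq> []"
proof -
  assume "w \<in> set_pmf word_pmf"
  then obtain n v where "v \<in> set_pmf (history (Suc n))" "w = rev v"
    unfolding word_pmf_def by (auto simp del: history.simps)
  then show ?thesis using set_history[of v "Suc n"] by auto
qed

text \<open>The probability that \<open>v\<close>, read backwards, is a proper prefix of a random word.\<close>

definition mass :: "'l list \<Rightarrow> real" where
  "mass v = (1 - \<epsilon>) ^ length v * pmf (history (length v)) v"

lemma mass_Nil: "mass [] = 1" by (simp add: mass_def)

lemma mass_Cons:
  "v \<in> lists \<alpha> \<Longrightarrow> b \<in> \<alpha> \<Longrightarrow> mass (b # v) = (1 - \<epsilon>) * mass v * future v [b]"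
  using pmf_history_Cons[of v b "length v"] by (simp add: mass_def del: history.simps)

lemma mass_nonneg: "0 \<le> mass v"
  using \<epsilon>_less_1 by (simp add: mass_def)

lemma geometric_tail: "measure (geometric_pmf \<epsilon>) {n..} = (1 - \<epsilon>) ^ n"
proof -
  have "(\<Sum>i<n. \<epsilon> * (1 - \<epsilon>) ^ i) = 1 - (1 - \<epsilon>) ^ n"
    by (induction n) (auto simp: algebra_simps)
  moreover have "measure (geometric_pmf \<epsilon>) {..<n} = (\<Sum>i<n. \<epsilon> * (1 - \<epsilon>) ^ i)"
    using \<epsilon>_pos \<epsilon>_less_1 by (simp add: measure_measure_pmf_finite mult.commute)
  moreover have "measure (geometric_pmf \<epsilon>) (- {..<n}) = 1 - measure (geometric_pmf \<epsilon>) {..<n}"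
    using measure_pmf.prob_compl[of "{..<n}" "geometric_pmf \<epsilon>"] by (simp add: Compl_eq_Diff_UNIV)
  ultimately show ?thesis by (simp add: Compl_lessThan)
qed

lemma word_pmf_extends:
  "measure word_pmf {w. \<exists>r. r \<noteq> [] \<and> w = rev v @ r} = mass v"
proof -
  let ?A = "{w. \<exists>r. r \<noteq> [] \<and> w = rev v @ r}" and ?n = "length v"
  have 1: "emeasure (map_pmf rev (history (Suc N))) ?A =
      ennreal (pmf (history ?n) v) * indicator {?n..} N" for N
  proof (cases "?n \<le> N")
    case True
    then obtain k where k: "N = k + ?n" by (metis le_add_diff_inverse2)
    have "emeasure (map_pmf rev (history (Suc N))) ?A =
      emeasure (history (Suc N)) (rev -` ?A)" by (simp del: history.simps)
    also have "\<dots> = emeasure (history (Suc N)) (drop (Suc k) -` {v})"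
    proof (intro emeasure_eq_AE AE_pmfI)
      fix h assume h: "h \<in> set_pmf (history (Suc N))"
      then have len: "length h = Suc N" using set_history by blast
      have "rev h = rev v @ r \<longleftrightarrow> h = rev r @ v" for r
        by (metis rev_append rev_rev_ident)
      then have "h \<in> rev -` ?A \<longleftrightarrow> (\<exists>r. r \<noteq> [] \<and> h = rev r @ v)" by simp
      also have "\<dots> \<longleftrightarrow> drop (Suc k) h = v"
      proof
        assume "\<exists>r. r \<noteq> [] \<and> h = rev r @ v"
        then show "drop (Suc k) h = v" using len k by auto
      next
        assume d: "drop (Suc k) h = v"
        have "h = rev (rev (take (Suc k) h)) @ v" using d append_take_drop_id[of "Suc k" h] by simp
        moreover have "rev (take (Suc k) h) \<noteq> []" using len by auto
        ultimately show "\<exists>r. r \<noteq> [] \<and> h = rev r @ v" by blast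
      qed
      finally show "h \<in> rev -` ?A \<longleftrightarrow> h \<in> drop (Suc k) -` {v}" by simp
    qed auto
    also have "\<dots> = emeasure (map_pmf (drop (Suc k)) (history (Suc k + ?n))) {v}"
      by (simp add: k del: history.simps)
    also have "\<dots> = ennreal (pmf (history ?n) v)"
      unfolding map_drop_history by (simp add: emeasure_pmf_single)
    finally show ?thesis using True by simp
  next
    case False
    have "emeasure (map_pmf rev (history (Suc N))) ?A =
      emeasure (history (Suc N)) (rev -` ?A)" by (simp del: history.simps)
    also have "\<dots> = emeasure (history (Suc N)) {}"
    proof (intro emeasure_eq_AE AE_pmfI)
      fix h assume "h \<in> set_pmf (history (Suc N))"
      then have "length h = Suc N" using set_history by blast
      then show "h \<in> rev -` ?A \<longleftrightarrow> h \<in> {}"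
        using False by (auto dest!: arg_cong[where f = length] simp: length_greater_0_conv[symmetric]
            simp del: length_greater_0_conv)
    qed auto
    finally show ?thesis using False by simp
  qed
  have "emeasure word_pmf ?A = (\<integral>\<^sup>+ N. ennreal (pmf (history ?n) v) * indicator {?n..} N \<partial>geometric_pmf \<epsilon>)"
    unfolding word_pmf_def emeasure_bind_pmf 1 ..
  also have "\<dots> = ennreal (pmf (history ?n) v) * emeasure (geometric_pmf \<epsilon>) {?n..}"
    by (simp add: nn_integral_cmult_indicator)
  also have "\<dots> = ennreal (mass v)"
    using \<epsilon>_less_1 by (simp add: measure_pmf.emeasure_eq_measure geometric_tail mass_def mult.commute
        flip: ennreal_mult)
  finally show ?thesis by (simp add: measure_pmf.emeasure_eq_measure mass_nonneg)
qed

lemma pmf_word: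
  assumes "v \<in> lists \<alpha>" "b \<in> \<alpha>"
  shows "pmf word_pmf (rev v @ [b]) = \<epsilon> * mass v * future v [b]"
proof -
  let ?n = "length v"
  have 1: "pmf (map_pmf rev (history (Suc N))) (rev v @ [b]) =
     pmf (history (Suc ?n)) (b # v) * indicator {?n} N" for N
  proof -
    have "pmf (map_pmf rev (history (Suc N))) (rev (b # v)) = pmf (history (Suc N)) (b # v)"
      by (rule pmf_map_inj') (auto simp: inj_def)
    moreover have "pmf (history (Suc N)) (b # v) = 0" if "N \<noteq> ?n"
      using that set_history[of "b # v" "Suc N"] by (auto simp: pmf_eq_0_set_pmf simp del: history.simps)
    ultimately show ?thesis by (auto simp: indicator_def simp del: history.simps)
  qed
  have "ennreal (pmf word_pmf (rev v @ [b])) =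
      (\<integral>\<^sup>+ N. ennreal (pmf (history (Suc ?n)) (b # v)) * indicator {?n} N \<partial>geometric_pmf \<epsilon>)"
    unfolding word_pmf_def ennreal_pmf_bind 1 by (simp add: ennreal_mult' flip: ennreal_indicator)
  also have "\<dots> = ennreal (pmf (history (Suc ?n)) (b # v) * (\<epsilon> * (1 - \<epsilon>) ^ ?n))"
    using \<epsilon>_less_1 \<epsilon>_pos by (subst nn_integral_cmult_indicator)
      (simp_all add: emeasure_pmf_single ennreal_mult mult.commute del: history.simps)
  also have "\<dots> = ennreal (\<epsilon> * mass v * future v [b])"
    using pmf_history_Cons[OF assms, of ?n] by (simp add: mass_def ac_simps del: history.simps)
  finally show ?thesis using \<epsilon>_pos mass_nonneg future_pos[OF assms(1), of "[b]"] assms(2)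
    by (simp add: less_imp_le)
qed

text \<open>A bound for one letter given its history is used once per letter; the factors need not be
independent.\<close>

lemma nn_integral_history_prod:
  assumes g: "\<And>v. v \<in> lists \<alpha> \<Longrightarrow> (\<integral>\<^sup>+ b. ennreal (g b) \<partial>next_letter v) \<le> c" and g0: "\<And>b. 0 \<le> g b"
  shows "(\<integral>\<^sup>+ v. ennreal (\<Prod>b\<leftarrow>v. g b) \<partial>history n) \<le> c ^ n"
proof (induction n)
  case (Suc n)
  have g0': "0 \<le> (\<Prod>b\<leftarrow>v. g b)" for v using g0 by (induction v) auto
  have "(\<integral>\<^sup>+ v. ennreal (\<Prod>b\<leftarrow>v. g b) \<partial>history (Suc n)) =
     (\<integral>\<^sup>+ v. ennreal (\<Prod>b\<leftarrow>v. g b) * (\<integral>\<^sup>+ b. ennreal (g b) \<partial>next_letter v) \<partial>history n)"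
    using g0 g0' by (simp add: ennreal_mult nn_integral_multc mult.commute)
  also have "\<dots> \<le> (\<integral>\<^sup>+ v. ennreal (\<Prod>b\<leftarrow>v. g b) * c \<partial>history n)"
    by (intro nn_integral_mono_AE AE_pmfI mult_left_mono g) (auto dest: set_history)
  also have "\<dots> \<le> c ^ n * c" using Suc.IH by (simp add: nn_integral_multc mult_right_mono)
  finally show ?case by (simp add: mult.commute)
qed simp

lemma nn_integral_word_prod:
  assumes g: "\<And>v. v \<in> lists \<alpha> \<Longrightarrow> (\<integral>\<^sup>+ b. ennreal (g b) \<partial>next_letter v) \<le> ennreal c" and g0: "\<And>b. 0 \<le> g b"
    and c: "0 \<le> c" "(1 - \<epsilon>) * c < 1"
  shows "(\<integral>\<^sup>+ w. ennreal (\<Prod>b\<leftarrow>w. g b) \<partial>word_pmf) < \<infinity>"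
proof -
  have "(\<integral>\<^sup>+ w. ennreal (\<Prod>b\<leftarrow>w. g b) \<partial>word_pmf) =
     (\<integral>\<^sup>+ N. (\<integral>\<^sup>+ v. ennreal (\<Prod>b\<leftarrow>v. g b) \<partial>history (Suc N)) \<partial>geometric_pmf \<epsilon>)"
    unfolding word_pmf_def nn_integral_bind_pmf nn_integral_map_pmf
    by (simp add: prod_list.rev rev_map[symmetric] del: history.simps)
  also have "\<dots> \<le> (\<integral>\<^sup>+ N. ennreal (c ^ Suc N) \<partial>geometric_pmf \<epsilon>)"
    using nn_integral_history_prod[OF g g0] c by (intro nn_integral_mono) (simp add: ennreal_power del: power_Suc history.simps)
  also have "\<dots> = (\<integral>\<^sup>+ N. ennreal ((1 - \<epsilon>) ^ N * \<epsilon>) * ennreal (c ^ Suc N) \<partial>count_space UNIV)"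
    using \<epsilon>_pos \<epsilon>_less_1 by (simp add: nn_integral_measure_pmf)
  also have "\<dots> = (\<Sum>N. ennreal (c * \<epsilon> * ((1 - \<epsilon>) * c) ^ N))"
    using \<epsilon>_pos \<epsilon>_less_1 c by (simp add: nn_integral_count_space_nat power_mult_distrib ac_simps flip: ennreal_mult)
  also have "\<dots> < \<infinity>"
    using \<epsilon>_pos \<epsilon>_less_1 c by (subst suminf_ennreal2)
      (auto intro!: summable_mult summable_geometric mult_nonneg_nonneg zero_le_power)
  finally show ?thesis .
qed

end

section \<open>Markov shift towers\<close>

definition right_shift :: "(int \<Rightarrow> 'c) \<Rightarrow> int \<Rightarrow> 'c" where
  "right_shift x = (\<lambda>n. x (n - 1))"

text \<open>The tower map is invertible because the base transformation is a two-sided shift: from the base one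
returns to the top level over the previous symbol.\<close>

definition tower_map_inv :: "('c \<Rightarrow> nat) \<Rightarrow> (int \<Rightarrow> 'c) \<times> nat \<Rightarrow> (int \<Rightarrow> 'c) \<times> nat" where
  "tower_map_inv hA = (\<lambda>(x, l). if l = 0 then (right_shift x, hA (x (-1)) - 1) else (x, l - 1))"

context markov_shift_tower
begin

lemma prob_shift_measure: "prob_space (shift_measure PA)"
  unfolding shift_measure_def by (intro prob_space_PiM prob_PA)

lemma measurable_letters: "f \<in> PA \<rightarrow>\<^sub>M N \<longleftrightarrow> f \<in> space PA \<rightarrow> space N"
  by (auto simp: measurable_def sets_PA)

lemma measurable_coordinate [measurable]: "(\<lambda>x. x n) \<in> shift_measure PA \<rightarrow>\<^sub>M PA"
  unfolding shift_measure_def by measurable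

lemma space_shift_measure: "space (shift_measure PA) = {x. \<forall>n. x n \<in> space PA}"
  by (auto simp: shift_measure_def space_PiM PiE_def Pi_def)

lemma hA_measurable [measurable]: "hA \<in> PA \<rightarrow>\<^sub>M count_space UNIV"
  by (simp add: measurable_letters)

lemma measurable_shift_height [measurable]:
  "shift_height hA \<in> shift_measure PA \<rightarrow>\<^sub>M count_space UNIV"
  unfolding shift_height_def by measurable

lemma measurable_left_shift [measurable]: "left_shift \<in> shift_measure PA \<rightarrow>\<^sub>M shift_measure PA"
  unfolding shift_measure_def left_shift_def by (rule measurable_PiM_single') (auto simp: space_PiM PiE_def)

lemma measurable_right_shift [measurable]: "right_shift \<in> shift_measure PA \<rightarrow>\<^sub>M shift_measure PA"
  unfolding shift_measure_def right_shift_def by (rule measurable_PiM_single') (auto simp: space_PiM PiE_def)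

lemma distr_left_shift: "distr (shift_measure PA) (shift_measure PA) left_shift = shift_measure PA"
proof -
  have "distr (\<Pi>\<^sub>M n\<in>UNIV. PA) (\<Pi>\<^sub>M i\<in>UNIV. PA) (\<lambda>\<omega>. \<lambda>n\<in>UNIV. \<omega> (n + 1 :: int)) = (\<Pi>\<^sub>M n\<in>UNIV. PA)"
    by (rule distr_PiM_reindex) (auto simp: prob_PA inj_def)
  then show ?thesis by (simp add: shift_measure_def left_shift_def[abs_def] restrict_def)
qed

text \<open>Independence of the symbol at 0 from all others, as invariance under resampling that symbol.\<close>

lemma distr_resample:
  "distr (PA \<Otimes>\<^sub>M shift_measure PA) (shift_measure PA) (\<lambda>(c, x). x(0 := c)) = shift_measure PA"
  using distr_pair_PiM_eq_PiM[of UNIV "\<lambda>_::int. PA" 0] by (simp add: shift_measure_def prob_PA)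

text \<open>After the shift the symbol at 0 has moved to position \<open>- 1\<close>, where \<open>B\<close> does not see it; hence the
event \<open>B (left_shift x)\<close> is unaffected by resampling.\<close>

lemma emeasure_letter_future:
  assumes A: "A \<subseteq> space PA"
    and B: "Measurable.pred (shift_measure PA) B"
    and dep: "\<And>x y. (\<And>n. 0 \<le> n \<Longrightarrow> x n = y n) \<Longrightarrow> B x \<longleftrightarrow> B y"
  shows "emeasure (shift_measure PA) {x \<in> space (shift_measure PA). x 0 \<in> A \<and> B (left_shift x)} =
     emeasure PA A * emeasure (shift_measure PA) {x \<in> space (shift_measure PA). B x}"
    (is "emeasure ?P ?L = _ * emeasure _ ?B")
proof -
  interpret prob_space ?P by (rule prob_shift_measure)
  note [measurable] = B
  have A': "A \<in> sets PA" using A sets_PA by auto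
  note [measurable] = A'
  have up: "(\<lambda>(c, x). x(0 := c)) \<in> PA \<Otimes>\<^sub>M ?P \<rightarrow>\<^sub>M ?P"
    unfolding shift_measure_def
    by (rule measurable_PiM_single') (auto simp: space_PiM PiE_def split_beta' space_pair_measure)
  have "emeasure ?P ?L = emeasure (distr (PA \<Otimes>\<^sub>M ?P) ?P (\<lambda>(c, x). x(0 := c))) ?L"
    by (simp add: distr_resample)
  also have "\<dots> = emeasure (PA \<Otimes>\<^sub>M ?P) ((\<lambda>(c, x). x(0 := c)) -` ?L \<inter> space (PA \<Otimes>\<^sub>M ?P))"
    by (rule emeasure_distr[OF up]) measurable
  also have "(\<lambda>(c, x). x(0 := c)) -` ?L \<inter> space (PA \<Otimes>\<^sub>M ?P) =
      A \<times> (left_shift -` ?B \<inter> space ?P)"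
  proof -
    have "B (left_shift (x(0 := c))) \<longleftrightarrow> B (left_shift x)" for x c
      by (rule dep) (auto simp: left_shift_def)
    moreover have "left_shift x \<in> space ?P" if "x \<in> space ?P" for x
      using that by (auto simp: space_shift_measure left_shift_def)
    ultimately show ?thesis
      using A by (auto simp: space_pair_measure space_shift_measure)
  qed
  also have "emeasure (PA \<Otimes>\<^sub>M ?P) \<dots> = emeasure PA A * emeasure ?P (left_shift -` ?B \<inter> space ?P)"
    by (intro emeasure_pair_measure_Times) measurable
  also have "emeasure ?P (left_shift -` ?B \<inter> space ?P) = emeasure (distr ?P ?P left_shift) ?B"
    by (intro emeasure_distr[symmetric]) measurable
  finally show ?thesis by (simp add: distr_left_shift)
qed

lemma space_tower_measure: "space (tower_measure PA hA) = tower PA hA"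
proof -
  have "space (tower_measure PA hA) =
      space (restrict_space (shift_measure PA \<Otimes>\<^sub>M count_space UNIV) (tower PA hA))"
    unfolding tower_measure_def by (rule space_scale_measure)
  also have "\<dots> = tower PA hA"
    by (auto simp: tower_def space_restrict_space space_pair_measure)
  finally show ?thesis .
qed

lemma sets_tower_measure:
  "sets (tower_measure PA hA) =
    sets (restrict_space (shift_measure PA \<Otimes>\<^sub>M count_space UNIV) (tower PA hA))"
  by (simp add: tower_measure_def)

lemma measurable_tower_measure:
  "f \<in> tower_measure PA hA \<rightarrow>\<^sub>M N \<longleftrightarrow>
   f \<in> restrict_space (shift_measure PA \<Otimes>\<^sub>M count_space UNIV) (tower PA hA) \<rightarrow>\<^sub>M N"
  unfolding measurable_cong_sets[OF sets_tower_measure refl] ..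

lemma measurable_from_tower:
  "f \<in> shift_measure PA \<Otimes>\<^sub>M count_space UNIV \<rightarrow>\<^sub>M N \<Longrightarrow> f \<in> tower_measure PA hA \<rightarrow>\<^sub>M N"
  unfolding measurable_tower_measure by (rule measurable_restrict_space1)

lemma measurable_tower_fst [measurable]: "fst \<in> tower_measure PA hA \<rightarrow>\<^sub>M shift_measure PA"
  by (rule measurable_from_tower) simp

lemma measurable_tower_snd [measurable]: "snd \<in> tower_measure PA hA \<rightarrow>\<^sub>M count_space UNIV"
  by (rule measurable_from_tower) simp

lemma measurable_into_tower:
  assumes "(\<lambda>q. fst (f q)) \<in> N \<rightarrow>\<^sub>M shift_measure PA" "(\<lambda>q. snd (f q)) \<in> N \<rightarrow>\<^sub>M count_space UNIV"
    "\<And>q. q \<in> space N \<Longrightarrow> f q \<in> tower PA hA"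
  shows "f \<in> N \<rightarrow>\<^sub>M tower_measure PA hA"
proof -
  have "f \<in> N \<rightarrow>\<^sub>M restrict_space (shift_measure PA \<Otimes>\<^sub>M count_space UNIV) (tower PA hA)"
    using assms by (intro measurable_restrict_space2 measurable_pair) (auto simp: o_def)
  then show ?thesis
    by (subst measurable_cong_sets[OF refl sets_tower_measure])
qed

lemma tower_map_in_tower: "q \<in> tower PA hA \<Longrightarrow> tower_map hA q \<in> tower PA hA"
  using hA_pos[of "fst q 1"]
  by (cases q) (auto simp: tower_def tower_map_def space_shift_measure left_shift_def shift_height_def)

lemma tower_map_inv_in_tower: "q \<in> tower PA hA \<Longrightarrow> tower_map_inv hA q \<in> tower PA hA"
  using hA_pos[of "fst q (-1)"]
  by (cases q) (auto simp: tower_def tower_map_inv_def space_shift_measure right_shift_def shift_height_def)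

lemma tower_map_tower_map_inv: "q \<in> tower PA hA \<Longrightarrow> tower_map hA (tower_map_inv hA q) = q"
  by (auto simp: tower_def tower_map_def tower_map_inv_def shift_height_def left_shift_def right_shift_def)

lemma tower_map_inv_tower_map: "q \<in> tower PA hA \<Longrightarrow> tower_map_inv hA (tower_map hA q) = q"
  by (auto simp: tower_def tower_map_def tower_map_inv_def shift_height_def left_shift_def right_shift_def)

lemma measurable_tower_map [measurable]: "tower_map hA \<in> tower_measure PA hA \<rightarrow>\<^sub>M tower_measure PA hA"
proof (rule measurable_into_tower)
  note ms = measurable_tower_fst measurable_tower_snd
  have 1: "(\<lambda>q. if b q < shift_height hA (a q) - 1 then a q else left_shift (a q)) \<in> N \<rightarrow>\<^sub>M shift_measure PA"
    if [measurable]: "a \<in> N \<rightarrow>\<^sub>M shift_measure PA" "b \<in> N \<rightarrow>\<^sub>M count_space UNIV"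
    for N and a :: "'z \<Rightarrow> int \<Rightarrow> 'c" and b
  proof -
    have [measurable]: "b \<in> borel_measurable N"
      by (rule measurable_compose[OF that(2) borel_measurable_count_space])
    have [measurable]: "(\<lambda>q. shift_height hA (a q) - 1) \<in> borel_measurable N"
      by (rule measurable_compose[OF _ borel_measurable_count_space]) measurable
    show ?thesis by measurable
  qed
  show "(\<lambda>q. fst (tower_map hA q)) \<in> tower_measure PA hA \<rightarrow>\<^sub>M shift_measure PA"
    using 1[OF ms] by (simp add: tower_map_def split_beta' if_distrib cong: if_cong)
  have 2: "(\<lambda>q. if b q < shift_height hA (a q) - 1 then b q + 1 else 0) \<in> N \<rightarrow>\<^sub>M count_space UNIV"
    if [measurable]: "a \<in> N \<rightarrow>\<^sub>M shift_measure PA" "b \<in> N \<rightarrow>\<^sub>M count_space UNIV"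
    for N and a :: "'z \<Rightarrow> int \<Rightarrow> 'c" and b
  proof -
    have [measurable]: "b \<in> borel_measurable N"
      by (rule measurable_compose[OF that(2) borel_measurable_count_space])
    have [measurable]: "(\<lambda>q. shift_height hA (a q) - 1) \<in> borel_measurable N"
      by (rule measurable_compose[OF _ borel_measurable_count_space]) measurable
    show ?thesis by measurable
  qed
  show "(\<lambda>q. snd (tower_map hA q)) \<in> tower_measure PA hA \<rightarrow>\<^sub>M count_space UNIV"
    using 2[OF ms] by (simp add: tower_map_def split_beta' if_distrib cong: if_cong)
qed (simp add: tower_map_in_tower space_tower_measure)

lemma measurable_tower_map_inv [measurable]:
  "tower_map_inv hA \<in> tower_measure PA hA \<rightarrow>\<^sub>M tower_measure PA hA"
proof (rule measurable_into_tower)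
  note ms = measurable_tower_fst measurable_tower_snd
  have 1: "(\<lambda>q. if b q = 0 then right_shift (a q) else a q) \<in> N \<rightarrow>\<^sub>M shift_measure PA"
    if [measurable]: "a \<in> N \<rightarrow>\<^sub>M shift_measure PA" "b \<in> N \<rightarrow>\<^sub>M count_space UNIV"
    for N and a :: "'z \<Rightarrow> int \<Rightarrow> 'c" and b :: "'z \<Rightarrow> nat" by measurable
  show "(\<lambda>q. fst (tower_map_inv hA q)) \<in> tower_measure PA hA \<rightarrow>\<^sub>M shift_measure PA"
    using 1[OF ms] by (simp add: tower_map_inv_def split_beta' if_distrib cong: if_cong)
  have 2: "(\<lambda>q. if b q = 0 then hA (a q (-1)) - 1 else b q - 1) \<in> N \<rightarrow>\<^sub>M count_space UNIV"
    if [measurable]: "a \<in> N \<rightarrow>\<^sub>M shift_measure PA" "b \<in> N \<rightarrow>\<^sub>M count_space UNIV"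
    for N and a :: "'z \<Rightarrow> int \<Rightarrow> 'c" and b by measurable
  show "(\<lambda>q. snd (tower_map_inv hA q)) \<in> tower_measure PA hA \<rightarrow>\<^sub>M count_space UNIV"
    using 2[OF ms] by (simp add: tower_map_inv_def split_beta' if_distrib cong: if_cong)
qed (simp add: tower_map_inv_in_tower space_tower_measure)

abbreviation mean_height :: ennreal where
  "mean_height \<equiv> \<integral>\<^sup>+ x. of_nat (shift_height hA x) \<partial>shift_measure PA"

lemma mean_height_eq: "mean_height = (\<integral>\<^sup>+ a. of_nat (hA a) \<partial>PA)"
proof -
  have "distr (shift_measure PA) PA (\<lambda>x. x 0) = PA"
    unfolding shift_measure_def by (rule distr_PiM_component) (auto simp: prob_PA)
  then have "(\<integral>\<^sup>+ a. of_nat (hA a) \<partial>PA) = (\<integral>\<^sup>+ a. of_nat (hA a) \<partial>distr (shift_measure PA) PA (\<lambda>x. x 0))"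
    by simp
  also have "\<dots> = mean_height"
    by (subst nn_integral_distr) (auto simp: shift_height_def)
  finally show ?thesis ..
qed

lemma mean_height_finite: "mean_height < \<infinity>"
  using hA_integrable unfolding mean_height_eq
  by (simp add: integrable_iff_bounded ennreal_of_nat_eq_real_of_nat)

lemma mean_height_pos: "mean_height > 0"
proof -
  interpret prob_space "shift_measure PA" by (rule prob_shift_measure)
  have "1 = (\<integral>\<^sup>+ x. 1 \<partial>shift_measure PA)" by (simp add: emeasure_space_1)
  also have "\<dots> \<le> mean_height"
    using hA_pos by (intro nn_integral_mono) (auto simp: space_shift_measure shift_height_def Suc_le_eq)
  finally show ?thesis by (rule less_le_trans[OF zero_less_one])
qed

lemma emeasure_tower:
  assumes A: "A \<in> sets (tower_measure PA hA)"
  shows "emeasure (tower_measure PA hA) A = inverse mean_height *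
     (\<Sum>k. emeasure (shift_measure PA) {x \<in> space (shift_measure PA). (x, k) \<in> A})"
proof -
  let ?P = "shift_measure PA" and ?C = "count_space (UNIV :: nat set)"
  interpret prob_space ?P by (rule prob_shift_measure)
  interpret C: sigma_finite_measure ?C by (rule sigma_finite_measure_count_space)
  interpret pair_sigma_finite ?P ?C ..
  have A': "A \<in> sets (?P \<Otimes>\<^sub>M ?C)" "A \<subseteq> tower PA hA"
    using A tower_in_sets by (auto simp: sets_tower_measure sets_restrict_space_iff)
  have "emeasure (tower_measure PA hA) A = inverse mean_height * emeasure (?P \<Otimes>\<^sub>M ?C) A"
    using A' tower_in_sets by (simp add: tower_measure_def emeasure_restrict_space)
  also have "emeasure (?P \<Otimes>\<^sub>M ?C) A = (\<integral>\<^sup>+ k. emeasure ?P ((\<lambda>x. (x, k)) -` A) \<partial>?C)"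
    using A' by (intro emeasure_pair_measure_alt2)
  also have "\<dots> = (\<Sum>k. emeasure ?P ((\<lambda>x. (x, k)) -` A))"
    by (rule nn_integral_count_space_nat)
  also have "\<dots> = (\<Sum>k. emeasure ?P {x \<in> space ?P. (x, k) \<in> A})"
    using A'(2) by (intro suminf_cong arg_cong2[where f = emeasure]) (auto simp: tower_def)
  finally show ?thesis .
qed

lemma sets_tower_level:
  assumes "A \<in> sets (tower_measure PA hA)"
  shows "{x \<in> space (shift_measure PA). (x, k) \<in> A} \<in> sets (shift_measure PA)"
proof -
  have A': "A \<in> sets (shift_measure PA \<Otimes>\<^sub>M count_space (UNIV :: nat set))"
    using assms tower_in_sets by (auto simp: sets_tower_measure sets_restrict_space_iff)
  then have "(\<lambda>x. (x, k)) -` A \<in> sets (shift_measure PA)" by (rule sets_Pair2)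
  moreover have "(\<lambda>x. (x, k)) -` A = {x \<in> space (shift_measure PA). (x, k) \<in> A}"
    using sets.sets_into_space[OF A'] by (auto simp: space_pair_measure)
  ultimately show ?thesis by simp
qed

lemma emeasure_tower':
  assumes A: "A \<in> sets (tower_measure PA hA)"
  shows "emeasure (tower_measure PA hA) A = inverse mean_height *
     (\<integral>\<^sup>+ x. (\<Sum>k<shift_height hA x. indicator A (x, k)) \<partial>shift_measure PA)"
proof -
  have "(\<integral>\<^sup>+ x. (\<Sum>k<shift_height hA x. indicator A (x, k)) \<partial>shift_measure PA) =
    (\<integral>\<^sup>+ x. (\<Sum>k. indicator {x \<in> space (shift_measure PA). (x, k) \<in> A} x) \<partial>shift_measure PA)"
  proof (rule nn_integral_cong)
    fix x assume x: "x \<in> space (shift_measure PA)"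
    have "(\<Sum>k. indicator {x \<in> space (shift_measure PA). (x, k) \<in> A} x :: ennreal) =
      (\<Sum>k<shift_height hA x. indicator {x \<in> space (shift_measure PA). (x, k) \<in> A} x)"
      using sets.sets_into_space[OF A]
      by (intro suminf_finite) (auto simp: space_tower_measure tower_def indicator_def)
    then show "(\<Sum>k<shift_height hA x. indicator A (x, k)) =
       (\<Sum>k. indicator {x \<in> space (shift_measure PA). (x, k) \<in> A} x :: ennreal)"
      using x by (simp add: indicator_def)
  qed
  also have "\<dots> = (\<Sum>k. emeasure (shift_measure PA) {x \<in> space (shift_measure PA). (x, k) \<in> A})"
    using sets_tower_level[OF A] by (subst nn_integral_suminf) simp_all
  finally show ?thesis using emeasure_tower[OF A] by simp
qed

lemma mean_height_inverse: "inverse mean_height * mean_height = 1"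
  using mean_height_finite mean_height_pos
  by (simp add: mult.commute[of "inverse _"] ennreal_divide_self flip: divide_ennreal_def)

lemma prob_tower_measure: "prob_space (tower_measure PA hA)"
proof
  have "(\<Sum>k<n. indicator (tower PA hA) (x, k)) = (of_nat n :: ennreal)"
    if "x \<in> space (shift_measure PA)" "n = shift_height hA x" for x n
    using that by (simp add: tower_def)
  then have "(\<integral>\<^sup>+ x. (\<Sum>k<shift_height hA x. indicator (tower PA hA) (x, k)) \<partial>shift_measure PA) = mean_height"
    by (intro nn_integral_cong) blast
  then show "emeasure (tower_measure PA hA) (space (tower_measure PA hA)) = 1"
    using mean_height_inverse emeasure_tower'[OF sets.top] by (simp add: space_tower_measure)
qed

lemma measurable_fiber_sum:
  assumes E: "E \<in> sets (tower_measure PA hA)"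
  shows "(\<lambda>x. \<Sum>k<shift_height hA x. indicator E (x, k) :: ennreal) \<in> borel_measurable (shift_measure PA)"
proof -
  let ?P = "shift_measure PA"
  have "(\<lambda>x. \<Sum>k. indicator {x \<in> space ?P. (x, k) \<in> E} x :: ennreal) \<in> borel_measurable ?P"
    using sets_tower_level[OF E] by measurable
  moreover have "(\<Sum>k<shift_height hA x. indicator E (x, k) :: ennreal) =
     (\<Sum>k. indicator {x \<in> space ?P. (x, k) \<in> E} x)" if x: "x \<in> space ?P" for x
  proof -
    have "(\<Sum>k. indicator {x \<in> space ?P. (x, k) \<in> E} x :: ennreal) =
      (\<Sum>k<shift_height hA x. indicator {x \<in> space ?P. (x, k) \<in> E} x)"
      using sets.sets_into_space[OF E]
      by (intro suminf_finite) (auto simp: space_tower_measure tower_def indicator_def)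
    then show ?thesis using x by (simp add: indicator_def)
  qed
  ultimately show ?thesis by (subst measurable_cong) auto
qed

text \<open>The number of levels over \<open>x\<close> whose image lies in \<open>A\<close> differs from the number of levels that lie in
\<open>A\<close> only by a base level over \<open>left_shift x\<close> gained and one over \<open>x\<close> lost; these cancel since the
shift preserves the measure.\<close>

lemma distr_tower_map:
  "distr (tower_measure PA hA) (tower_measure PA hA) (tower_map hA) = tower_measure PA hA"
proof (rule measure_eqI)
  fix A assume "A \<in> sets (distr (tower_measure PA hA) (tower_measure PA hA) (tower_map hA))"
  then have A: "A \<in> sets (tower_measure PA hA)" by simp
  define A' where "A' = tower_map hA -` A \<inter> space (tower_measure PA hA)"
  have A': "A' \<in> sets (tower_measure PA hA)"
    unfolding A'_def using A by measurable
  let ?P = "shift_measure PA"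
  interpret prob_space ?P by (rule prob_shift_measure)
  let ?I = "\<lambda>A. \<integral>\<^sup>+ x. (\<Sum>k<shift_height hA x. indicator A (x, k)) \<partial>?P"
  let ?B = "{x \<in> space ?P. (x, 0) \<in> A}"
  have B: "?B \<in> sets ?P" using A by (rule sets_tower_level)
  have pt: "(\<Sum>k<shift_height hA x. indicator A' (x, k)) + indicator ?B x =
     (\<Sum>k<shift_height hA x. indicator A (x, k)) + (indicator ?B (left_shift x) :: ennreal)"
    if x: "x \<in> space ?P" for x
  proof -
    obtain h where h: "shift_height hA x = Suc h"
      using hA_pos[of "x 0"] x by (cases "shift_height hA x") (auto simp: shift_height_def space_shift_measure)
    have 1: "indicator A' (x, k) = (indicator A (x, Suc k) :: ennreal)" if "k < h" for k
      using that h x by (auto simp: A'_def space_tower_measure tower_def tower_map_def indicator_def)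
    have 2: "indicator A' (x, h) = (indicator ?B (left_shift x) :: ennreal)"
      using h x by (auto simp: A'_def space_tower_measure tower_def tower_map_def indicator_def
          space_shift_measure left_shift_def)
    have "(\<Sum>k<Suc h. indicator A' (x, k)) + indicator ?B x =
      (\<Sum>k<h. indicator A (x, Suc k)) + indicator ?B (left_shift x) + (indicator A (x, 0) :: ennreal)"
      using 1 2 x by (simp add: indicator_def)
    also have "\<dots> = (\<Sum>k<Suc h. indicator A (x, k)) + indicator ?B (left_shift x)"
      by (simp add: sum.lessThan_Suc_shift ac_simps del: sum.lessThan_Suc)
    finally show ?thesis by (simp add: h)
  qed
  have "(\<integral>\<^sup>+ x. indicator ?B (left_shift x) \<partial>?P) = (\<integral>\<^sup>+ x. indicator ?B x \<partial>distr ?P ?P left_shift)"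
    using B by (intro nn_integral_distr[symmetric]) simp_all
  then have sh: "(\<integral>\<^sup>+ x. indicator ?B (left_shift x) \<partial>?P) = emeasure ?P ?B"
    using B by (simp add: distr_left_shift)
  have "?I A' + emeasure ?P ?B =
      (\<integral>\<^sup>+ x. (\<Sum>k<shift_height hA x. indicator A' (x, k)) + indicator ?B x \<partial>?P)"
    using B measurable_fiber_sum[OF A'] by (simp add: nn_integral_add)
  also have "\<dots> = (\<integral>\<^sup>+ x. (\<Sum>k<shift_height hA x. indicator A (x, k)) + indicator ?B (left_shift x) \<partial>?P)"
    by (intro nn_integral_cong pt)
  also have "\<dots> = ?I A + emeasure ?P ?B"
    using B measurable_fiber_sum[OF A] sh by (subst nn_integral_add) simp_all
  finally have "?I A' = ?I A"
    by (simp add: emeasure_eq_measure)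
  then have "emeasure (tower_measure PA hA) A' = emeasure (tower_measure PA hA) A"
    using emeasure_tower'[OF A] emeasure_tower'[OF A'] by simp
  then show "emeasure (distr (tower_measure PA hA) (tower_measure PA hA) (tower_map hA)) A =
      emeasure (tower_measure PA hA) A"
    using A by (simp add: emeasure_distr A'_def)
qed simp

end

section \<open>Letters read along the tower of words\<close>

context gibbs_words
begin

lemma alphabet_nonempty: "\<alpha> \<noteq> {}"
proof
  assume "\<alpha> = {}"
  then have "has_bochner_integral (count_space \<alpha>) (\<lambda>a. lam ([] @ [a])) 0"
    by (simp add: has_bochner_integral_iff integrable_count_space lebesgue_integral_count_space_finite)
  then show False
    using has_bochner_integral_eq[OF _ lam_append[of "[]"], of 0] lam_Nil by simp
qed

definition words :: "'l list set" where "words = lists \<alpha> - {[]}"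

text \<open>Letters are sets; their words form a countable set and are coded by natural numbers. Decoding with
\<open>from_nat_into\<close> makes every code stand for an admissible nonempty word.\<close>

definition word :: "nat \<Rightarrow> 'l list" where "word = from_nat_into words"

definition code_pmf :: "nat pmf" where "code_pmf = map_pmf (to_nat_on words) word_pmf"

lemma countable_words: "countable words"
  unfolding words_def using countable_alphabet by (intro countable_Diff countable_lists)

lemma words_nonempty: "words \<noteq> {}"
proof -
  obtain a where "a \<in> \<alpha>" using alphabet_nonempty by blast
  then have "[a] \<in> words" by (simp add: words_def)
  then show ?thesis by blast
qed

lemma word_in_words: "word c \<in> words"
  unfolding word_def by (rule from_nat_into[OF words_nonempty])

lemma map_word_code_pmf: "map_pmf word code_pmf = word_pmf"
proof -
  have "word (to_nat_on words w) = w" if "w \<in> set_pmf word_pmf" for w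
    using set_word_pmf[OF that] countable_words by (simp add: word_def words_def)
  then show ?thesis
    unfolding code_pmf_def pmf.map_comp o_def by (rule map_pmf_idI)
qed

lemma emeasure_code_pmf: "emeasure code_pmf {c. word c \<in> A} = emeasure word_pmf A"
  by (subst map_word_code_pmf[symmetric]) (simp add: vimage_def)

abbreviation word_length :: "nat \<Rightarrow> nat" where "word_length c \<equiv> length (word c)"

lemma nn_integral_word_length: "(\<integral>\<^sup>+ c. of_nat (word_length c) \<partial>code_pmf) = ennreal (1 / \<epsilon>)"
proof -
  have "(\<integral>\<^sup>+ c. of_nat (word_length c) \<partial>code_pmf) =
      (\<integral>\<^sup>+ w. of_nat (length w) \<partial>map_pmf word code_pmf)"
    by (simp only: nn_integral_map_pmf)
  also have "\<dots> = (\<integral>\<^sup>+ N. (\<integral>\<^sup>+ v. of_nat (length v) \<partial>history (Suc N)) \<partial>geometric_pmf \<epsilon>)"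
    unfolding map_word_code_pmf unfolding word_pmf_def nn_integral_bind_pmf nn_integral_map_pmf
    by (simp del: history.simps)
  also have "\<dots> = (\<integral>\<^sup>+ N. (\<integral>\<^sup>+ v. of_nat (Suc N) \<partial>history (Suc N)) \<partial>geometric_pmf \<epsilon>)"
    using set_history by (intro nn_integral_cong nn_integral_cong_AE AE_pmfI) (metis)
  also have "\<dots> = (\<integral>\<^sup>+ N. ennreal (real N + 1) \<partial>geometric_pmf \<epsilon>)"
    by (intro nn_integral_cong) (simp add: measure_pmf.emeasure_space_1 ennreal_of_nat_eq_real_of_nat ennreal_plus[symmetric] add.commute
        del: history.simps ennreal_plus)
  also have "\<dots> = ennreal (measure_pmf.expectation (geometric_pmf \<epsilon>) (\<lambda>N. real N + 1))"
    using \<epsilon>_pos \<epsilon>_less_1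
    by (intro nn_integral_eq_integral Bochner_Integration.integrable_add) (auto simp: integrable_real_geometric_pmf)
  also have "measure_pmf.expectation (geometric_pmf \<epsilon>) (\<lambda>N. real N + 1) = (1 - \<epsilon>) / \<epsilon> + 1"
    using \<epsilon>_pos \<epsilon>_less_1
    by (subst Bochner_Integration.integral_add) (auto simp: integrable_real_geometric_pmf expectation_geometric_pmf)
  also have "\<dots> = 1 / \<epsilon>" using \<epsilon>_pos by (simp add: field_simps)
  finally show ?thesis .
qed

sublocale word: markov_shift_tower "measure_pmf code_pmf" word_length "1/2"
proof
  show "1 \<le> word_length c" for c
    using word_in_words[of c] by (cases "word c") (auto simp: words_def)
  show "integrable (measure_pmf code_pmf) (\<lambda>a. real (word_length a))"
    using nn_integral_word_length by (simp add: integrable_iff_bounded ennreal_of_nat_eq_real_of_nat)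
qed auto

abbreviation P :: "(int \<Rightarrow> nat) measure" where "P \<equiv> shift_measure (measure_pmf code_pmf)"

abbreviation Q :: "((int \<Rightarrow> nat) \<times> nat) measure" where
  "Q \<equiv> tower_measure (measure_pmf code_pmf) word_length"

abbreviation S :: "(int \<Rightarrow> nat) \<times> nat \<Rightarrow> (int \<Rightarrow> nat) \<times> nat" where
  "S \<equiv> tower_map word_length"

definition letter :: "(int \<Rightarrow> nat) \<times> nat \<Rightarrow> 'l" where
  "letter q = word (fst q 0) ! snd q"

text \<open>The letters met by the forward orbit in the tower begin with the given word.\<close>

primrec reads :: "'l list \<Rightarrow> (int \<Rightarrow> nat) \<times> nat \<Rightarrow> bool" where
  "reads [] q \<longleftrightarrow> True"
| "reads (b # u) q \<longleftrightarrow> letter q = b \<and> reads u (S q)"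

lemma space_P: "space P = UNIV"
  using word.space_shift_measure by simp

lemma prob_P: "prob_space P" by (rule word.prob_shift_measure)

lemma space_Q: "space Q = {(x, k). k < word_length (x 0)}"
  by (simp add: word.space_tower_measure tower_def space_P shift_height_def)

lemma letter_in_alphabet: "q \<in> space Q \<Longrightarrow> letter q \<in> \<alpha>"
  using word_in_words[of "fst q 0"] by (auto simp: space_Q letter_def words_def in_lists_conv_set)

lemma measurable_letter [measurable]: "letter \<in> Q \<rightarrow>\<^sub>M count_space UNIV"
proof -
  have "(\<lambda>q. (fst q 0, snd q)) \<in> Q \<rightarrow>\<^sub>M measure_pmf code_pmf \<Otimes>\<^sub>M count_space UNIV"
    by (intro measurable_Pair measurable_compose[OF word.measurable_tower_fst word.measurable_coordinate]
        word.measurable_tower_snd)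
  moreover have "sets (measure_pmf code_pmf \<Otimes>\<^sub>M count_space (UNIV :: nat set)) =
      sets (count_space UNIV \<Otimes>\<^sub>M count_space UNIV)"
    by (intro sets_pair_measure_cong) simp_all
  moreover have "count_space (UNIV :: nat set) \<Otimes>\<^sub>M count_space (UNIV :: nat set) = count_space UNIV"
    by (subst pair_measure_countable) auto
  ultimately have sets_eq: "sets (measure_pmf code_pmf \<Otimes>\<^sub>M count_space (UNIV :: nat set)) = sets (count_space UNIV)"
    and 1: "(\<lambda>q. (fst q 0, snd q)) \<in> Q \<rightarrow>\<^sub>M measure_pmf code_pmf \<Otimes>\<^sub>M count_space UNIV"
    by (simp_all only:)
  from 1 have "(\<lambda>q. (fst q 0, snd q)) \<in> Q \<rightarrow>\<^sub>M count_space UNIV"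
    unfolding measurable_cong_sets[OF refl sets_eq] .
  then have "(\<lambda>q. (\<lambda>(c, k). word c ! k) (fst q 0, snd q)) \<in> Q \<rightarrow>\<^sub>M count_space UNIV"
    by (rule measurable_compose) simp
  then show ?thesis by (simp add: letter_def[abs_def])
qed

lemma measurable_reads [measurable]: "Measurable.pred Q (reads u)"
proof (induction u)
  case (Cons b u)
  note [measurable] = Cons.IH
  have "Measurable.pred Q (\<lambda>q. letter q = b \<and> reads u (S q))" by measurable
  then show ?case by simp
qed simp

lemma reads_cong: "(\<And>n. 0 \<le> n \<Longrightarrow> x n = y n) \<Longrightarrow> reads u (x, k) \<longleftrightarrow> reads u (y, k)"
proof (induction u arbitrary: x y k)
  case (Cons b u)
  then have "reads u (left_shift x, k) = reads u (left_shift y, k)" for k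
    by (intro Cons.IH) (auto simp: left_shift_def)
  with Cons.IH[of x y] Cons.prems show ?case
    by (auto simp: letter_def tower_map_def shift_height_def)
qed simp

lemma sets_level:
  assumes "Measurable.pred Q A"
  shows "{x. k < word_length (x 0) \<and> A (x, k)} \<in> sets P"
proof -
  have "{q \<in> space Q. A q} \<in> sets Q" using assms by measurable
  from word.sets_tower_level[OF this, of k] show ?thesis
    by (simp add: space_P space_Q)
qed

lemma sets_reads0: "{x. reads u (x, 0)} \<in> sets P"
proof -
  have "{x. 0 < word_length (x 0) \<and> reads u (x, 0)} \<in> sets P" by (rule sets_level) measurable
  moreover have "0 < word_length c" for c using word_in_words[of c] by (auto simp: words_def)
  ultimately show ?thesis by simp
qed

lemma sets_code: "{x. A (x 0)} \<in> sets P"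
proof -
  have "(\<lambda>x. x 0) -` {c. A c} \<inter> space P \<in> sets P"
    by (rule measurable_sets[OF word.measurable_coordinate]) simp
  then show ?thesis by (simp add: space_P vimage_def)
qed

lemma sets_code_reads: "{x. word (x 0) \<in> A \<and> reads u (left_shift x, 0)} \<in> sets P"
proof -
  have "left_shift -` {x. reads u (x, 0)} \<inter> space P \<in> sets P"
    using sets_reads0 by (intro measurable_sets[OF word.measurable_left_shift])
  then have "{x. word (x 0) \<in> A} \<inter> {x. reads u (left_shift x, 0)} \<in> sets P"
    using sets_code[of "\<lambda>c. word c \<in> A"] by (intro sets.Int) (auto simp: space_P vimage_def)
  also have "{x. word (x 0) \<in> A} \<inter> {x. reads u (left_shift x, 0)} =
      {x. word (x 0) \<in> A \<and> reads u (left_shift x, 0)}" by auto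
  finally show ?thesis .
qed

lemma emeasure_code:
  "emeasure P {x. word (x 0) \<in> A} = emeasure word_pmf A"
proof -
  have "distr P (measure_pmf code_pmf) (\<lambda>x. x 0) = measure_pmf code_pmf"
    unfolding shift_measure_def by (rule distr_PiM_component) (auto intro: prob_space_measure_pmf)
  then have "emeasure code_pmf {c. word c \<in> A} =
      emeasure (distr P (measure_pmf code_pmf) (\<lambda>x. x 0)) {c. word c \<in> A}"
    by simp
  also have "\<dots> = emeasure P {x. word (x 0) \<in> A}"
    using word.measurable_coordinate[of 0] by (subst emeasure_distr) (auto simp: space_P vimage_def)
  finally show ?thesis by (simp add: emeasure_code_pmf)
qed

lemma emeasure_code_reads:
  "emeasure P {x. word (x 0) \<in> A \<and> reads u (left_shift x, 0)} =
    emeasure word_pmf A * emeasure P {x. reads u (x, 0)}"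
proof -
  have "Measurable.pred P (\<lambda>x. reads u (x, 0))"
    using sets_reads0 by (simp add: pred_def space_P)
  then have "emeasure P {x \<in> space P. x 0 \<in> {c. word c \<in> A} \<and> reads u (left_shift x, 0)} =
    emeasure code_pmf {c. word c \<in> A} * emeasure P {x \<in> space P. reads u (x, 0)}"
    by (rule word.emeasure_letter_future[rotated]) (erule reads_cong, simp)
  then show ?thesis by (simp add: space_P emeasure_code_pmf)
qed

text \<open>The event that the first word properly extends \<open>v\<close> and that the letters from the end of \<open>v\<close> onwards
begin with \<open>u\<close>. By induction on \<open>u\<close>: its first letter \<open>b\<close> either ends the word, and then the rest is
read in an independent sequence of words, or it does not, and then \<open>v\<close> is extended by \<open>b\<close>. The two
cases are the two summands in \<open>future_Cons\<close>.\<close>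

lemma emeasure_extends_reads:
  assumes "u \<in> lists \<alpha>" "v \<in> lists \<alpha>"
  shows "emeasure P {x. (\<exists>r. r \<noteq> [] \<and> word (x 0) = rev v @ r) \<and> reads u (x, length v)} =
    ennreal (mass v * future v u)"
  using assms
proof (induction u arbitrary: v rule: list.induct)
  case Nil
  have "emeasure P {x. word (x 0) \<in> {w. \<exists>r. r \<noteq> [] \<and> w = rev v @ r}} =
      emeasure word_pmf {w. \<exists>r. r \<noteq> [] \<and> w = rev v @ r}"
    by (rule emeasure_code)
  then show ?case
    using word_pmf_extends[of v] regular_Nil[OF regular_future] Nil
    by (simp add: measure_pmf.emeasure_eq_measure)
next
  case (Cons b u)
  then have u: "u \<in> lists \<alpha>" and b: "b \<in> \<alpha>" and v: "v \<in> lists \<alpha>" by auto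
  let ?A = "{x. word (x 0) \<in> {rev v @ [b]} \<and> reads u (left_shift x, 0)}"
  let ?B = "{x. (\<exists>r. r \<noteq> [] \<and> word (x 0) = rev (b # v) @ r) \<and> reads u (x, length (b # v))}"
  have word_ne: "word c \<noteq> []" for c using word_in_words[of c] by (auto simp: words_def)
  have "emeasure P {x. reads u (x, 0)} = ennreal (lam u)"
    using Cons.IH[OF u, of "[]"] word_ne by (simp add: mass_Nil)
  then have A: "emeasure P ?A = ennreal (\<epsilon> * mass v * future v [b] * lam u)"
    unfolding emeasure_code_reads
    using pmf_word[OF v b] lam_pos[OF u] future_pos[OF v, of "[b]"] b \<epsilon>_pos mass_nonneg[of v]
    by (simp add: emeasure_pmf_single ennreal_mult less_imp_le)
  have B: "emeasure P ?B = ennreal (mass (b # v) * future (b # v) u)"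
    using Cons.IH[OF u, of "b # v"] b v by simp
  have "{x. (\<exists>r. r \<noteq> [] \<and> word (x 0) = rev v @ r) \<and> reads (b # u) (x, length v)} = ?A \<union> ?B"
    (is "?L = _")
  proof (intro set_eqI)
    fix x
    show "x \<in> ?L \<longleftrightarrow> x \<in> ?A \<union> ?B"
    proof (cases "\<exists>r. r \<noteq> [] \<and> word (x 0) = rev v @ r")
      case True
      then obtain c r where "word (x 0) = rev v @ c # r" by (metis neq_Nil_conv)
      then show ?thesis
        by (cases r) (auto simp: letter_def tower_map_def shift_height_def nth_append)
    qed auto
  qed
  moreover have "?A \<inter> ?B = {}" by auto
  moreover have "?A \<in> sets P" by (rule sets_code_reads)
  moreover have "?B \<in> sets P"
  proof -
    have "{x. \<exists>r. r \<noteq> [] \<and> word (x 0) = rev (b # v) @ r} \<inter>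
        {x. length (b # v) < word_length (x 0) \<and> reads u (x, length (b # v))} \<in> sets P"
      by (intro sets.Int sets_code sets_level) measurable
    also have "{x. \<exists>r. r \<noteq> [] \<and> word (x 0) = rev (b # v) @ r} \<inter>
        {x. length (b # v) < word_length (x 0) \<and> reads u (x, length (b # v))} = ?B" by auto
    finally show ?thesis .
  qed
  ultimately have "emeasure P ?L = emeasure P ?A + emeasure P ?B"
    by (simp add: plus_emeasure)
  also have "\<dots> = ennreal (\<epsilon> * mass v * future v [b] * lam u + mass (b # v) * future (b # v) u)"
    unfolding A B using lam_pos[OF u] future_pos[OF v, of "[b]"] future_pos[of "b # v" u] b v u \<epsilon>_pos mass_nonneg
    by (intro ennreal_plus[symmetric] mult_nonneg_nonneg) (simp_all add: less_imp_le del: future.simps)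
  also have "\<epsilon> * mass v * future v [b] * lam u + mass (b # v) * future (b # v) u =
      mass v * (future v [b] * (\<epsilon> * lam u + (1 - \<epsilon>) * future (b # v) u))"
    unfolding mass_Cons[OF v b] by (simp add: algebra_simps)
  also have "\<dots> = mass v * future v (b # u)"
    by (simp only: future_Cons[OF v b, symmetric])
  finally show ?case .
qed

lemma emeasure_reads0: "u \<in> lists \<alpha> \<Longrightarrow> emeasure P {x. reads u (x, 0)} = ennreal (lam u)"
  using emeasure_extends_reads[of u "[]"] word_in_words by (auto simp: mass_Nil words_def)

lemma word_pmf_length: "emeasure word_pmf {w. length w = Suc k} = ennreal (\<epsilon> * (1 - \<epsilon>) ^ k)"
proof -
  have "emeasure word_pmf {w. length w = Suc k} =
      (\<integral>\<^sup>+ N. emeasure (map_pmf rev (history (Suc N))) {w. length w = Suc k} \<partial>geometric_pmf \<epsilon>)"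
    unfolding word_pmf_def emeasure_bind_pmf ..
  also have "\<dots> = (\<integral>\<^sup>+ N. indicator {k} N \<partial>geometric_pmf \<epsilon>)"
  proof (intro nn_integral_cong)
    fix N
    have "emeasure (map_pmf rev (history (Suc N))) {w. length w = Suc k} =
       emeasure (history (Suc N)) {v. length v = Suc k}"
      by (simp add: vimage_def del: history.simps)
    also have "\<dots> = emeasure (history (Suc N)) {v. N = k}"
      using set_history by (intro emeasure_eq_AE AE_pmfI) fastforce+
    also have "\<dots> = indicator {k} N"
      using measure_pmf.emeasure_space_1[of "history (Suc N)"] by (auto simp: indicator_def simp del: history.simps)
    finally show "emeasure (map_pmf rev (history (Suc N))) {w. length w = Suc k} = indicator {k} N" .
  qed
  also have "\<dots> = ennreal (\<epsilon> * (1 - \<epsilon>) ^ k)"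
    using \<epsilon>_pos \<epsilon>_less_1 by (simp add: emeasure_pmf_single mult.commute)
  finally show ?thesis .
qed

text \<open>The future at an inner position of a word has the law \<open>lam\<close>. Forgetting the letter at position \<open>k\<close>,
the letters after it are \<open>u\<close> with probability proportional to the sum of \<open>lam (b # u)\<close> over \<open>b\<close>, which
is \<open>lam u\<close>. A part \<open>\<epsilon>\<close> of this comes from words that end there, where the future is \<open>lam\<close> by
independence, so the same holds for the complementary part.\<close>

lemma emeasure_level_reads:
  assumes "u \<in> lists \<alpha>"
  shows "emeasure P {x. k < word_length (x 0) \<and> reads u (x, k)} = ennreal ((1 - \<epsilon>) ^ k * lam u)"
  using assms
proof (induction k arbitrary: u)
  case 0
  have "0 < word_length c" for c using word_in_words[of c] by (auto simp: words_def)
  then show ?case using emeasure_reads0[OF 0] by simp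
next
  case (Suc k)
  interpret prob_space P by (rule prob_P)
  let ?C = "{x. k < word_length (x 0) \<and> reads u (S (x, k))}"
  let ?A = "{x. word (x 0) \<in> {w. length w = Suc k} \<and> reads u (left_shift x, 0)}"
  let ?B = "{x. Suc k < word_length (x 0) \<and> reads u (x, Suc k)}"
  have "?C = (\<Union>b\<in>\<alpha>. {x. k < word_length (x 0) \<and> reads (b # u) (x, k)})"
    using letter_in_alphabet by (force simp: space_Q)
  then have "emeasure P ?C = (\<integral>\<^sup>+ b. emeasure P {x. k < word_length (x 0) \<and> reads (b # u) (x, k)} \<partial>count_space \<alpha>)"
    using countable_alphabet
    by (simp only:) (rule emeasure_UN_countable, auto simp: disjoint_family_on_def simp del: reads.simps intro!: sets_level measurable_reads, simp)
  also have "\<dots> = (\<integral>\<^sup>+ b. ennreal ((1 - \<epsilon>) ^ k) * ennreal (lam (b # u)) \<partial>count_space \<alpha>)"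
    using Suc.IH Suc.prems \<epsilon>_less_1 lam_pos
    by (intro nn_integral_cong) (simp add: ennreal_mult' del: reads.simps)
  also have "\<dots> = ennreal ((1 - \<epsilon>) ^ k) * ennreal (lam u)"
    using lam_Cons[OF Suc.prems] lam_pos Suc.prems
      nn_integral_eq_integral[of "count_space \<alpha>" "\<lambda>b. lam (b # u)"]
    by (simp add: nn_integral_cmult has_bochner_integral_iff AE_count_space less_imp_le)
  finally have C: "emeasure P ?C = ennreal ((1 - \<epsilon>) ^ k * lam u)"
    using \<epsilon>_less_1 by (simp add: ennreal_mult')
  have A: "emeasure P ?A = ennreal (\<epsilon> * (1 - \<epsilon>) ^ k * lam u)"
    unfolding emeasure_code_reads word_pmf_length emeasure_reads0[OF Suc.prems]
    using \<epsilon>_less_1 \<epsilon>_pos by (simp add: ennreal_mult'[symmetric])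
  have "?C = ?A \<union> ?B"
    by (auto simp: tower_map_def shift_height_def split: if_splits)
  moreover have "?A \<inter> ?B = {}" by auto
  moreover have "?A \<in> sets P" by (rule sets_code_reads)
  moreover have "?B \<in> sets P" by (intro sets_level) measurable
  ultimately have "emeasure P ?C = emeasure P ?A + emeasure P ?B"
    by (simp add: plus_emeasure)
  then have "measure P ?B = (1 - \<epsilon>) ^ k * lam u - \<epsilon> * (1 - \<epsilon>) ^ k * lam u"
    using A C \<epsilon>_less_1 \<epsilon>_pos lam_pos[OF Suc.prems]
    by (simp add: emeasure_eq_measure flip: ennreal_plus)
  also have "\<dots> = (1 - \<epsilon>) ^ Suc k * lam u" by (simp add: algebra_simps)
  finally show ?case by (simp add: emeasure_eq_measure)
qed

lemma emeasure_Q_reads: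
  assumes u: "u \<in> lists \<alpha>"
  shows "emeasure Q {q \<in> space Q. reads u q} = ennreal (lam u)"
proof -
  have "emeasure Q {q \<in> space Q. reads u q} =
      inverse word.mean_height * (\<Sum>k. emeasure P {x \<in> space P. (x, k) \<in> {q \<in> space Q. reads u q}})"
    by (intro word.emeasure_tower) measurable
  also have "(\<Sum>k. emeasure P {x \<in> space P. (x, k) \<in> {q \<in> space Q. reads u q}}) =
      (\<Sum>k. ennreal ((1 - \<epsilon>) ^ k * lam u))"
    using emeasure_level_reads[OF u] by (simp add: space_P space_Q)
  also have "\<dots> = ennreal (1 / \<epsilon> * lam u)"
  proof (rule suminf_ennreal_eq)
    have "(\<lambda>k. (1 - \<epsilon>) ^ k) sums (1 / (1 - (1 - \<epsilon>)))"
      using \<epsilon>_pos \<epsilon>_less_1 by (intro geometric_sums) simp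
    from sums_mult2[OF this, of "lam u"]
    show "(\<lambda>k. (1 - \<epsilon>) ^ k * lam u) sums (1 / \<epsilon> * lam u)" by simp
  qed (use \<epsilon>_less_1 lam_pos[OF u] in auto)
  also have "word.mean_height = ennreal (1 / \<epsilon>)"
    unfolding word.mean_height_eq by (rule nn_integral_word_length)
  finally show ?thesis
    using \<epsilon>_pos lam_pos[OF u] by (simp add: inverse_ennreal flip: ennreal_mult)
qed

lemma emeasure_word_letter:
  assumes "b \<in> \<alpha>"
  shows "emeasure word_pmf {w. k < length w \<and> w ! k = b} = ennreal ((1 - \<epsilon>) ^ k * lam [b])"
  using emeasure_level_reads[of "[b]" k] assms emeasure_code[of "{w. k < length w \<and> w ! k = b}"]
  by (simp add: letter_def)

end

section \<open>Cylinders and their distortion\<close>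

lemma gap_power_le:
  assumes "enat n \<le> s" "j \<le> n" "0 < \<gamma>" "\<gamma> < 1"
  shows "gap_power \<gamma> s j \<le> \<gamma> ^ (n - j)"
proof (cases s)
  case (enat k)
  then have "j \<le> k" "n - j \<le> k - j" using assms by auto
  then have "\<gamma> powi (int k - int j) = \<gamma> ^ (k - j)"
    by (simp add: of_nat_diff[symmetric] del: of_nat_diff)
  also have "\<dots> \<le> \<gamma> ^ (n - j)"
    using \<open>n - j \<le> k - j\<close> assms by (intro power_decreasing) auto
  finally show ?thesis using enat by (simp add: gap_power_def)
next
  case infinity
  then show ?thesis using assms by (simp add: gap_power_def)
qed

context nonuniformly_hyperbolic
begin

abbreviation F :: "'a \<Rightarrow> 'a" where "F \<equiv> induced_map T \<tau>"

abbreviation \<mu>c :: "'a measure" where "\<mu>c \<equiv> completion \<mu>"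

lemma space_\<mu>: "space \<mu> = Y"
  using sets_eq_imp_space_eq[OF sets_\<mu>] by (simp add: space_restrict_space)

lemma prob_\<mu>c: "prob_space \<mu>c"
proof (rule prob_spaceI)
  have "emeasure \<mu>c (space \<mu>) = emeasure \<mu> (space \<mu>)" by (simp del: space_completion)
  then show "emeasure \<mu>c (space \<mu>c) = 1" using prob_space.emeasure_space_1[OF prob_\<mu>] by simp
qed

lemma F_preserves: "F \<in> \<mu>c \<rightarrow>\<^sub>M \<mu>c" "distr \<mu>c \<mu>c F = \<mu>c"
proof -
  show "F \<in> \<mu>c \<rightarrow>\<^sub>M \<mu>c"
    using F_measurable by (rule completion.measurable_completion2) (simp add: F_preserving)
  show "distr \<mu>c \<mu>c F = \<mu>c"
    using completion.completion_distr_eq[OF F_measurable] by (simp add: F_preserving)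
qed

lemma funpow_F_preserves: "F ^^ n \<in> \<mu>c \<rightarrow>\<^sub>M \<mu>c" "distr \<mu>c \<mu>c (F ^^ n) = \<mu>c"
proof (induction n)
  case 0
  { case 1 show ?case by (simp add: id_def)
  next case 2 show ?case by (simp add: id_def distr_id2) }
next
  case (Suc n)
  { case 1 show ?case using Suc F_preserves by (auto intro: measurable_comp simp del: funpow.simps simp: funpow.simps(2))
  next case 2 
    have "distr \<mu>c \<mu>c (F ^^ Suc n) = distr (distr \<mu>c \<mu>c (F ^^ n)) \<mu>c F"
      using Suc(1) F_preserves by (subst distr_distr) (simp_all only: funpow.simps(2))
    then show ?case using Suc(2) F_preserves by (simp only:) }
qed

lemma emeasure_funpow_F:
  assumes "A \<in> sets \<mu>c"
  shows "emeasure \<mu>c ((F ^^ n) -` A \<inter> Y) = emeasure \<mu>c A"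
  using emeasure_distr[OF funpow_F_preserves(1) assms, of n] by (simp add: funpow_F_preserves space_\<mu>)

lemma funpow_F_in_Y: "y \<in> Y \<Longrightarrow> (F ^^ n) y \<in> Y"
  by (induction n) (auto intro: return)

lemma \<alpha>_subset: "a \<in> \<alpha> \<Longrightarrow> a \<subseteq> Y"
  using partition_onD1[OF \<alpha>_partition] by auto

lemma \<alpha>_disjoint: "a \<in> \<alpha> \<Longrightarrow> b \<in> \<alpha> \<Longrightarrow> y \<in> a \<Longrightarrow> y \<in> b \<Longrightarrow> a = b"
  using partition_onD2[OF \<alpha>_partition] by (auto dest: disjointD)

lemma \<alpha>_cover: "y \<in> Y \<Longrightarrow> \<exists>a\<in>\<alpha>. y \<in> a"
  using partition_onD1[OF \<alpha>_partition] by auto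

primrec cyl :: "'a set list \<Rightarrow> 'a set" where
  "cyl [] = Y"
| "cyl (a # u) = a \<inter> F -` cyl u"

lemma cyl_subset: "u \<in> lists \<alpha> \<Longrightarrow> cyl u \<subseteq> Y"
  using \<alpha>_subset by (cases u) auto

lemma cyl_sets: "u \<in> lists \<alpha> \<Longrightarrow> cyl u \<in> sets \<mu>c"
proof (induction u rule: list.induct)
  case Nil
  then show ?case using sets.top[of \<mu>c] by (simp add: space_\<mu> del: sets.top)
next
  case (Cons a u)
  then have "a \<inter> (F -` cyl u \<inter> space \<mu>c) \<in> sets \<mu>c"
    by (intro sets.Int[OF \<alpha>_measurable measurable_sets[OF F_preserves(1)]]) auto
  also have "a \<inter> (F -` cyl u \<inter> space \<mu>c) = cyl (a # u)"
    using Cons \<alpha>_subset by (auto simp: space_\<mu>)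
  finally show ?case .
qed

lemma cyl_append:
  "u \<in> lists \<alpha> \<Longrightarrow> v \<in> lists \<alpha> \<Longrightarrow> cyl (u @ v) = cyl u \<inter> (F ^^ length u) -` cyl v"
proof (induction u rule: list.induct)
  case Nil
  then show ?case using cyl_subset[of v] by auto
next
  case (Cons a u)
  then show ?case by (auto simp: funpow_swap1)
qed

lemma cyl_nth: "u \<in> lists \<alpha> \<Longrightarrow> y \<in> cyl u \<Longrightarrow> i < length u \<Longrightarrow> (F ^^ i) y \<in> u ! i"
proof (induction u arbitrary: y i rule: list.induct)
  case (Cons a u)
  then show ?case by (cases i) (auto simp: funpow_swap1)
qed simp

lemma separation_time_cyl:
  assumes u: "u \<in> lists \<alpha>" and y: "y \<in> cyl u" and z: "z \<in> cyl u"
  shows "enat (length u) \<le> separation_time F \<alpha> y z"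
  unfolding separation_time_def
proof (rule Inf_greatest)
  fix s assume "s \<in> enat ` {n. \<exists>a\<in>\<alpha>. \<exists>b\<in>\<alpha>. a \<noteq> b \<and> (F ^^ n) y \<in> a \<and> (F ^^ n) z \<in> b}"
  then obtain n a b where n: "s = enat n" "a \<in> \<alpha>" "b \<in> \<alpha>" "a \<noteq> b" "(F ^^ n) y \<in> a" "(F ^^ n) z \<in> b"
    by auto
  have "length u \<le> n"
  proof (rule ccontr)
    assume "\<not> length u \<le> n"
    then have i: "n < length u" by simp
    then have "u ! n \<in> \<alpha>" using u by (auto simp: in_lists_conv_set)
    then show False
      using \<alpha>_disjoint n cyl_nth[OF u y i] cyl_nth[OF u z i] by blast
  qed
  then show "enat (length u) \<le> s" using n by simp
qed

definition lam :: "'a set list \<Rightarrow> real" where "lam u = measure \<mu>c (cyl u)"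

lemma emeasure_cyl: "emeasure \<mu>c (cyl u) = ennreal (lam u)"
  unfolding lam_def using finite_measure.emeasure_eq_measure[OF prob_space.finite_measure[OF prob_\<mu>c]] .

lemma has_bochner_integral_partition:
  assumes B: "B \<in> sets \<mu>c"
  shows "has_bochner_integral (count_space \<alpha>) (\<lambda>a. measure \<mu>c (a \<inter> B)) (measure \<mu>c B)"
proof (rule has_bochner_integral_nn_integral)
  interpret prob_space \<mu>c by (rule prob_\<mu>c)
  have "B = (\<Union>a\<in>\<alpha>. a \<inter> B)"
    using sets.sets_into_space[OF B] \<alpha>_cover by (auto simp: space_\<mu>)
  moreover have "emeasure \<mu>c (\<Union>a\<in>\<alpha>. a \<inter> B) = (\<integral>\<^sup>+ a. emeasure \<mu>c (a \<inter> B) \<partial>count_space \<alpha>)"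
    using B \<alpha>_countable \<alpha>_measurable \<alpha>_disjoint
    by (intro emeasure_UN_countable) (auto simp: disjoint_family_on_def)
  ultimately show "(\<integral>\<^sup>+ a. ennreal (measure \<mu>c (a \<inter> B)) \<partial>count_space \<alpha>) = ennreal (measure \<mu>c B)"
    by (simp add: emeasure_eq_measure)
qed auto

lemma lam_Nil: "lam [] = 1"
  using prob_space.prob_space[OF prob_\<mu>c] by (simp add: lam_def space_\<mu>)

lemma lam_append_integral:
  assumes u: "u \<in> lists \<alpha>"
  shows "has_bochner_integral (count_space \<alpha>) (\<lambda>a. lam (u @ [a])) (lam u)"
proof -
  let ?n = "length u"
  interpret prob_space \<mu>c by (rule prob_\<mu>c)
  have "has_bochner_integral (count_space \<alpha>) (\<lambda>a. lam (u @ [a])) (lam u)"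
  proof (rule has_bochner_integral_nn_integral)
    have e: "cyl (u @ [a]) = cyl u \<inter> (F ^^ ?n) -` a" if "a \<in> \<alpha>" for a
    proof -
      have "cyl [a] = a" using \<alpha>_subset[OF that] return by auto
      then show ?thesis using cyl_append[OF u, of "[a]"] that by simp
    qed
    have "cyl u \<subseteq> (\<Union>a\<in>\<alpha>. (F ^^ ?n) -` a)"
    proof
      fix y assume "y \<in> cyl u"
      then have "(F ^^ ?n) y \<in> Y" using cyl_subset[OF u] funpow_F_in_Y by blast
      then show "y \<in> (\<Union>a\<in>\<alpha>. (F ^^ ?n) -` a)" using \<alpha>_cover by blast
    qed
    then have "cyl u = (\<Union>a\<in>\<alpha>. cyl (u @ [a]))" using e by blast
    moreover have "emeasure \<mu>c (\<Union>a\<in>\<alpha>. cyl (u @ [a])) = (\<integral>\<^sup>+ a. emeasure \<mu>c (cyl (u @ [a])) \<partial>count_space \<alpha>)"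
    proof (intro emeasure_UN_countable cyl_sets \<alpha>_countable)
      show "disjoint_family_on (\<lambda>a. cyl (u @ [a])) \<alpha>"
        unfolding disjoint_family_on_def using e \<alpha>_disjoint by blast
    qed (use u in auto)
    ultimately show "(\<integral>\<^sup>+ a. ennreal (lam (u @ [a])) \<partial>count_space \<alpha>) = ennreal (lam u)"
      by (simp add: emeasure_cyl[symmetric])
  qed (auto simp: lam_def)
  then show ?thesis .
qed

lemma lam_Cons_integral:
  assumes u: "u \<in> lists \<alpha>"
  shows "has_bochner_integral (count_space \<alpha>) (\<lambda>a. lam (a # u)) (lam u)"
proof -
  have B: "F -` cyl u \<inter> Y \<in> sets \<mu>c"
    using measurable_sets[OF F_preserves(1) cyl_sets[OF u]] by (simp add: space_\<mu>)
  have "measure \<mu>c (F -` cyl u \<inter> Y) = lam u"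
    using emeasure_funpow_F[OF cyl_sets[OF u], of 1] by (simp add: lam_def measure_def)
  moreover have "a \<inter> (F -` cyl u \<inter> Y) = cyl (a # u)" if "a \<in> \<alpha>" for a
    using \<alpha>_subset[OF that] by auto
  then have "has_bochner_integral (count_space \<alpha>) (\<lambda>a. lam (a # u)) (measure \<mu>c (F -` cyl u \<inter> Y)) \<longleftrightarrow>
      has_bochner_integral (count_space \<alpha>) (\<lambda>a. measure \<mu>c (a \<inter> (F -` cyl u \<inter> Y))) (measure \<mu>c (F -` cyl u \<inter> Y))"
    by (intro has_bochner_integral_cong) (auto simp: lam_def)
  ultimately show ?thesis
    using has_bochner_integral_partition[OF B] by simp
qed

abbreviation \<nu> :: "'a set measure" where "\<nu> \<equiv> quotient_measure \<mu> W"

abbreviation G :: "'a set \<Rightarrow> 'a set" where "G \<equiv> leaf_map F W"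

lemma W_partition: "partition_on Y W" and W_in_\<alpha>: "w \<in> W \<Longrightarrow> \<exists>a\<in>\<alpha>. w \<subseteq> a"
  using W_refines by (auto simp: refines_def)

lemma leaf_unique: "y \<in> Y \<Longrightarrow> w \<in> W \<Longrightarrow> y \<in> w \<Longrightarrow> leaf W y = w"
  unfolding leaf_def using partition_onD2[OF W_partition]
  by (intro the_equality) (auto dest: disjointD)

lemma leaf_in_W: "y \<in> Y \<Longrightarrow> leaf W y \<in> W" and in_leaf: "y \<in> Y \<Longrightarrow> y \<in> leaf W y"
proof -
  assume y: "y \<in> Y"
  then obtain w where "w \<in> W" "y \<in> w" using partition_onD1[OF W_partition] by auto
  with leaf_unique[OF y] show "leaf W y \<in> W" "y \<in> leaf W y" by auto
qed

text \<open>The leaves refine \<open>\<alpha>\<close>, hence elements of \<open>\<alpha>\<close>, and with them all cylinders, are unions of leaves.\<close>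

lemma leaf_saturated: 
  assumes "a \<in> \<alpha>" "y \<in> Y" "z \<in> a" "leaf W y = leaf W z"
  shows "y \<in> a"
proof -
  have z: "z \<in> Y" using assms \<alpha>_subset by auto
  obtain b where "b \<in> \<alpha>" "leaf W y \<subseteq> b" using W_in_\<alpha>[OF leaf_in_W[OF assms(2)]] by blast
  then show ?thesis
    using in_leaf[OF assms(2)] in_leaf[OF z] assms \<alpha>_disjoint[of a b z] by auto
qed

lemma G_leaf: "y \<in> Y \<Longrightarrow> G (leaf W y) = leaf W (F y)"
  unfolding leaf_map_def
proof (rule the_equality)
  assume y: "y \<in> Y"
  show "leaf W (F y) \<in> W \<and> F ` leaf W y \<subseteq> leaf W (F y)"
    using leaf_in_W return W_invariant y by auto
  fix w assume "w \<in> W \<and> F ` leaf W y \<subseteq> w"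
  then show "w = leaf W (F y)" using leaf_unique[OF return[OF y], of w] in_leaf[OF y] by auto
qed

lemma funpow_G_leaf: "y \<in> Y \<Longrightarrow> (G ^^ n) (leaf W y) = leaf W ((F ^^ n) y)"
  by (induction n) (auto simp: G_leaf funpow_F_in_Y)

lemma sets_\<nu>: "sets \<nu> = {B \<in> Pow W. leaf W -` B \<inter> Y \<in> sets \<mu>c}"
proof -
  let ?Q = "{B \<in> Pow W. leaf W -` B \<inter> Y \<in> sets \<mu>c}"
  have "sigma_algebra W ?Q"
    unfolding sigma_algebra_iff2
  proof (intro conjI ballI allI impI)
    fix B assume B: "B \<in> ?Q"
    have "leaf W -` (W - B) \<inter> Y = space \<mu>c - (leaf W -` B \<inter> Y)"
      using leaf_in_W by (auto simp: space_\<mu>)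
    then show "W - B \<in> ?Q" using B by auto
  next
    fix A :: "nat \<Rightarrow> 'a set set" assume "range A \<subseteq> ?Q"
    then have A: "A i \<subseteq> W" "leaf W -` A i \<inter> Y \<in> sets \<mu>c" for i by auto
    have "(\<Union>i. leaf W -` A i \<inter> Y) \<in> sets \<mu>c"
      by (rule sets.countable_nat_UN) (use A(2) in blast)
    moreover have "(\<Union>i. leaf W -` A i \<inter> Y) = leaf W -` (\<Union>i. A i) \<inter> Y" by auto
    ultimately have "leaf W -` (\<Union>i. A i) \<inter> Y \<in> sets \<mu>c" by (simp only:)
    then show "(\<Union>i. A i) \<in> ?Q" using A(1) by (intro CollectI conjI PowI UN_least)
  qed auto
  then show ?thesis
    by (simp add: quotient_measure_def space_\<mu> sigma_algebra.sets_measure_of_eq)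
qed

lemma space_\<nu>: "space \<nu> = W"
  unfolding quotient_measure_def by simp (rule space_measure_of, auto)

lemma emeasure_\<nu>:
  assumes B: "B \<in> sets \<nu>"
  shows "emeasure \<nu> B = emeasure \<mu>c (leaf W -` B \<inter> Y)"
proof -
  have m: "leaf W \<in> \<mu>c \<rightarrow>\<^sub>M \<nu>"
    using leaf_in_W by (intro measurableI) (auto simp: space_\<nu> sets_\<nu> space_\<mu>)
  have "sets \<nu> = sets (sigma W {B \<in> Pow W. leaf W -` B \<inter> space \<mu> \<in> sets \<mu>c})"
    by (simp add: quotient_measure_def)
  then have "distr \<mu>c \<nu> (leaf W) = \<nu>"
    unfolding quotient_measure_def by (intro distr_cong) simp_all
  then have "emeasure \<nu> B = emeasure (distr \<mu>c \<nu> (leaf W)) B" by simp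
  then show ?thesis using emeasure_distr[OF m B] by (simp add: space_\<mu>)
qed

definition qcyl :: "'a set list \<Rightarrow> 'a set set" where "qcyl u = leaf W ` cyl u"

lemma leaf_in_qcyl:
  assumes u: "u \<in> lists \<alpha>" and y: "y \<in> Y"
  shows "leaf W y \<in> qcyl u \<longleftrightarrow> y \<in> cyl u"
proof -
  have "y \<in> cyl u" if "u \<in> lists \<alpha>" "y \<in> Y" "z \<in> cyl u" "leaf W y = leaf W z" for y z
    using that
  proof (induction u arbitrary: y z rule: list.induct)
    case (Cons a u)
    then have "y \<in> a" using leaf_saturated[of a y z] by auto
    moreover have z: "z \<in> Y" using cyl_subset[OF Cons.prems(1)] Cons.prems(3) by blast
    then have "leaf W (F y) = leaf W (F z)"
      using Cons.prems by (metis G_leaf)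
    then have "F y \<in> cyl u"
      using Cons.prems by (intro Cons.IH[of "F y" "F z"]) (auto intro: return)
    ultimately show ?case by simp
  qed auto
  note sat = this[OF u y]
  show ?thesis
  proof
    assume "leaf W y \<in> qcyl u"
    then obtain z where "z \<in> cyl u" "leaf W y = leaf W z" unfolding qcyl_def by blast
    then show "y \<in> cyl u" by (rule sat)
  qed (simp add: qcyl_def)
qed

lemma leaf_vimage_qcyl: "u \<in> lists \<alpha> \<Longrightarrow> leaf W -` qcyl u \<inter> Y = cyl u"
  using leaf_in_qcyl[of u] cyl_subset[of u] by blast

lemma qcyl_sets:
  assumes u: "u \<in> lists \<alpha>"
  shows "qcyl u \<in> sets \<nu>"
proof -
  have "qcyl u \<subseteq> W" unfolding qcyl_def using cyl_subset[OF u] leaf_in_W by blast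
  then show ?thesis using leaf_vimage_qcyl[OF u] cyl_sets[OF u] by (simp add: sets_\<nu>)
qed

lemma emeasure_qcyl: "u \<in> lists \<alpha> \<Longrightarrow> emeasure \<nu> (qcyl u) = ennreal (lam u)"
  using emeasure_\<nu>[OF qcyl_sets] by (simp add: leaf_vimage_qcyl emeasure_cyl)

lemma separation_time_qcyl:
  assumes u: "u \<in> lists \<alpha>" and w: "w \<in> qcyl u" and z: "z \<in> qcyl u"
  shows "enat (length u) \<le> separation_time G (quotient_partition \<alpha> W) w z"
proof -
  obtain y y' where y: "y \<in> cyl u" "w = leaf W y" and y': "y' \<in> cyl u" "z = leaf W y'"
    using w z by (auto simp: qcyl_def)
  have Y: "y \<in> Y" "y' \<in> Y" using y y' cyl_subset[OF u] by auto
  have "separation_time F \<alpha> y y' \<le> separation_time G (quotient_partition \<alpha> W) w z"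
    unfolding separation_time_def
  proof (intro Inf_superset_mono image_mono subsetI CollectI)
    fix n assume "n \<in> {n. \<exists>a\<in>quotient_partition \<alpha> W. \<exists>b\<in>quotient_partition \<alpha> W.
        a \<noteq> b \<and> (G ^^ n) w \<in> a \<and> (G ^^ n) z \<in> b}"
    then obtain A B where AB: "A \<in> quotient_partition \<alpha> W" "B \<in> quotient_partition \<alpha> W" "A \<noteq> B"
      "(G ^^ n) w \<in> A" "(G ^^ n) z \<in> B" by blast
    from AB(1,2) obtain a b where "a \<in> \<alpha>" "b \<in> \<alpha>" "A = leaf W ` a" "B = leaf W ` b"
      unfolding quotient_partition_def by blast
    with AB have ab: "a \<in> \<alpha>" "b \<in> \<alpha>" "leaf W ` a \<noteq> leaf W ` b"
      "(G ^^ n) w \<in> leaf W ` a" "(G ^^ n) z \<in> leaf W ` b" by simp_all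
    have "(F ^^ n) y \<in> a"
      using ab(1,4) leaf_saturated[OF ab(1) funpow_F_in_Y[OF Y(1)]] y funpow_G_leaf[OF Y(1)] by auto
    moreover have "(F ^^ n) y' \<in> b"
      using ab(2,5) leaf_saturated[OF ab(2) funpow_F_in_Y[OF Y(2)]] y' funpow_G_leaf[OF Y(2)] by auto
    ultimately show "\<exists>a\<in>\<alpha>. \<exists>b\<in>\<alpha>. a \<noteq> b \<and> (F ^^ n) y \<in> a \<and> (F ^^ n) y' \<in> b"
      using ab by blast
  qed
  with separation_time_cyl[OF u y(1) y'(1)] show ?thesis by simp
qed

text \<open>On a set where \<open>G\<close> is injective with measurable images, the measure of images is countably additive,
so that the value of \<open>measure_of\<close> is the intended one.\<close>

lemma emeasure_comp_measure:
  assumes A: "A \<in> sets \<nu>" and inj: "inj_on G A"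
    and im: "\<And>B. B \<in> sets \<nu> \<Longrightarrow> B \<subseteq> A \<Longrightarrow> G ` B \<in> sets \<nu>"
    and B: "B \<in> sets \<nu>" "B \<subseteq> A"
  shows "emeasure (comp_measure \<nu> G A) B = emeasure \<nu> (G ` B)"
    and "sets (comp_measure \<nu> G A) = sets (restrict_space \<nu> A)"
proof -
  have spA: "space (restrict_space \<nu> A) = A"
    using sets.sets_into_space[OF A] by (auto simp: space_restrict_space)
  have subA: "sets (restrict_space \<nu> A) \<subseteq> Pow A"
    using sets.space_closed[of "restrict_space \<nu> A"] by (simp add: spA)
  show sets: "sets (comp_measure \<nu> G A) = sets (restrict_space \<nu> A)"
    using sets.sigma_sets_eq[of "restrict_space \<nu> A"] subA
    by (simp add: comp_measure_def spA)
  show "emeasure (comp_measure \<nu> G A) B = emeasure \<nu> (G ` B)"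
  proof (rule emeasure_measure_of[OF comp_measure_def subA])
    show "B \<in> sets (comp_measure \<nu> G A)"
      using B A by (simp add: sets sets_restrict_space_iff)
    show "positive (sets (comp_measure \<nu> G A)) (\<lambda>B. emeasure \<nu> (G ` B))"
      by (simp add: positive_def)
    show "countably_additive (sets (comp_measure \<nu> G A)) (\<lambda>B. emeasure \<nu> (G ` B))"
    proof (rule countably_additiveI)
      fix E :: "nat \<Rightarrow> 'a set set"
      assume E: "range E \<subseteq> sets (comp_measure \<nu> G A)" "disjoint_family E"
      have "E i \<in> sets (restrict_space \<nu> A)" for i using range_subsetD[OF E(1), of i] by (simp only: sets)
      then have E': "E i \<in> sets \<nu>" "E i \<subseteq> A" for i
        using A by (auto simp: sets_restrict_space_iff)
      have "disjoint_family (\<lambda>i. G ` E i)"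
        using E(2) E'(2) inj unfolding disjoint_family_on_def
        by (metis (no_types) image_empty inj_on_image_Int)
      then show "(\<Sum>i. emeasure \<nu> (G ` E i)) = emeasure \<nu> (G ` (\<Union>i. E i))"
        using im E' by (subst suminf_emeasure) (auto simp: image_UN)
    qed
  qed
qed

text \<open>The function \<open>\<zeta>\<close> relates the measures of a cylinder and of its image, which up to null sets is the
cylinder without its first letter. On the cylinder of \<open>a # u\<close> two values of \<open>\<zeta>\<close> differ by a factor that
is controlled by the separation time, hence bounds of \<open>\<zeta>\<close> there are bounds of ratios of \<open>lam\<close>. If
\<open>[a]\<close> had measure zero, so would its image, which has full measure.\<close>

lemma jacobian_cylinder:
  assumes a: "a \<in> \<alpha>"
  obtains \<zeta> :: "'a set \<Rightarrow> real" where
    "\<And>w. w \<in> qcyl [a] \<Longrightarrow> 0 < \<zeta> w"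
    "\<And>u w z. u \<in> lists \<alpha> \<Longrightarrow> w \<in> qcyl (a # u) \<Longrightarrow> z \<in> qcyl (a # u) \<Longrightarrow>
      \<zeta> w \<le> exp (K * \<gamma> ^ length u) * \<zeta> z"
    "\<And>u c. u \<in> lists \<alpha> \<Longrightarrow> (\<And>w. w \<in> qcyl (a # u) \<Longrightarrow> \<zeta> w \<le> c) \<Longrightarrow> 0 \<le> c \<Longrightarrow> lam (a # u) \<le> c * lam u"
    "\<And>u c. u \<in> lists \<alpha> \<Longrightarrow> (\<And>w. w \<in> qcyl (a # u) \<Longrightarrow> c \<le> \<zeta> w) \<Longrightarrow> 0 \<le> c \<Longrightarrow> c * lam u \<le> lam (a # u)"
    "0 < lam [a]"
proof -
  let ?a = "leaf W ` a"
  have qa: "?a = qcyl [a]"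
    using \<alpha>_subset[OF a] return by (force simp: qcyl_def)
  have "?a \<in> quotient_partition \<alpha> W" using a by (auto simp: quotient_partition_def)
  then obtain N N' \<zeta> where
    N: "N \<in> null_sets \<nu>" and N': "N' \<in> null_sets \<nu>"
    and bij: "bij_betw G (?a - N) (W - N')"
    and im': "\<forall>B\<in>sets \<nu>. B \<subseteq> ?a - N \<longrightarrow> G ` B \<in> sets \<nu>"
    and jac: "inverse_jacobian \<nu> G (?a - N) \<zeta>"
    and pos: "\<forall>y\<in>?a. 0 < \<zeta> y"
    and ln: "\<forall>y\<in>?a. \<forall>z\<in>?a. \<bar>ln (\<zeta> y) - ln (\<zeta> z)\<bar> \<le> K * gap_power \<gamma>
             (separation_time G (quotient_partition \<alpha> W) y z) 0"
    by (rule jacobian[THEN bexE], elim bexE exE conjE) (rule that)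
  have im: "G ` B \<in> sets \<nu>" if "B \<in> sets \<nu>" "B \<subseteq> ?a - N" for B using im' that by simp
  define A where "A = ?a - N"
  define \<kappa> where "\<kappa> = comp_measure \<nu> G A"
  have A: "A \<in> sets \<nu>" unfolding A_def qa using qcyl_sets[of "[a]"] a N by auto
  have inj: "inj_on G A" using bij by (simp add: bij_betw_def A_def)
  have GA: "G ` A = W - N'" using bij by (simp add: bij_betw_def A_def)
  note \<kappa> = emeasure_comp_measure[OF A inj im[folded A_def], folded \<kappa>_def]
  have sets_\<kappa>: "sets \<kappa> = sets (restrict_space \<nu> A)" using \<kappa>(2)[of "{}"] by simp
  have \<zeta>_meas: "\<zeta> \<in> borel_measurable \<kappa>"
    using jac unfolding inverse_jacobian_def A_def[symmetric] by (simp add: measurable_cong_sets[OF sets_\<kappa> refl])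
  have dens: "density \<kappa> (\<lambda>x. ennreal (\<zeta> x)) = restrict_space \<nu> A"
    using jac unfolding inverse_jacobian_def A_def[symmetric] \<kappa>_def by simp
  have \<nu>_eq: "emeasure \<nu> B = (\<integral>\<^sup>+ w. ennreal (\<zeta> w) * indicator B w \<partial>\<kappa>)"
    if B: "B \<in> sets \<nu>" "B \<subseteq> A" for B
  proof -
    have "B \<in> sets \<kappa>" using B A by (simp add: sets_\<kappa> sets_restrict_space_iff)
    then have "emeasure (density \<kappa> (\<lambda>x. ennreal (\<zeta> x))) B = (\<integral>\<^sup>+ w. ennreal (\<zeta> w) * indicator B w \<partial>\<kappa>)"
      using \<zeta>_meas by (intro emeasure_density) auto
    then show ?thesis using B A by (simp add: dens emeasure_restrict_space)
  qed
  have cyl_image: "emeasure \<nu> (qcyl (a # u) - N) = ennreal (lam (a # u))"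
      "emeasure \<kappa> (qcyl (a # u) - N) = ennreal (lam u)"
      "qcyl (a # u) - N \<in> sets \<nu>" "qcyl (a # u) - N \<subseteq> A" if u: "u \<in> lists \<alpha>" for u
  proof -
    have au: "a # u \<in> lists \<alpha>" using a u by simp
    show B: "qcyl (a # u) - N \<in> sets \<nu>" using qcyl_sets[OF au] N by auto
    show B': "qcyl (a # u) - N \<subseteq> A" by (auto simp: A_def qcyl_def)
    show "emeasure \<nu> (qcyl (a # u) - N) = ennreal (lam (a # u))"
      using emeasure_qcyl[OF au] emeasure_Diff_null_set[OF N qcyl_sets[OF au]] by simp
    have "G ` (qcyl (a # u) - N) = qcyl u - N'"
    proof (intro equalityI subsetI)
      fix w' assume "w' \<in> G ` (qcyl (a # u) - N)"
      then obtain y where y: "y \<in> cyl (a # u)" "leaf W y \<notin> N" "w' = G (leaf W y)"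
        by (auto simp: qcyl_def)
      then have yY: "y \<in> Y" using cyl_subset[OF au] by blast
      have "w' \<in> W - N'" using y GA by (auto simp: A_def)
      moreover have "w' \<in> qcyl u" using y G_leaf[OF yY] by (auto simp: qcyl_def)
      ultimately show "w' \<in> qcyl u - N'" by simp
    next
      fix w' assume w': "w' \<in> qcyl u - N'"
      then have "w' \<in> W - N'" using sets.sets_into_space[OF qcyl_sets[OF u]] by (auto simp: space_\<nu>)
      then obtain y where y: "y \<in> a" "leaf W y \<notin> N" "w' = G (leaf W y)"
        unfolding GA[symmetric] by (auto simp: A_def)
      have yY: "y \<in> Y" using y \<alpha>_subset[OF a] by blast
      have "F y \<in> cyl u"
        using w' y(3) G_leaf[OF yY] leaf_in_qcyl[OF u return[OF yY]] by simp
      then show "w' \<in> G ` (qcyl (a # u) - N)"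
        using y by (auto simp: qcyl_def)
    qed
    then show "emeasure \<kappa> (qcyl (a # u) - N) = ennreal (lam u)"
      using \<kappa>(1)[OF _ _ B B'] emeasure_qcyl[OF u] emeasure_Diff_null_set[OF N' qcyl_sets[OF u]] by simp
  qed
  have in\<kappa>: "qcyl (a # u) - N \<in> sets \<kappa>" if "u \<in> lists \<alpha>" for u
    using cyl_image(3,4)[OF that] A by (simp add: sets_\<kappa> sets_restrict_space_iff)
  show thesis
  proof
    show "0 < \<zeta> w" if "w \<in> qcyl [a]" for w using pos that qa by auto
    show "\<zeta> w \<le> exp (K * \<gamma> ^ length u) * \<zeta> z"
      if u: "u \<in> lists \<alpha>" and w: "w \<in> qcyl (a # u)" and z: "z \<in> qcyl (a # u)" for u w z
    proof -
      have wz: "w \<in> ?a" "z \<in> ?a" using w z by (auto simp: qcyl_def)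
      have au: "a # u \<in> lists \<alpha>" using a u by simp
      have "gap_power \<gamma> (separation_time G (quotient_partition \<alpha> W) w z) 0 \<le> \<gamma> ^ (Suc (length u) - 0)"
        using separation_time_qcyl[OF au w z] \<gamma>_bounds by (intro gap_power_le) auto
      also have "\<dots> \<le> \<gamma> ^ length u"
        using \<gamma>_bounds by (intro power_decreasing) auto
      finally have "K * gap_power \<gamma> (separation_time G (quotient_partition \<alpha> W) w z) 0 \<le> K * \<gamma> ^ length u"
        using K_ge_1 by (intro mult_left_mono) auto
      then have "ln (\<zeta> w) \<le> K * \<gamma> ^ length u + ln (\<zeta> z)"
        using ln wz by (smt (verit))
      then have "exp (ln (\<zeta> w)) \<le> exp (K * \<gamma> ^ length u + ln (\<zeta> z))" by (subst exp_le_cancel_iff)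
      then show ?thesis using pos wz by (simp add: exp_add)
    qed
    show "lam (a # u) \<le> c * lam u"
      if u: "u \<in> lists \<alpha>" and c: "\<And>w. w \<in> qcyl (a # u) \<Longrightarrow> \<zeta> w \<le> c" "0 \<le> c" for u c
    proof -
      have "ennreal (lam (a # u)) = (\<integral>\<^sup>+ w. ennreal (\<zeta> w) * indicator (qcyl (a # u) - N) w \<partial>\<kappa>)"
        using \<nu>_eq[OF cyl_image(3,4)[OF u]] cyl_image(1)[OF u] by simp
      also have "\<dots> \<le> (\<integral>\<^sup>+ w. ennreal c * indicator (qcyl (a # u) - N) w \<partial>\<kappa>)"
        using c by (intro nn_integral_mono) (auto simp: indicator_def intro!: ennreal_leI)
      also have "\<dots> = ennreal (c * lam u)"
        using cyl_image(2)[OF u] in\<kappa>[OF u] c by (simp add: nn_integral_cmult_indicator ennreal_mult')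
      finally show ?thesis using c by (simp add: lam_def)
    qed
    show "c * lam u \<le> lam (a # u)"
      if u: "u \<in> lists \<alpha>" and c: "\<And>w. w \<in> qcyl (a # u) \<Longrightarrow> c \<le> \<zeta> w" "0 \<le> c" for u c
    proof -
      have "ennreal (c * lam u) = (\<integral>\<^sup>+ w. ennreal c * indicator (qcyl (a # u) - N) w \<partial>\<kappa>)"
        using cyl_image(2)[OF u] in\<kappa>[OF u] c by (simp add: nn_integral_cmult_indicator ennreal_mult')
      also have "\<dots> \<le> (\<integral>\<^sup>+ w. ennreal (\<zeta> w) * indicator (qcyl (a # u) - N) w \<partial>\<kappa>)"
        using c by (intro nn_integral_mono) (auto simp: indicator_def intro!: ennreal_leI)
      also have "\<dots> = ennreal (lam (a # u))"
        using \<nu>_eq[OF cyl_image(3,4)[OF u]] cyl_image(1)[OF u] by simp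
      finally show ?thesis using c by (simp add: lam_def)
    qed
    show "0 < lam [a]"
    proof (rule ccontr)
      assume "\<not> 0 < lam [a]"
      then have "lam [a] = 0" by (simp add: lam_def less_le)
      have in\<kappa>': "qcyl [a] - N \<in> sets \<kappa>" using in\<kappa>[of "[]"] by simp
      have "(\<integral>\<^sup>+ w. ennreal (\<zeta> w) * indicator (qcyl [a] - N) w \<partial>\<kappa>) = 0"
        using \<nu>_eq[OF cyl_image(3,4)[of "[]"]] cyl_image(1)[of "[]"] \<open>lam [a] = 0\<close> by simp
      then have "AE w in \<kappa>. ennreal (\<zeta> w) * indicator (qcyl [a] - N) w = 0"
        using \<zeta>_meas in\<kappa>' by (subst (asm) nn_integral_0_iff_AE) auto
      then have "AE w in \<kappa>. w \<notin> qcyl [a] - N"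
        using pos qa by (auto elim!: eventually_mono simp: indicator_def split: if_splits)
      then have "emeasure \<kappa> (qcyl [a] - N) = 0"
        using AE_iff_null_sets[OF in\<kappa>'] by auto
      then show False using cyl_image(2)[of "[]"] by (simp add: lam_Nil)
    qed
  qed
qed

text \<open>Comparing both measures with the value of \<open>\<zeta>\<close> at one point of the cylinder of \<open>a # u\<close> costs the
distortion twice.\<close>

lemma lam_distortion:
  assumes a: "a \<in> \<alpha>" and u: "u \<in> lists \<alpha>" and v: "v \<in> lists \<alpha>" and v': "v' \<in> lists \<alpha>"
  shows "lam (a # u @ v) * lam (u @ v') \<le> exp (2 * K * \<gamma> ^ length u) * (lam (a # u @ v') * lam (u @ v))"
proof (cases "cyl (a # u @ v) = {}")
  case True
  then have "lam (a # u @ v) = 0" by (simp add: lam_def del: cyl.simps)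
  then show ?thesis by (simp add: lam_def)
next
  case False
  obtain \<zeta> where \<zeta>: 
    "\<And>w. w \<in> qcyl [a] \<Longrightarrow> 0 < \<zeta> w"
    "\<And>u w z. u \<in> lists \<alpha> \<Longrightarrow> w \<in> qcyl (a # u) \<Longrightarrow> z \<in> qcyl (a # u) \<Longrightarrow>
      \<zeta> w \<le> exp (K * \<gamma> ^ length u) * \<zeta> z"
    "\<And>u c. u \<in> lists \<alpha> \<Longrightarrow> (\<And>w. w \<in> qcyl (a # u) \<Longrightarrow> \<zeta> w \<le> c) \<Longrightarrow> 0 \<le> c \<Longrightarrow> lam (a # u) \<le> c * lam u"
    "\<And>u c. u \<in> lists \<alpha> \<Longrightarrow> (\<And>w. w \<in> qcyl (a # u) \<Longrightarrow> c \<le> \<zeta> w) \<Longrightarrow> 0 \<le> c \<Longrightarrow> c * lam u \<le> lam (a # u)"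
    by (rule jacobian_cylinder[OF a]) blast
  have uv: "u @ v \<in> lists \<alpha>" "u @ v' \<in> lists \<alpha>" using u v v' by auto
  have sub: "qcyl (a # u @ v) \<subseteq> qcyl (a # u)" if "v \<in> lists \<alpha>" for v
    using cyl_append[of "a # u" v] a u that by (auto simp: qcyl_def)
  have "qcyl (a # u @ v) \<noteq> {}" using False by (simp add: qcyl_def del: cyl.simps)
  then obtain z where z: "z \<in> qcyl (a # u)" using sub[OF v] by blast
  then have "z \<in> qcyl [a]" using cyl_append[of "[a]" u] a u by (auto simp: qcyl_def)
  then have z0: "0 < \<zeta> z" by (rule \<zeta>)
  let ?e = "exp (K * \<gamma> ^ length u)"
  have 1: "lam (a # u @ v) \<le> ?e * \<zeta> z * lam (u @ v)"
    using sub[OF v] \<zeta>(2)[OF u _ z] z0 by (intro \<zeta>(3) uv) auto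
  have 2: "\<zeta> z / ?e * lam (u @ v') \<le> lam (a # u @ v')"
    using sub[OF v'] \<zeta>(2)[OF u z] z0 by (intro \<zeta>(4) uv) (auto simp: field_simps)
  have nn: "0 \<le> lam u" for u by (simp add: lam_def)
  have "lam (a # u @ v) * lam (u @ v') \<le> ?e * \<zeta> z * lam (u @ v) * lam (u @ v')"
    using 1 nn by (intro mult_right_mono)
  also have "\<dots> = ?e * ?e * lam (u @ v) * (\<zeta> z / ?e * lam (u @ v'))" by (simp add: field_simps)
  also have "\<dots> \<le> ?e * ?e * lam (u @ v) * lam (a # u @ v')"
    using 2 nn by (intro mult_left_mono) auto
  also have "?e * ?e = exp (2 * K * \<gamma> ^ length u)" by (simp flip: exp_add)
  finally show ?thesis by (simp add: ac_simps)
qed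

lemma lam_positive: "u \<in> lists \<alpha> \<Longrightarrow> 0 < lam u"
proof (induction u rule: list.induct)
  case (Cons a u)
  then have a: "a \<in> \<alpha>" and u: "u \<in> lists \<alpha>" by auto
  have "0 < lam [a]" by (rule jacobian_cylinder[OF a])
  then have "0 < lam ([a] @ []) * lam ([] @ u)" using Cons.IH u by simp
  also have "\<dots> \<le> exp (2 * K * \<gamma> ^ length ([] :: 'a set list)) * (lam (a # [] @ u) * lam ([] @ []))"
    using lam_distortion[OF a _ _ u, of "[]" "[]"] by simp
  finally show ?case by (simp add: zero_less_mult_iff lam_Nil)
qed (simp add: lam_Nil)

lemma gibbs_words_lam: "gibbs_words \<alpha> lam (2 * K) \<gamma>"
proof (rule gibbs_words.intro)
  show "0 \<le> 2 * K" using K_ge_1 by simp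
  show "countable \<alpha>" by (rule \<alpha>_countable)
  show "lam [] = 1" by (rule lam_Nil)
  show "0 < \<gamma>" "\<gamma> < 1" by (rule \<gamma>_bounds)+
  show "0 < lam u" if "u \<in> lists \<alpha>" for u by (rule lam_positive[OF that])
  show "has_bochner_integral (count_space \<alpha>) (\<lambda>a. lam (u @ [a])) (lam u)" if "u \<in> lists \<alpha>" for u
    by (rule lam_append_integral[OF that])
  show "has_bochner_integral (count_space \<alpha>) (\<lambda>a. lam (a # u)) (lam u)" if "u \<in> lists \<alpha>" for u
    by (rule lam_Cons_integral[OF that])
  show "lam (a # u @ v) * lam (u @ v') \<le> exp (2 * K * \<gamma> ^ length u) * (lam (a # u @ v') * lam (u @ v))"
    if "a \<in> \<alpha>" "u \<in> lists \<alpha>" "v \<in> lists \<alpha>" "v' \<in> lists \<alpha>" for a u v v'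
    by (rule lam_distortion[OF that])
qed

end

sublocale nonuniformly_hyperbolic \<subseteq> gibbs: gibbs_words \<alpha> lam "2 * K" \<gamma>
  by (rule gibbs_words_lam)

section \<open>Compact sets in Lebesgue spaces\<close>

lemma completion_inner_compact:
  fixes \<rho> :: "real measure"
  assumes sets: "sets \<rho> = sets borel" and fin: "finite_measure \<rho>"
    and E: "E \<in> sets (completion \<rho>)" and e: "0 < e"
  obtains C where "compact C" "C \<subseteq> E" "measure (completion \<rho>) (E - C) < e"
proof -
  interpret \<rho>: finite_measure \<rho> by (rule fin)
  interpret c: finite_measure "completion \<rho>"
    by (rule finite_measureI) (use \<rho>.emeasure_finite in simp)
  let ?B = "main_part \<rho> E"
  have B: "?B \<in> sets borel" using main_part_sets[OF E] sets by simp
  have reg: "emeasure \<rho> ?B = (SUP K\<in>{K. K \<subseteq> ?B \<and> compact K}. emeasure \<rho> K)"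
    using \<rho>.emeasure_finite by (intro inner_regular[OF sets _ B]) simp
  have "\<exists>K. K \<subseteq> ?B \<and> compact K \<and> measure \<rho> ?B < measure \<rho> K + e"
  proof (cases "measure \<rho> ?B < e")
    case True
    then show ?thesis by (intro exI[of _ "{}"]) auto
  next
    case False
    then have "ennreal (measure \<rho> ?B - e) < emeasure \<rho> ?B"
      using e by (simp add: \<rho>.emeasure_eq_measure ennreal_less_iff)
    then obtain K where "K \<subseteq> ?B" "compact K" "ennreal (measure \<rho> ?B - e) < emeasure \<rho> K"
      unfolding reg less_SUP_iff by auto
    then show ?thesis
      using False by (intro exI[of _ K]) (auto simp: \<rho>.emeasure_eq_measure ennreal_less_iff)
  qed
  then obtain K where K: "K \<subseteq> ?B" "compact K" "measure \<rho> ?B < measure \<rho> K + e" by blast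
  have Kb: "K \<in> sets \<rho>" using K(2) sets by (simp add: compact_imp_closed)
  have KE: "K \<subseteq> E" using K(1) main_part_null_part_Un[OF E] by blast
  have "measure (completion \<rho>) (E - K) = measure (completion \<rho>) E - measure (completion \<rho>) K"
    using E Kb KE by (intro c.finite_measure_Diff) auto
  also have "measure (completion \<rho>) E = measure \<rho> ?B"
    using E by (simp add: measure_def)
  also have "measure (completion \<rho>) K = measure \<rho> K"
    using Kb by (simp add: measure_def)
  finally show thesis using K that[of K] KE by simp
qed

text \<open>Lusin's theorem for the isomorphism with an interval and atoms: off a set of small measure the space
is the image of a compact set of real numbers, in which the preimages of countably many prescribed
sets are relatively clopen.\<close>

lemma lebesgue_space_compact_parametrization:
  fixes M :: "'a measure" and S :: "nat \<Rightarrow> 'a set"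
  assumes leb: "lebesgue_space M" and prob: "prob_space M"
    and S: "\<And>i. S i \<in> sets (completion M)" and e: "0 < e"
  obtains D :: "real set" and \<psi> :: "real \<Rightarrow> 'a" where
    "compact D" "\<psi> ` D \<in> sets (completion M)" "1 - e < measure (completion M) (\<psi> ` D)"
    "\<And>i. closed {t \<in> D. \<psi> t \<in> S i}" "\<And>i. closed {t \<in> D. \<psi> t \<notin> S i}"
proof -
  obtain c p where \<rho>: "prob_space (interval_with_atoms c p)"
    and iso: "isomorphic_mod_0 (completion M) (completion (interval_with_atoms c p))"
    using leb unfolding lebesgue_space_def by blast
  define \<rho>' where "\<rho>' = interval_with_atoms c p"
  have sets_\<rho>: "sets \<rho>' = sets borel"
    using sets.sigma_sets_eq[of "borel :: real measure"] by (simp add: \<rho>'_def interval_with_atoms_def)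
  have space_\<rho>: "space \<rho>' = UNIV" using sets_eq_imp_space_eq[OF sets_\<rho>] by simp
  interpret \<rho>: prob_space \<rho>' using \<rho> by (simp add: \<rho>'_def)
  interpret M: prob_space M by (rule prob)
  have "emeasure (completion \<rho>') (space \<rho>') = 1" "emeasure (completion M) (space M) = 1"
    using \<rho>.emeasure_space_1 M.emeasure_space_1 by (simp_all del: space_completion)
  then interpret c: prob_space "completion \<rho>'" by (intro prob_spaceI) simp
  obtain A B \<phi> where A: "A \<in> null_sets (completion M)" and B: "B \<in> null_sets (completion \<rho>')"
    and bij: "bij_betw \<phi> (space M - A) (UNIV - B)"
    and meas: "\<forall>E. E \<subseteq> space M - A \<longrightarrow> (E \<in> sets (completion M) \<longleftrightarrow> \<phi> ` E \<in> sets (completion \<rho>'))"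
    and pres: "\<forall>E\<in>sets (completion M). E \<subseteq> space M - A \<longrightarrow>
       emeasure (completion \<rho>') (\<phi> ` E) = emeasure (completion M) E"
    using iso unfolding isomorphic_mod_0_def \<rho>'_def[symmetric] space_completion space_\<rho>
    by (elim bexE exE conjE) (rule that)
  define \<psi> where "\<psi> = inv_into (space M - A) \<phi>"
  have inj: "inj_on \<phi> (space M - A)" and im: "\<phi> ` (space M - A) = - B"
    using bij by (auto simp: bij_betw_def Compl_eq_Diff_UNIV)
  have \<psi>_in: "\<psi> t \<in> space M - A" and \<phi>\<psi>: "\<phi> (\<psi> t) = t" if "t \<notin> B" for t
    using that im inv_into_into[of t \<phi> "space M - A"] f_inv_into_f[of t \<phi> "space M - A"]
    by (auto simp: \<psi>_def)
  define U where "U i = \<phi> ` (S i - A)" for i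
  have SM: "S i \<subseteq> space M" for i using sets.sets_into_space[OF S[of i]] by simp
  have U_sets: "U i \<in> sets (completion \<rho>')" for i
  proof -
    have "S i - A \<in> sets (completion M)" using S[of i] A by auto
    moreover have "S i - A \<subseteq> space M - A" using SM by auto
    ultimately show ?thesis using meas by (auto simp: U_def)
  qed
  have in_U: "\<psi> t \<in> S i \<longleftrightarrow> t \<in> U i" if "t \<notin> B" for t i
  proof
    assume "\<psi> t \<in> S i"
    then have "\<phi> (\<psi> t) \<in> U i" using \<psi>_in[OF that] by (auto simp: U_def)
    then show "t \<in> U i" by (simp add: \<phi>\<psi>[OF that])
  next
    assume "t \<in> U i"
    then obtain x where x: "x \<in> S i - A" "t = \<phi> x" by (auto simp: U_def)
    have "x \<in> space M - A" using x SM by blast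
    then have "\<psi> t = x" unfolding \<psi>_def x(2) by (rule inv_into_f_f[OF inj])
    then show "\<psi> t \<in> S i" using x by simp
  qed
  let ?\<rho> = "completion \<rho>'"
  have fin: "finite_measure \<rho>'" by (rule \<rho>.finite_measure)
  have B_sets: "B \<in> sets ?\<rho>" using B by auto
  have "UNIV - B \<in> sets ?\<rho>" using sets.compl_sets[OF B_sets] by (simp add: space_\<rho>)
  then obtain D0 where D0: "compact D0" "D0 \<subseteq> UNIV - B" "measure ?\<rho> (UNIV - B - D0) < e / 2"
    using completion_inner_compact[OF sets_\<rho> fin, of "UNIV - B" "e / 2"] e by auto
  have "\<exists>C C'. compact C \<and> compact C' \<and> C \<subseteq> U i \<and> C' \<subseteq> - U i \<and>
      measure ?\<rho> (- (C \<union> C')) \<le> e / 2 * (1 / 2) ^ Suc i" for i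
  proof -
    have nU: "- U i \<in> sets ?\<rho>" using sets.compl_sets[OF U_sets[of i]] by (simp add: space_\<rho> Compl_eq_Diff_UNIV)
    have e': "0 < e / 2 * (1 / 2) ^ Suc i / 2" using e by simp
    obtain C where C: "compact C" "C \<subseteq> U i" "measure ?\<rho> (U i - C) < e / 2 * (1 / 2) ^ Suc i / 2"
      by (rule completion_inner_compact[OF sets_\<rho> fin U_sets e'])
    obtain C' where C': "compact C'" "C' \<subseteq> - U i" "measure ?\<rho> (- U i - C') < e / 2 * (1 / 2) ^ Suc i / 2"
      by (rule completion_inner_compact[OF sets_\<rho> fin nU e'])
    have cs: "C \<in> sets ?\<rho>" "C' \<in> sets ?\<rho>"
      using C C' sets_\<rho> by (auto intro!: sets_completionI_sets simp: compact_imp_closed)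
    have "measure ?\<rho> (- (C \<union> C')) \<le> measure ?\<rho> ((U i - C) \<union> (- U i - C'))"
      using cs U_sets[of i] nU by (intro c.finite_measure_mono sets.Un sets.Diff) auto
    also have "\<dots> \<le> measure ?\<rho> (U i - C) + measure ?\<rho> (- U i - C')"
      using cs U_sets[of i] nU by (intro measure_Un_le sets.Diff)
    finally have "measure ?\<rho> (- (C \<union> C')) \<le> e / 2 * (1 / 2) ^ Suc i" using C(3) C'(3) by linarith
    then show ?thesis using C C' by blast
  qed
  then obtain C C' where C: "\<And>i. compact (C i)" "\<And>i. compact (C' i)" "\<And>i. C i \<subseteq> U i" "\<And>i. C' i \<subseteq> - U i"
      "\<And>i. measure ?\<rho> (- (C i \<union> C' i)) \<le> e / 2 * (1 / 2) ^ Suc i"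
    by metis
  define D where "D = D0 \<inter> (\<Inter>i. C i \<union> C' i)"
  have D_compact: "compact D"
    unfolding D_def using C(1,2) D0(1)
    by (intro compact_Int_closed closed_INT ballI closed_Un) (auto simp: compact_imp_closed)
  have DB: "t \<notin> B" if "t \<in> D" for t using that D0(2) by (auto simp: D_def)
  have D_sets: "D \<in> sets ?\<rho>" using D_compact sets_\<rho> by (auto intro!: sets_completionI_sets simp: compact_imp_closed)
  have K_sets: "- (C i \<union> C' i) \<in> sets ?\<rho>" for i
    using C(1,2)[of i] sets_\<rho> by (intro sets_completionI_sets) (auto simp: compact_imp_closed)
  have sm: "(\<lambda>i. e / 2 * (1 / 2) ^ Suc i) sums (e / 2 * 1)"
    by (rule sums_mult) (rule power_half_series)
  have summ: "summable (\<lambda>i. measure ?\<rho> (- (C i \<union> C' i)))"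
    using C(5) by (intro summable_comparison_test'[OF sums_summable[OF sm], of 0]) auto
  have UN_sets: "(\<Union>i. - (C i \<union> C' i)) \<in> sets ?\<rho>"
    by (rule sets.countable_nat_UN) (use K_sets in blast)
  have "D0 \<in> sets ?\<rho>"
    using D0(1) sets_\<rho> by (intro sets_completionI_sets) (simp add: compact_imp_closed)
  then have D0_sets: "UNIV - B - D0 \<in> sets ?\<rho>" using \<open>UNIV - B \<in> sets ?\<rho>\<close> by (rule sets.Diff[rotated])
  have "measure ?\<rho> (UNIV - D) \<le> measure ?\<rho> (B \<union> ((UNIV - B - D0) \<union> (\<Union>i. - (C i \<union> C' i))))"
    by (intro c.finite_measure_mono sets.Un B_sets D0_sets UN_sets) (auto simp: D_def)
  also have "\<dots> \<le> measure ?\<rho> B + measure ?\<rho> ((UNIV - B - D0) \<union> (\<Union>i. - (C i \<union> C' i)))"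
    by (intro measure_Un_le sets.Un B_sets D0_sets UN_sets)
  also have "measure ?\<rho> ((UNIV - B - D0) \<union> (\<Union>i. - (C i \<union> C' i))) \<le>
      measure ?\<rho> (UNIV - B - D0) + measure ?\<rho> (\<Union>i. - (C i \<union> C' i))"
    by (intro measure_Un_le D0_sets UN_sets)
  also have "measure ?\<rho> (\<Union>i. - (C i \<union> C' i)) \<le> (\<Sum>i. measure ?\<rho> (- (C i \<union> C' i)))"
    using K_sets summ by (intro c.finite_measure_subadditive_countably) auto
  also have "\<dots> \<le> (\<Sum>i. e / 2 * (1 / 2) ^ Suc i)"
    by (intro suminf_le summ sums_summable[OF sm] C(5))
  also have "\<dots> = e / 2" using sums_unique[OF sm] by simp
  also have "measure ?\<rho> B = 0" using B by (simp add: measure_def null_sets_def)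
  finally have "measure ?\<rho> (UNIV - D) < e" using D0(3) by simp
  then have D_meas: "1 - e < measure ?\<rho> D"
    using c.prob_compl[OF D_sets] by (simp add: space_\<rho>)
  have \<psi>D: "\<psi> ` D \<subseteq> space M - A" using \<psi>_in DB by auto
  have \<phi>D: "\<phi> ` \<psi> ` D = D" using \<phi>\<psi> DB by (force simp: image_image)
  show thesis
  proof (rule that)
    show "compact D" by fact
    show s: "\<psi> ` D \<in> sets (completion M)" using meas \<psi>D \<phi>D D_sets by simp
    show "1 - e < measure (completion M) (\<psi> ` D)"
    proof -
      have "emeasure ?\<rho> (\<phi> ` \<psi> ` D) = emeasure (completion M) (\<psi> ` D)" using pres s \<psi>D by blast
      then show ?thesis using D_meas unfolding measure_def \<phi>D by (simp only:)
    qed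
    show "closed {t \<in> D. \<psi> t \<in> S i}" for i
    proof -
      have "{t \<in> D. \<psi> t \<in> S i} = D \<inter> C i"
        using in_U[OF DB] C(3)[of i] C(4)[of i] unfolding D_def by blast
      then show ?thesis using D_compact C(1) by (simp add: compact_imp_closed closed_Int)
    qed
    show "closed {t \<in> D. \<psi> t \<notin> S i}" for i
    proof -
      have "{t \<in> D. \<psi> t \<notin> S i} = D \<inter> C' i"
        using in_U[OF DB] C(3)[of i] C(4)[of i] unfolding D_def by blast
      then show ?thesis using D_compact C(2) by (simp add: compact_imp_closed closed_Int)
    qed
  qed
qed

context nonuniformly_hyperbolic
begin

lemma contraction:
  assumes u: "u \<in> lists \<alpha>" and y: "y \<in> cyl u" and z: "z \<in> cyl u" and j: "j \<le> length u"
  shows "dist ((F ^^ j) y) ((F ^^ j) z) \<le> K * (\<gamma> ^ (length u - j) + \<gamma> ^ j)"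
proof -
  have "dist ((F ^^ j) y) ((F ^^ j) z) \<le> K * (gap_power \<gamma> (separation_time F \<alpha> y z) j + \<gamma> ^ j)"
    using y z cyl_subset[OF u] by (intro hyperbolic) auto
  also have "\<dots> \<le> K * (\<gamma> ^ (length u - j) + \<gamma> ^ j)"
    using separation_time_cyl[OF u y z] K_ge_1 \<gamma>_bounds j
    by (intro mult_left_mono add_right_mono gap_power_le) auto
  finally show ?thesis .
qed

lemma itinerary_exists: "y \<in> Y \<Longrightarrow> \<exists>u\<in>lists \<alpha>. length u = n \<and> y \<in> cyl u"
proof (induction n arbitrary: y)
  case 0
  then show ?case by (intro bexI[of _ "[]"]) auto
next
  case (Suc n)
  obtain u where u: "u \<in> lists \<alpha>" "length u = n" "F y \<in> cyl u"
    using Suc.IH[OF return[OF Suc.prems]] by blast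
  obtain a where a: "a \<in> \<alpha>" "y \<in> a" using \<alpha>_cover[OF Suc.prems] by blast
  show ?case using u a by (intro bexI[of _ "a # u"]) auto
qed

lemma countable_itineraries: "countable (lists \<alpha>)"
  using \<alpha>_countable by (rule countable_lists)

lemma borel_in_\<mu>: "B \<in> sets borel \<Longrightarrow> B \<inter> Y \<in> sets \<mu>"
  by (auto simp: sets_\<mu> sets_restrict_space)

lemma value_on_\<tau>: "a \<in> \<alpha> \<Longrightarrow> y \<in> a \<Longrightarrow> value_on \<tau> a = \<tau> y"
proof -
  assume a: "a \<in> \<alpha>" "y \<in> a"
  then obtain c where "\<forall>x\<in>a. \<tau> x = c" using \<tau>_constant by (auto simp: constant_on_def)
  then have "\<tau> ` a = {\<tau> y}" using a by auto
  then show ?thesis by (simp add: value_on_def)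
qed

lemma value_on_\<tau>_pos: "a \<in> \<alpha> \<Longrightarrow> 1 \<le> value_on \<tau> a"
proof -
  assume a: "a \<in> \<alpha>"
  then obtain y where "y \<in> a" using partition_onD3[OF \<alpha>_partition] by (metis ex_in_conv)
  then show ?thesis using a value_on_\<tau>[OF a] \<tau>_pos \<alpha>_subset by auto
qed

lemma space_m: "space m = UNIV"
  using sets_eq_imp_space_eq[OF sets_m] by simp

lemma funpow_T_measurable [measurable]: "T ^^ k \<in> borel_measurable borel"
  using T_measurable by (induction k) (auto simp: id_def intro: measurable_comp)

lemma letter_inter_sets:
  assumes "a \<in> \<alpha>" "A \<in> sets borel"
  shows "a \<inter> (T ^^ k) -` A \<in> sets \<mu>c"
proof -
  have "(T ^^ k) -` A \<in> sets borel"
    using measurable_sets[OF funpow_T_measurable assms(2)] by simp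
  then have "(T ^^ k) -` A \<inter> Y \<in> sets \<mu>c" by (intro sets_completionI_sets borel_in_\<mu>)
  then have "a \<inter> ((T ^^ k) -` A \<inter> Y) \<in> sets \<mu>c" using \<alpha>_measurable[OF assms(1)] by blast
  also have "a \<inter> ((T ^^ k) -` A \<inter> Y) = a \<inter> (T ^^ k) -` A" using \<alpha>_subset[OF assms(1)] by auto
  finally show ?thesis .
qed

abbreviation mean_return :: ennreal where "mean_return \<equiv> \<integral>\<^sup>+ y. of_nat (\<tau> y) \<partial>\<mu>c"

lemma emeasure_m:
  assumes A: "A \<in> sets borel"
  shows "emeasure m A = (\<integral>\<^sup>+ a. (\<Sum>k<value_on \<tau> a. emeasure \<mu>c (a \<inter> (T ^^ k) -` A)) \<partial>count_space \<alpha>) / mean_return"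
proof -
  have "emeasure (distr (restrict_space \<mu>c a) m (T ^^ k)) A = emeasure \<mu>c (a \<inter> (T ^^ k) -` A)"
    if a: "a \<in> \<alpha>" for a k
  proof -
    have aY: "a \<inter> space \<mu>c = a" using \<alpha>_subset[OF a] by (auto simp: space_\<mu>)
    have "T ^^ k \<in> restrict_space \<mu>c a \<rightarrow>\<^sub>M m"
    proof (rule measurableI)
      fix B assume "B \<in> sets m"
      then have B: "a \<inter> (T ^^ k) -` B \<in> sets \<mu>c" using letter_inter_sets[OF a] by (simp add: sets_m)
      have "(T ^^ k) -` B \<inter> space (restrict_space \<mu>c a) = a \<inter> (T ^^ k) -` B"
        using aY by (auto simp: space_restrict_space)
      then show "(T ^^ k) -` B \<inter> space (restrict_space \<mu>c a) \<in> sets (restrict_space \<mu>c a)"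
        using B \<alpha>_measurable[OF a] aY by (simp add: sets_restrict_space_iff)
    qed (simp add: space_m)
    then have "emeasure (distr (restrict_space \<mu>c a) m (T ^^ k)) A =
        emeasure (restrict_space \<mu>c a) ((T ^^ k) -` A \<inter> space (restrict_space \<mu>c a))"
      using A by (intro emeasure_distr) (simp_all add: sets_m)
    also have "(T ^^ k) -` A \<inter> space (restrict_space \<mu>c a) = a \<inter> (T ^^ k) -` A"
      using aY by (auto simp: space_restrict_space)
    also have "emeasure (restrict_space \<mu>c a) (a \<inter> (T ^^ k) -` A) = emeasure \<mu>c (a \<inter> (T ^^ k) -` A)"
      using \<alpha>_measurable[OF a] aY by (intro emeasure_restrict_space) auto
    finally show ?thesis .
  qed
  then show ?thesis
    using A by (subst m_eq) (auto simp: sets_m intro!: arg_cong2[where f = divide] nn_integral_cong sum.cong)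
qed

lemma mean_return_ge_1: "1 \<le> mean_return"
proof -
  interpret prob_space \<mu>c by (rule prob_\<mu>c)
  have "1 = (\<integral>\<^sup>+ y. 1 \<partial>\<mu>c)" using emeasure_space_1 by simp
  also have "\<dots> \<le> mean_return"
    using \<tau>_pos by (intro nn_integral_mono) (auto simp: space_\<mu> Suc_le_eq simp flip: of_nat_Suc)
  finally show ?thesis .
qed

lemma emeasure_partition:
  assumes B: "B \<in> sets \<mu>c"
  shows "(\<integral>\<^sup>+ a. emeasure \<mu>c (a \<inter> B) \<partial>count_space \<alpha>) = emeasure \<mu>c B"
proof -
  have "B = (\<Union>a\<in>\<alpha>. a \<inter> B)"
    using sets.sets_into_space[OF B] \<alpha>_cover by (auto simp: space_\<mu>)
  moreover have "emeasure \<mu>c (\<Union>a\<in>\<alpha>. a \<inter> B) = (\<integral>\<^sup>+ a. emeasure \<mu>c (a \<inter> B) \<partial>count_space \<alpha>)"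
  proof (intro emeasure_UN_countable \<alpha>_countable)
    show "disjoint_family_on (\<lambda>a. a \<inter> B) \<alpha>"
      unfolding disjoint_family_on_def using \<alpha>_disjoint by blast
  qed (use B \<alpha>_measurable in auto)
  ultimately show ?thesis by simp
qed

text \<open>The bottom level of the formula for \<open>m\<close> contributes \<open>\<mu>\<close> up to the normalisation. This transfers
null sets and small sets from \<open>m\<close>, for which the space is Lebesgue, to \<open>\<mu>\<close>.\<close>

lemma \<mu>_le_m:
  assumes A: "A \<in> sets borel"
  shows "emeasure \<mu>c (A \<inter> Y) \<le> mean_return * emeasure m A"
proof -
  have AY: "A \<inter> Y \<in> sets \<mu>c" using borel_in_\<mu>[OF A] by (rule sets_completionI_sets)
  have "emeasure \<mu>c (A \<inter> Y) = (\<integral>\<^sup>+ a. emeasure \<mu>c (a \<inter> (A \<inter> Y)) \<partial>count_space \<alpha>)"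
    using emeasure_partition[OF AY] by simp
  also have "\<dots> \<le> (\<integral>\<^sup>+ a. (\<Sum>k<value_on \<tau> a. emeasure \<mu>c (a \<inter> (T ^^ k) -` A)) \<partial>count_space \<alpha>)"
  proof (intro nn_integral_mono)
    fix a assume "a \<in> space (count_space \<alpha>)"
    then have a: "a \<in> \<alpha>" by simp
    have "a \<inter> (A \<inter> Y) = a \<inter> (T ^^ 0) -` A" using \<alpha>_subset[OF a] by auto
    then have "emeasure \<mu>c (a \<inter> (A \<inter> Y)) = (\<Sum>k\<in>{0}. emeasure \<mu>c (a \<inter> (T ^^ k) -` A))" by simp
    also have "\<dots> \<le> (\<Sum>k<value_on \<tau> a. emeasure \<mu>c (a \<inter> (T ^^ k) -` A))"
      using value_on_\<tau>_pos[OF a] by (intro sum_mono2) auto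
    finally show "emeasure \<mu>c (a \<inter> (A \<inter> Y)) \<le> \<dots>" .
  qed
  also have "\<dots> = mean_return * emeasure m A"
    unfolding emeasure_m[OF A] using mean_return_ge_1 \<tau>_integrable
    by (subst ennreal_mult_divide_eq[symmetric]) (auto simp: ennreal_times_divide mult.commute)
  finally show ?thesis .
qed

text \<open>The image of \<open>F ^^ j\<close> is covered by the images of the countably many cylinders of length \<open>2 * j\<close>, all
of which have small diameter; and this image has full measure because \<open>F\<close> preserves \<open>\<mu>\<close>.\<close>

lemma separable_approx:
  obtains Q where "countable Q" "emeasure \<mu>c ((\<Union>q\<in>Q. cball q (2 * K * \<gamma> ^ j)) \<inter> Y) = 1"
proof -
  interpret prob_space \<mu>c by (rule prob_\<mu>c)
  define z where "z u = (F ^^ j) (SOME z. z \<in> cyl u)" for u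
  define Q where "Q = z ` {u \<in> lists \<alpha>. length u = 2 * j}"
  have Q: "countable Q"
    unfolding Q_def using countable_itineraries by (intro countable_image) (rule countable_subset[rotated], auto)
  let ?V = "\<Union>q\<in>Q. cball q (2 * K * \<gamma> ^ j)"
  have "?V \<in> sets borel" using Q by (intro sets.countable_UN'') auto
  then have V: "?V \<inter> Y \<in> sets \<mu>c" by (intro sets_completionI_sets borel_in_\<mu>)
  have "(F ^^ j) y \<in> ?V" if y: "y \<in> Y" for y
  proof -
    obtain u where u: "u \<in> lists \<alpha>" "length u = 2 * j" "y \<in> cyl u"
      using itinerary_exists[OF y, of "2 * j"] by blast
    have "(SOME z. z \<in> cyl u) \<in> cyl u" using u(3) by (rule someI)
    from contraction[OF u(1) this u(3), of j] u(2)
    have "dist (z u) ((F ^^ j) y) \<le> 2 * K * \<gamma> ^ j" by (simp add: z_def)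
    then show ?thesis using u by (auto simp: Q_def)
  qed
  then have "(F ^^ j) -` (?V \<inter> Y) \<inter> Y = Y" using funpow_F_in_Y by auto
  then have "emeasure \<mu>c (?V \<inter> Y) = emeasure \<mu>c Y"
    using emeasure_funpow_F[OF V, of j] by simp
  then show thesis using that[OF Q] emeasure_space_1 by (simp add: space_\<mu>)
qed

lemma separable_support:
  obtains Q M0 where "countable Q" "Q \<noteq> {}" "M0 \<in> sets borel" "emeasure \<mu>c (M0 \<inter> Y) = 1"
    "\<And>x e. x \<in> M0 \<Longrightarrow> 0 < e \<Longrightarrow> \<exists>q\<in>Q. dist q x < e"
proof -
  interpret prob_space \<mu>c by (rule prob_\<mu>c)
  have "\<exists>Q. countable Q \<and> emeasure \<mu>c ((\<Union>q\<in>Q. cball q (2 * K * \<gamma> ^ j)) \<inter> Y) = 1" for j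
    using separable_approx[of j] by blast
  then obtain Q where Q: "\<And>j. countable (Q j)" "\<And>j. emeasure \<mu>c ((\<Union>q\<in>Q j. cball q (2 * K * \<gamma> ^ j)) \<inter> Y) = 1"
    by metis
  let ?V = "\<lambda>j. \<Union>q\<in>Q j. cball q (2 * K * \<gamma> ^ j)"
  have V: "?V j \<in> sets borel" for j using Q(1)[of j] by (intro sets.countable_UN'') auto
  have VY: "?V j \<inter> Y \<in> sets \<mu>c" for j by (intro sets_completionI_sets borel_in_\<mu> V)
  have "AE y in \<mu>c. y \<in> ?V j \<inter> Y" for j
    using AE_in_set_eq_1[OF VY, of j] Q(2)[of j] by (simp add: emeasure_eq_measure)
  then have "AE y in \<mu>c. \<forall>j. y \<in> ?V j \<inter> Y" by (subst AE_all_countable) simp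
  then have ae: "AE y in \<mu>c. y \<in> (\<Inter>j. ?V j) \<inter> Y" by eventually_elim auto
  have M0: "(\<Inter>j. ?V j) \<in> sets borel" using V by blast
  have "emeasure \<mu>c ((\<Inter>j. ?V j) \<inter> Y) = 1"
    using AE_in_set_eq_1[OF sets_completionI_sets[OF borel_in_\<mu>[OF M0]]] ae by (simp add: emeasure_eq_measure)
  moreover have "\<exists>q\<in>(\<Union>j. Q j). dist q x < e" if x: "x \<in> (\<Inter>j. ?V j)" and e: "0 < e" for x e
  proof -
    have "(\<lambda>j. 2 * K * \<gamma> ^ j) \<longlonglongrightarrow> 2 * K * 0"
      using \<gamma>_bounds by (intro tendsto_mult tendsto_const LIMSEQ_power_zero) auto
    then have "eventually (\<lambda>j. 2 * K * \<gamma> ^ j < e) sequentially"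
      using e by (intro order_tendstoD) auto
    then obtain j where "2 * K * \<gamma> ^ j < e" by (auto simp: eventually_sequentially)
    moreover have "x \<in> ?V j" using x by blast
    ultimately show ?thesis by force
  qed
  moreover have "(\<Union>j. Q j) \<noteq> {}"
  proof
    assume "(\<Union>j. Q j) = {}"
    then have "?V 0 \<inter> Y = {}" by auto
    then show False using Q(2)[of 0] by simp
  qed
  ultimately show thesis using that[of "\<Union>j. Q j", OF _ _ M0] Q(1) by auto
qed

text \<open>Sets that are measurable for the completion of \<open>\<mu>\<close> need not be so for the completion of \<open>m\<close>; they are
replaced by Borel sets that agree with them off \<open>\<mu>\<close>-null Borel sets, and the latter are removed from
the compact set. Adding balls around a countable dense set to the family makes the parametrization
continuous.\<close>

lemma lusin:
  fixes S :: "nat \<Rightarrow> 'a set"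
  assumes S: "\<And>i. S i \<in> sets \<mu>c" and e: "0 < e"
  obtains C where "compact C" "C \<subseteq> Y" "1 - e < measure \<mu>c C"
    "\<And>i. closed (C \<inter> S i)" "\<And>i. closed (C - S i)"
proof -
  interpret prob_space \<mu>c by (rule prob_\<mu>c)
  interpret m: prob_space m by (rule prob_m)
  have "\<exists>B Z. B \<in> sets borel \<and> Z \<in> sets borel \<and> emeasure \<mu>c (Z \<inter> Y) = 0 \<and>
      (\<forall>y\<in>Y - Z. y \<in> S i \<longleftrightarrow> y \<in> B)" for i
  proof -
    have "main_part \<mu> (S i) \<in> sets \<mu>" by (rule main_part_sets[OF S])
    then obtain B where B: "B \<in> sets borel" "main_part \<mu> (S i) = B \<inter> Y"
      by (auto simp: sets_\<mu> sets_restrict_space)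
    obtain N where N: "N \<in> null_sets \<mu>" "null_part \<mu> (S i) \<subseteq> N" using null_part[OF S] by blast
    then obtain Z where Z: "Z \<in> sets borel" "N = Z \<inter> Y"
      by (auto simp: sets_\<mu> sets_restrict_space null_sets_def)
    have "emeasure \<mu>c (Z \<inter> Y) = 0"
      using N Z(2) null_sets_completionI[of N \<mu>] by (auto simp: null_sets_def)
    moreover have "\<forall>y\<in>Y - Z. y \<in> S i \<longleftrightarrow> y \<in> B"
      using main_part_null_part_Un[OF S, of i] B(2) N(2) Z(2) by blast
    ultimately show ?thesis using B Z by blast
  qed
  then obtain B Z where B: "\<And>i. B i \<in> sets borel" and Z: "\<And>i. Z i \<in> sets borel"
    and Z0: "\<And>i. emeasure \<mu>c (Z i \<inter> Y) = 0" and SB: "\<And>i. \<forall>y\<in>Y - Z i. y \<in> S i \<longleftrightarrow> y \<in> B i"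
    by metis
  define Z' where "Z' = (\<Union>i. Z i)"
  have Z': "Z' \<in> sets borel" unfolding Z'_def using Z by blast
  have Z'0: "measure \<mu>c (Z' \<inter> Y) = 0"
  proof -
    have "Z i \<inter> Y \<in> null_sets \<mu>c" for i
      using Z0[of i] sets_completionI_sets[OF borel_in_\<mu>[OF Z[of i]]] by (auto simp: null_sets_def)
    then have "(\<Union>i. Z i \<inter> Y) \<in> null_sets \<mu>c" by (rule null_sets_UN)
    moreover have "(\<Union>i. Z i \<inter> Y) = Z' \<inter> Y" by (auto simp: Z'_def)
    ultimately show ?thesis by (simp add: measure_eq_0_null_sets)
  qed
  obtain Q M0 where Q: "countable Q" "Q \<noteq> {}" and M0: "M0 \<in> sets borel" "emeasure \<mu>c (M0 \<inter> Y) = 1"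
    and dense: "\<And>x e. x \<in> M0 \<Longrightarrow> 0 < e \<Longrightarrow> \<exists>q\<in>Q. dist q x < e"
    by (rule separable_support) blast
  define \<S> where "\<S> = {Y, M0, Z'} \<union> range B \<union> (\<Union>q\<in>Q. range (\<lambda>k. ball q (inverse (real (Suc k)))))"
  have \<S>: "countable \<S>" "\<S> \<noteq> {}" unfolding \<S>_def using Q by auto
  have borel_m: "X \<in> sets (completion m)" if "X \<in> sets borel" for X
    using that by (intro sets_completionI_sets) (simp add: sets_m)
  have \<S>_m: "X \<in> sets (completion m)" if "X \<in> \<S>" for X
    using that Y_measurable borel_m M0(1) Z' B unfolding \<S>_def by auto
  define t where "t = enn2real mean_return"
  have t: "1 \<le> t" "mean_return = ennreal t"
    using mean_return_ge_1 \<tau>_integrable by (auto simp: t_def enn2real_leI intro!: enn2real_mono[of 1, simplified])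
  have "from_nat_into \<S> i \<in> sets (completion m)" for i
    using \<S>_m from_nat_into[OF \<S>(2)] by blast
  note parametrize = lebesgue_space_compact_parametrization
    [where S = "from_nat_into \<S>" and e = "e / t", OF lebesgue_m prob_m this]
  have "\<exists>(D :: real set) \<psi>. compact D \<and> \<psi> ` D \<in> sets (completion m) \<and> 1 - e / t < measure (completion m) (\<psi> ` D) \<and>
      (\<forall>i. closed {x \<in> D. \<psi> x \<in> from_nat_into \<S> i}) \<and> (\<forall>i. closed {x \<in> D. \<psi> x \<notin> from_nat_into \<S> i})"
  proof (rule parametrize)
    show "0 < e / t" using e t by simp
    fix D :: "real set" and \<psi>
    assume h: "compact D" "\<psi> ` D \<in> sets (completion m)" "1 - e / t < measure (completion m) (\<psi> ` D)"
      "\<And>i. closed {x \<in> D. \<psi> x \<in> from_nat_into \<S> i}" "\<And>i. closed {x \<in> D. \<psi> x \<notin> from_nat_into \<S> i}"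
    show ?thesis by (intro exI[of _ D] exI[of _ \<psi>] conjI allI h)
  qed
  then obtain D :: "real set" and \<psi> where D: "compact D" "\<psi> ` D \<in> sets (completion m)"
      "1 - e / t < measure (completion m) (\<psi> ` D)"
      and cl: "\<forall>i. closed {x \<in> D. \<psi> x \<in> from_nat_into \<S> i}" "\<forall>i. closed {x \<in> D. \<psi> x \<notin> from_nat_into \<S> i}"
    by (elim exE conjE) (rule that)
  have cl': "closed {x \<in> D. \<psi> x \<in> X}" "closed {x \<in> D. \<psi> x \<notin> X}" if "X \<in> \<S>" for X
    using cl that \<S>(1) from_nat_into_surj[OF \<S>(1) that] by blast+
  have in\<S>: "Y \<in> \<S>" "M0 \<in> \<S>" "Z' \<in> \<S>" "B i \<in> \<S>" "q \<in> Q \<Longrightarrow> ball q (inverse (real (Suc k))) \<in> \<S>" for i q k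
    by (auto simp: \<S>_def)
  \<comment> \<open>Points of \<open>D\<close> whose image is unsuitable form a relatively clopen set, so removing them preserves compactness.\<close>
  define D' where "D' = D \<inter> {x \<in> D. \<psi> x \<in> Y} \<inter> {x \<in> D. \<psi> x \<in> M0} \<inter> {x \<in> D. \<psi> x \<notin> Z'}"
  have D': "compact D'" unfolding D'_def by (intro compact_Int_closed D(1) cl' in\<S>)
  have D'_in: "\<psi> x \<in> Y" "\<psi> x \<in> M0" "\<psi> x \<notin> Z'" "x \<in> D" if "x \<in> D'" for x using that by (auto simp: D'_def)
  have cont: "continuous_on D' \<psi>"
  proof (subst continuous_on_iff, intro ballI allI impI)
    fix x :: real and r :: real assume x: "x \<in> D'" and r: "0 < r"
    obtain k where k: "inverse (real (Suc k)) < r / 2" using reals_Archimedean[of "r / 2"] r by auto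
    obtain q where q: "q \<in> Q" "dist q (\<psi> x) < inverse (real (Suc k))"
      using dense[OF D'_in(2)[OF x], of "inverse (real (Suc k))"] by auto
    let ?U = "{x \<in> D. \<psi> x \<notin> ball q (inverse (real (Suc k)))}"
    have "open (- ?U)" using cl'(2)[OF in\<S>(5)[OF q(1)]] by (simp add: open_Compl)
    moreover have "x \<in> - ?U" using q by simp
    ultimately obtain d where d: "0 < d" "\<And>y. dist y x < d \<Longrightarrow> y \<in> - ?U"
      by (auto simp: open_dist)
    have "dist (\<psi> y) (\<psi> x) < r" if "y \<in> D'" "dist y x < d" for y
    proof -
      have "dist q (\<psi> y) < inverse (real (Suc k))" using d(2)[OF that(2)] D'_in(4)[OF that(1)] by auto
      then show ?thesis using q(2) k dist_triangle[of "\<psi> y" "\<psi> x" q] by (simp add: dist_commute)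
    qed
    then show "\<exists>d>0. \<forall>y\<in>D'. dist y x < d \<longrightarrow> dist (\<psi> y) (\<psi> x) < r" using d(1) by blast
  qed
  define C where "C = \<psi> ` D'"
  have C: "compact C" unfolding C_def by (rule compact_continuous_image[OF cont D'])
  have CY: "C \<subseteq> Y" using D'_in by (auto simp: C_def)
  have img: "closed (\<psi> ` (D' \<inter> E))" if "closed E" for E
    by (intro compact_imp_closed compact_continuous_image continuous_on_subset[OF cont]
        compact_Int_closed[OF D' that]) auto
  have SC: "\<psi> x \<in> S i \<longleftrightarrow> \<psi> x \<in> B i" if "x \<in> D'" for x i
    using SB[of i] D'_in[OF that] by (auto simp: Z'_def)
  have "C \<inter> S i = \<psi> ` (D' \<inter> {x \<in> D. \<psi> x \<in> B i})" "C - S i = \<psi> ` (D' \<inter> {x \<in> D. \<psi> x \<notin> B i})" for i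
    using SC D'_in(4) by (auto simp: C_def)
  then have clS: "closed (C \<inter> S i)" "closed (C - S i)" for i
    using img cl' in\<S>(4) by simp_all
  have "1 - e < measure \<mu>c C"
  proof -
    \<comment> \<open>A Borel kernel of the compact image, since \<open>\<mu>\<close> is compared with \<open>m\<close> on Borel sets only.\<close>
    let ?H = "main_part m (\<psi> ` D)"
    have H: "?H \<in> sets borel" "?H \<subseteq> \<psi> ` D"
      using main_part_sets[OF D(2)] main_part_null_part_Un[OF D(2)] by (auto simp: sets_m)
    have "1 - e / t < measure m ?H" using D(3) D(2) by (simp add: measure_def)
    then have mH: "measure m (- ?H) < e / t"
      using m.prob_compl[of ?H] H(1) by (simp add: sets_m space_m Compl_eq_Diff_UNIV)
    have C_sets: "C \<in> sets \<mu>c"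
      using sets_completionI_sets[OF borel_in_\<mu>[of C]] C CY by (simp add: compact_imp_closed Int_absorb2)
    have nn: "- ?H \<inter> Y \<in> sets \<mu>c" "- M0 \<inter> Y \<in> sets \<mu>c" "Z' \<inter> Y \<in> sets \<mu>c"
      using H M0 Z' by (auto intro!: sets_completionI_sets borel_in_\<mu>)
    have "Y - C \<subseteq> (- ?H \<inter> Y) \<union> ((- M0 \<inter> Y) \<union> (Z' \<inter> Y))"
      using H(2) by (auto simp: C_def D'_def)
    then have "measure \<mu>c (Y - C) \<le> measure \<mu>c ((- ?H \<inter> Y) \<union> ((- M0 \<inter> Y) \<union> (Z' \<inter> Y)))"
      using nn by (intro finite_measure_mono sets.Un)
    also have "\<dots> \<le> measure \<mu>c (- ?H \<inter> Y) + measure \<mu>c ((- M0 \<inter> Y) \<union> (Z' \<inter> Y))"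
      using nn by (intro measure_Un_le sets.Un)
    also have "measure \<mu>c ((- M0 \<inter> Y) \<union> (Z' \<inter> Y)) \<le> measure \<mu>c (- M0 \<inter> Y) + measure \<mu>c (Z' \<inter> Y)"
      using nn by (intro measure_Un_le)
    also have "measure \<mu>c (- M0 \<inter> Y) = 0"
    proof -
      have "M0 \<inter> Y \<in> sets \<mu>c" using M0(1) by (intro sets_completionI_sets borel_in_\<mu>)
      from prob_compl[OF this] show ?thesis
        using M0(2) by (simp add: emeasure_eq_measure space_\<mu> Int_commute Diff_eq[symmetric] Diff_Int_distrib)
          (metis Diff_Compl Diff_Diff_Int Diff_eq Int_commute)
    qed
    also have "measure \<mu>c (- ?H \<inter> Y) < e"
    proof -
      have "ennreal (measure \<mu>c (- ?H \<inter> Y)) \<le> ennreal (t * measure m (- ?H))"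
        using \<mu>_le_m[of "- ?H"] H(1) t by (simp add: emeasure_eq_measure m.emeasure_eq_measure ennreal_mult)
      then have "measure \<mu>c (- ?H \<inter> Y) \<le> t * measure m (- ?H)" using t by simp
      also have "\<dots> < e" using mH t by (simp add: field_simps)
      finally show ?thesis .
    qed
    finally have "measure \<mu>c (Y - C) < e" using Z'0 by simp
    then show ?thesis using prob_compl[OF C_sets] by (simp add: space_\<mu>)
  qed
  with C CY clS show thesis by (intro that) auto
qed

text \<open>If the preimages of the balls of a countable base are relatively open in \<open>C\<close>, then \<open>F\<close> is continuous
on \<open>C\<close>.\<close>

lemma lusin_F:
  assumes e: "0 < e"
  obtains C where "compact C" "C \<subseteq> Y" "1 - e < measure \<mu>c C"
    "\<And>a. a \<in> \<alpha> \<Longrightarrow> closed (C \<inter> a)" "continuous_on C F"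
proof -
  interpret prob_space \<mu>c by (rule prob_\<mu>c)
  obtain Q M0 where Q: "countable Q" "Q \<noteq> {}" and M0: "M0 \<in> sets borel" "emeasure \<mu>c (M0 \<inter> Y) = 1"
    and dense: "\<And>x e. x \<in> M0 \<Longrightarrow> 0 < e \<Longrightarrow> \<exists>q\<in>Q. dist q x < e"
    by (rule separable_support) blast
  have pre: "F -` B \<inter> Y \<in> sets \<mu>c" if "B \<in> sets borel" for B
  proof -
    have "F -` (B \<inter> Y) \<inter> space \<mu>c \<in> sets \<mu>c"
      by (rule measurable_sets[OF F_preserves(1)]) (intro sets_completionI_sets borel_in_\<mu> that)
    also have "F -` (B \<inter> Y) \<inter> space \<mu>c = F -` B \<inter> Y" using return by (auto simp: space_\<mu>)
    finally show ?thesis .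
  qed
  define N where "N = F -` M0 \<inter> Y"
  \<comment> \<open>\<open>N\<close> consists of the points whose image lies in the separable part; only there do small balls around \<open>Q\<close> exist.\<close>
  define \<S> where "\<S> = insert N (\<alpha> \<union> (\<Union>q\<in>Q. range (\<lambda>k. F -` ball q (inverse (real (Suc k))) \<inter> Y)))"
  have \<S>: "countable \<S>" "\<S> \<noteq> {}" unfolding \<S>_def using Q \<alpha>_countable by auto
  have \<S>_sets: "X \<in> sets \<mu>c" if "X \<in> \<S>" for X
    using that \<alpha>_measurable pre M0(1) unfolding \<S>_def N_def by auto
  then have "from_nat_into \<S> i \<in> sets \<mu>c" for i
    using from_nat_into[OF \<S>(2)] by blast
  then obtain C where C: "compact C" "C \<subseteq> Y" "1 - e < measure \<mu>c C"
    and cl: "\<And>i. closed (C \<inter> from_nat_into \<S> i)" "\<And>i. closed (C - from_nat_into \<S> i)"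
    using lusin[of "from_nat_into \<S>", OF _ e] by blast
  have cl': "closed (C \<inter> X)" "closed (C - X)" if "X \<in> \<S>" for X
    using cl from_nat_into_surj[OF \<S>(1) that] by blast+
  have N\<S>: "N \<in> \<S>" by (simp add: \<S>_def)
  have CN: "compact (C \<inter> N)"
    using compact_Int_closed[OF C(1) cl'(1)[OF N\<S>]] by (simp add: Int_assoc[symmetric])
  have NS: "N \<in> sets \<mu>c" by (rule \<S>_sets[OF N\<S>])
  have CS: "C \<in> sets \<mu>c"
    using sets_completionI_sets[OF borel_in_\<mu>[of C]] C(1,2) by (simp add: compact_imp_closed Int_absorb2)
  have "emeasure \<mu>c N = emeasure \<mu>c ((F ^^ 1) -` (M0 \<inter> Y) \<inter> Y)"
    using return by (intro arg_cong[where f = "emeasure \<mu>c"]) (auto simp: N_def)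
  also have "\<dots> = 1"
    using M0 by (subst emeasure_funpow_F) (auto intro!: sets_completionI_sets borel_in_\<mu>)
  finally have "AE y in \<mu>c. y \<in> N" using AE_in_set_eq_1[OF NS] by (simp add: emeasure_eq_measure)
  then have "measure \<mu>c (C \<inter> N) = measure \<mu>c C"
    using CS NS by (intro finite_measure_eq_AE) auto
  moreover have "closed (C \<inter> N \<inter> a)" if "a \<in> \<alpha>" for a
  proof -
    have "closed ((C \<inter> N) \<inter> (C \<inter> a))"
      by (rule closed_Int[OF compact_imp_closed[OF CN] cl'(1)]) (use that in \<open>simp add: \<S>_def\<close>)
    moreover have "(C \<inter> N) \<inter> (C \<inter> a) = C \<inter> N \<inter> a" by auto
    ultimately show ?thesis by simp
  qed
  moreover have "continuous_on (C \<inter> N) F"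
  proof (subst continuous_on_iff, intro ballI allI impI)
    fix x r assume x: "x \<in> C \<inter> N" and r: "(0 :: real) < r"
    obtain k where k: "inverse (real (Suc k)) < r / 2" using reals_Archimedean[of "r / 2"] r by auto
    obtain q where q: "q \<in> Q" "dist q (F x) < inverse (real (Suc k))"
      using dense[of "F x" "inverse (real (Suc k))"] x by (auto simp: N_def)
    let ?B = "F -` ball q (inverse (real (Suc k))) \<inter> Y"
    have "?B \<in> \<S>" using q(1) by (auto simp: \<S>_def)
    then have "open (- (C - ?B))" by (rule open_Compl[OF cl'(2)])
    moreover have "x \<in> - (C - ?B)" using q x C(2) by auto
    ultimately obtain d where "0 < d" "\<forall>y. dist y x < d \<longrightarrow> y \<in> - (C - ?B)"
      unfolding open_dist by blast
    then have d: "0 < d" "\<And>y. dist y x < d \<Longrightarrow> y \<in> - (C - ?B)" by blast+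
    have "dist (F y) (F x) < r" if "y \<in> C \<inter> N" "dist y x < d" for y
    proof -
      have "dist q (F y) < inverse (real (Suc k))" using d(2)[OF that(2)] that(1) by auto
      then show ?thesis using q(2) k dist_triangle[of "F y" "F x" q] by (simp add: dist_commute)
    qed
    then show "\<exists>d>0. \<forall>y\<in>C \<inter> N. dist y x < d \<longrightarrow> dist (F y) (F x) < r" using d(1) by blast
  qed
  ultimately show thesis using that[OF CN] C by auto
qed

lemma inner_compact:
  assumes A: "A \<in> sets \<mu>c" and e: "0 < e"
  obtains C where "compact C" "C \<subseteq> A" "measure \<mu>c A - e < measure \<mu>c C"
proof -
  interpret prob_space \<mu>c by (rule prob_\<mu>c)
  obtain C where C: "compact C" "C \<subseteq> Y" "1 - e < measure \<mu>c C" "closed (C \<inter> A)"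
    using lusin[of "\<lambda>_. A", OF A e] by metis
  have CS: "C \<in> sets \<mu>c"
    using sets_completionI_sets[OF borel_in_\<mu>[of C]] C(1,2) by (simp add: compact_imp_closed Int_absorb2)
  have "measure \<mu>c A \<le> measure \<mu>c ((C \<inter> A) \<union> (Y - C))"
    using sets.sets_into_space[OF A] A CS sets.compl_sets[OF CS]
    by (intro finite_measure_mono) (auto simp: space_\<mu>)
  also have "\<dots> \<le> measure \<mu>c (C \<inter> A) + measure \<mu>c (Y - C)"
    using A CS sets.compl_sets[OF CS] by (intro measure_Un_le) (auto simp: space_\<mu>)
  also have "measure \<mu>c (Y - C) < e"
    using prob_compl[OF CS] C(3) by (simp add: space_\<mu>)
  finally have "measure \<mu>c A - e < measure \<mu>c (C \<inter> A)" by simp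
  moreover have "compact (C \<inter> A)"
    using compact_Int_closed[OF C(1,4)] by (simp add: Int_assoc[symmetric])
  ultimately show thesis by (intro that[of "C \<inter> A"]) auto
qed

end

section \<open>Points determined by itineraries\<close>

text \<open>An invertible stationary process whose letters have the law of itineraries under \<open>\<mu>\<close>. The
points of \<open>Y\<close> whose orbits realise the two-sided sequences are constructed below.\<close>

locale symbolic_model = nonuniformly_hyperbolic m T Y \<alpha> \<tau> \<mu> W K \<gamma>
  for m :: "'a::metric_space measure" and T Y \<alpha> \<tau> \<mu> W K \<gamma> +
  fixes Q :: "'b measure" and S S' :: "'b \<Rightarrow> 'b" and \<ll> :: "'b \<Rightarrow> 'a set"
  assumes prob_Q: "prob_space Q"
    and S_measurable [measurable]: "S \<in> Q \<rightarrow>\<^sub>M Q" and S_preserving: "distr Q Q S = Q"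
    and S'_measurable [measurable]: "S' \<in> Q \<rightarrow>\<^sub>M Q"
    and S_S': "q \<in> space Q \<Longrightarrow> S (S' q) = q" and S'_S: "q \<in> space Q \<Longrightarrow> S' (S q) = q"
    and letter_measurable [measurable]: "\<ll> \<in> Q \<rightarrow>\<^sub>M count_space UNIV"
    and letter_in: "q \<in> space Q \<Longrightarrow> \<ll> q \<in> \<alpha>"
    and law: "u \<in> lists \<alpha> \<Longrightarrow>
      emeasure Q {q \<in> space Q. map (\<lambda>i. \<ll> ((S ^^ i) q)) [0..<length u] = u} = ennreal (lam u)"
begin

definition itin :: "nat \<Rightarrow> 'b \<Rightarrow> 'a set list" where
  "itin n q = map (\<lambda>i. \<ll> ((S ^^ i) q)) [0..<n]"

lemma length_itin [simp]: "length (itin n q) = n"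
  by (simp add: itin_def)

lemma S_space: "q \<in> space Q \<Longrightarrow> S q \<in> space Q" and S'_space: "q \<in> space Q \<Longrightarrow> S' q \<in> space Q"
  by (rule measurable_space[OF S_measurable], assumption) (rule measurable_space[OF S'_measurable])

lemma funpow_S_space: "q \<in> space Q \<Longrightarrow> (S ^^ n) q \<in> space Q"
  and funpow_S'_space: "q \<in> space Q \<Longrightarrow> (S' ^^ n) q \<in> space Q"
  by (induction n) (auto intro: S_space S'_space)

lemma funpow_S_measurable: "S ^^ n \<in> Q \<rightarrow>\<^sub>M Q"
  and funpow_S'_measurable: "S' ^^ n \<in> Q \<rightarrow>\<^sub>M Q"
  by (induction n) (auto simp: id_def intro: measurable_comp)

lemma funpow_S_S': "q \<in> space Q \<Longrightarrow> (S ^^ n) ((S' ^^ n) q) = q"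
proof (induction n arbitrary: q)
  case (Suc n)
  have "(S ^^ Suc n) ((S' ^^ Suc n) q) = (S ^^ n) (S (S' ((S' ^^ n) q)))"
    by (simp add: funpow_swap1)
  then show ?case using Suc by (simp add: S_S' funpow_S'_space)
qed simp

lemma itin_in_lists: "q \<in> space Q \<Longrightarrow> itin n q \<in> lists \<alpha>"
  using letter_in funpow_S_space by (auto simp: itin_def)

lemma itin_Suc: "itin (Suc n) q = \<ll> q # itin n (S q)"
  by (simp add: itin_def upt_rec[of 0] map_Suc_upt[symmetric] funpow_swap1 o_def del: upt_Suc)

lemma itin_add: "itin (n + k) q = itin n q @ itin k ((S ^^ n) q)"
proof (induction n arbitrary: q)
  case (Suc n)
  then show ?case by (simp add: itin_Suc funpow_swap1)
qed (simp add: itin_def)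

lemma S'_preserving: "distr Q Q S' = Q"
proof -
  have "distr Q Q S' = distr (distr Q Q S) Q S'" by (simp add: S_preserving)
  also have "\<dots> = distr Q Q (S' \<circ> S)" by (rule distr_distr) measurable
  also have "\<dots> = distr Q Q (\<lambda>q. q)" by (rule distr_cong) (auto simp: S'_S)
  finally show ?thesis by (simp add: distr_id2)
qed

lemma emeasure_funpow_S':
  assumes A: "A \<in> sets Q"
  shows "emeasure Q {q \<in> space Q. (S' ^^ n) q \<in> A} = emeasure Q A"
proof (induction n)
  case 0
  have "{q \<in> space Q. q \<in> A} = A" using sets.sets_into_space[OF A] by auto
  then show ?case by simp
next
  case (Suc n)
  let ?B = "{q \<in> space Q. (S' ^^ n) q \<in> A}"
  have B: "?B \<in> sets Q"
    using measurable_sets[OF funpow_S'_measurable A, of n] by (simp add: vimage_def Int_def conj_commute)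
  have "{q \<in> space Q. (S' ^^ Suc n) q \<in> A} = S' -` ?B \<inter> space Q"
    using S'_space by (auto simp: funpow_swap1)
  then have "emeasure Q {q \<in> space Q. (S' ^^ Suc n) q \<in> A} = emeasure (distr Q Q S') ?B"
    using B by (subst emeasure_distr) auto
  then show ?case using Suc by (simp add: S'_preserving)
qed

lemma itin_measurable [measurable]: "itin n \<in> Q \<rightarrow>\<^sub>M count_space (lists \<alpha>)"
proof (rule measurable_count_space_eq_countable[THEN iffD2, OF countable_itineraries], intro conjI ballI)
  show "itin n \<in> space Q \<rightarrow> lists \<alpha>" using itin_in_lists by auto
  fix u assume "u \<in> lists \<alpha>"
  have "{q \<in> space Q. \<forall>i\<in>{..<n}. \<ll> ((S ^^ i) q) = u ! i} \<in> sets Q"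
  proof (intro sets.sets_Collect_finite_All ballI)
    fix i
    have "(\<lambda>q. \<ll> ((S ^^ i) q)) -` {u ! i} \<inter> space Q \<in> sets Q"
      by (rule measurable_sets[OF measurable_compose[OF funpow_S_measurable letter_measurable]]) simp
    then show "{q \<in> space Q. \<ll> ((S ^^ i) q) = u ! i} \<in> sets Q"
      by (simp add: vimage_def Int_def conj_commute)
  qed simp
  moreover have "itin n q = u \<longleftrightarrow> length u = n \<and> (\<forall>i\<in>{..<n}. \<ll> ((S ^^ i) q) = u ! i)" for q
    unfolding itin_def list_eq_iff_nth_eq[of _ u] by auto
  then have "itin n -` {u} \<inter> space Q =
    (if length u = n then {q \<in> space Q. \<forall>i\<in>{..<n}. \<ll> ((S ^^ i) q) = u ! i} else {})"
    by auto
  ultimately show "itin n -` {u} \<inter> space Q \<in> sets Q" by simp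
qed

lemma emeasure_itin_window:
  assumes U: "U \<subseteq> lists \<alpha>" "\<And>u. u \<in> U \<Longrightarrow> length u = N"
  shows "emeasure Q {q \<in> space Q. itin N ((S' ^^ n) q) \<in> U} = emeasure \<mu>c (\<Union>u\<in>U. cyl u)"
proof -
  have cU: "countable U" using countable_itineraries U(1) by (rule countable_subset[rotated])
  have "itin N -` U \<inter> space Q \<in> sets Q"
    using U(1) by (intro measurable_sets[OF itin_measurable]) simp
  then have A: "{q \<in> space Q. itin N q \<in> U} \<in> sets Q" by (simp add: vimage_def Int_def conj_commute)
  have "{q \<in> space Q. itin N ((S' ^^ n) q) \<in> U} = {q \<in> space Q. (S' ^^ n) q \<in> {q \<in> space Q. itin N q \<in> U}}"
    using funpow_S'_space by auto
  then have "emeasure Q {q \<in> space Q. itin N ((S' ^^ n) q) \<in> U} = emeasure Q {q \<in> space Q. itin N q \<in> U}"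
    using emeasure_funpow_S'[OF A] by simp
  also have "{q \<in> space Q. itin N q \<in> U} = (\<Union>u\<in>U. {q \<in> space Q. itin N q = u})" by auto
  also have "emeasure Q \<dots> = (\<integral>\<^sup>+ u. emeasure Q {q \<in> space Q. itin N q = u} \<partial>count_space U)"
  proof (intro emeasure_UN_countable cU)
    fix u assume "u \<in> U"
    then have "itin N -` {u} \<inter> space Q \<in> sets Q"
      using U(1) by (intro measurable_sets[OF itin_measurable]) auto
    then show "{q \<in> space Q. itin N q = u} \<in> sets Q" by (simp add: vimage_def Int_def conj_commute)
  qed (auto simp: disjoint_family_on_def)
  also have "\<dots> = (\<integral>\<^sup>+ u. emeasure \<mu>c (cyl u) \<partial>count_space U)"
    using law U by (intro nn_integral_cong) (auto simp: itin_def emeasure_cyl subset_eq)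
  also have "\<dots> = emeasure \<mu>c (\<Union>u\<in>U. cyl u)"
  proof (intro emeasure_UN_countable[symmetric] cU)
    show "disjoint_family_on cyl U"
      unfolding disjoint_family_on_def
    proof (intro ballI impI)
      fix u v assume uv: "u \<in> U" "v \<in> U" "u \<noteq> v"
      have uv': "u \<in> lists \<alpha>" "v \<in> lists \<alpha>" "length u = N" "length v = N" using uv U by auto
      then obtain i where i: "i < N" "u ! i \<noteq> v ! i" using uv(3) by (auto simp: list_eq_iff_nth_eq)
      then have "u ! i \<in> \<alpha>" "v ! i \<in> \<alpha>" using uv'  by (auto simp: in_lists_conv_set)
      show "cyl u \<inter> cyl v = {}"
      proof (rule ccontr)
        assume "cyl u \<inter> cyl v \<noteq> {}"
        then obtain y where "y \<in> cyl u" "y \<in> cyl v" by blast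
        then have "(F ^^ i) y \<in> u ! i" "(F ^^ i) y \<in> v ! i"
          using cyl_nth[OF uv'(1), of y i] cyl_nth[OF uv'(2), of y i] i(1) uv'(3,4) by simp_all
        then show False using \<alpha>_disjoint[OF \<open>u ! i \<in> \<alpha>\<close> \<open>v ! i \<in> \<alpha>\<close>] i(2) by blast
      qed
    qed
    show "cyl u \<in> sets \<mu>c" if "u \<in> U" for u using that U(1) by (intro cyl_sets) blast
  qed
  finally show ?thesis .
qed

text \<open>The letters at the times from \<open>- n\<close> to \<open>n\<close>.\<close>

definition window :: "nat \<Rightarrow> 'b \<Rightarrow> 'a set list" where
  "window n q = itin (2 * n + 1) ((S' ^^ n) q)"

lemma length_window [simp]: "length (window n q) = 2 * n + 1"
  by (simp add: window_def)

lemma window_in_lists: "q \<in> space Q \<Longrightarrow> window n q \<in> lists \<alpha>"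
  unfolding window_def by (intro itin_in_lists funpow_S'_space)

lemma window_measurable [measurable]: "window n \<in> Q \<rightarrow>\<^sub>M count_space (lists \<alpha>)"
  unfolding window_def by (rule measurable_compose[OF funpow_S'_measurable itin_measurable])

lemma window_nth: "q \<in> space Q \<Longrightarrow> window n q ! n = \<ll> q"
  unfolding window_def itin_def by (subst nth_map) (simp_all add: funpow_S_S' del: upt_Suc)

text \<open>The points at time 0 of orbits that follow the window.\<close>

definition approx :: "nat \<Rightarrow> 'b \<Rightarrow> 'a set" where
  "approx n q = (F ^^ n) ` cyl (window n q)"

lemma cyl_nonempty: "u \<in> lists \<alpha> \<Longrightarrow> cyl u \<noteq> {}"
  using lam_positive[of u] by (auto simp: lam_def)

lemma approx_nonempty: "q \<in> space Q \<Longrightarrow> approx n q \<noteq> {}"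
  using cyl_nonempty[OF window_in_lists] by (simp add: approx_def)

lemma approx_Suc_subset:
  assumes q: "q \<in> space Q"
  shows "approx (Suc n) q \<subseteq> approx n q"
proof -
  let ?r = "(S' ^^ n) q"
  have r: "?r \<in> space Q" by (rule funpow_S'_space[OF q])
  have "window (Suc n) q = itin (Suc ((2 * n + 1) + 1)) (S' ?r)"
    by (simp add: window_def)
  also have "\<dots> = \<ll> (S' ?r) # itin ((2 * n + 1) + 1) (S (S' ?r))"
    by (rule itin_Suc)
  also have "S (S' ?r) = ?r" by (rule S_S'[OF r])
  also have "itin ((2 * n + 1) + 1) ?r = window n q @ itin 1 ((S ^^ (2 * n + 1)) ?r)"
    unfolding window_def by (rule itin_add)
  finally have "window (Suc n) q = \<ll> (S' ?r) # window n q @ itin 1 ((S ^^ (2 * n + 1)) ?r)" .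
  moreover have "cyl (window n q @ itin 1 ((S ^^ (2 * n + 1)) ?r)) \<subseteq> cyl (window n q)"
    using cyl_append[OF window_in_lists[OF q] itin_in_lists] funpow_S_space[OF r] by blast
  ultimately have "cyl (window (Suc n) q) \<subseteq> F -` cyl (window n q)" by auto
  then show ?thesis by (auto simp: approx_def funpow_swap1)
qed

lemma approx_mono: "q \<in> space Q \<Longrightarrow> n \<le> k \<Longrightarrow> approx k q \<subseteq> approx n q"
  by (rule lift_Suc_antimono_le[of "\<lambda>n. approx n q"]) (auto dest: approx_Suc_subset)

lemma approx_diameter:
  assumes q: "q \<in> space Q" and x: "x \<in> approx n q" and y: "y \<in> approx n q"
  shows "dist x y \<le> 2 * K * \<gamma> ^ n"
proof -
  obtain z z' where z: "z \<in> cyl (window n q)" "x = (F ^^ n) z" "z' \<in> cyl (window n q)" "y = (F ^^ n) z'"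
    using x y by (auto simp: approx_def)
  have "dist x y \<le> K * (\<gamma> ^ (2 * n + 1 - n) + \<gamma> ^ n)"
    using contraction[OF window_in_lists[OF q] z(1,3), of n] z(2,4) by simp
  also have "\<gamma> ^ (2 * n + 1 - n) \<le> \<gamma> ^ n" using \<gamma>_bounds by (intro power_decreasing) auto
  then have "K * (\<gamma> ^ (2 * n + 1 - n) + \<gamma> ^ n) \<le> K * (\<gamma> ^ n + \<gamma> ^ n)"
    using K_ge_1 by (intro mult_left_mono) auto
  finally show ?thesis by simp
qed

lemma decay: "(\<lambda>n. c * \<gamma> ^ n) \<longlonglongrightarrow> 0"
  using tendsto_mult[OF tendsto_const[of c] LIMSEQ_power_zero[of \<gamma>]] \<gamma>_bounds by simp

definition near :: "'b \<Rightarrow> 'a \<Rightarrow> bool" where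
  "near q y \<longleftrightarrow> (\<forall>n. \<forall>x\<in>approx n q. dist y x \<le> 2 * K * \<gamma> ^ n)"

lemma near_unique:
  assumes q: "q \<in> space Q" and y: "near q y" "near q z"
  shows "y = z"
proof -
  have "dist y z \<le> 4 * K * \<gamma> ^ n" for n
  proof -
    obtain x where "x \<in> approx n q" using approx_nonempty[OF q] by blast
    then have "dist y x \<le> 2 * K * \<gamma> ^ n" "dist z x \<le> 2 * K * \<gamma> ^ n" using y by (auto simp: near_def)
    then show ?thesis using dist_triangle2[of y z x] by simp
  qed
  then have "dist y z \<le> 0" by (intro LIMSEQ_le_const[OF decay]) auto
  then show ?thesis by simp
qed

definition point :: "'b \<Rightarrow> 'a" where "point q = (THE y. near q y)"

lemma point_eq: "q \<in> space Q \<Longrightarrow> near q y \<Longrightarrow> point q = y"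
  unfolding point_def using near_unique by (intro the_equality) auto

definition hits :: "'a set \<Rightarrow> 'b set" where
  "hits C = {q \<in> space Q. \<forall>n. approx n q \<inter> C \<noteq> {}}"

lemma approx_hit_sets: "{q \<in> space Q. approx n q \<inter> C \<noteq> {}} \<in> sets Q"
proof -
  have "{q \<in> space Q. (F ^^ n) ` cyl (window n q) \<inter> C \<noteq> {}} \<in> sets Q"
    by (rule measurable_compose[OF window_measurable, of "\<lambda>u. (F ^^ n) ` cyl u \<inter> C \<noteq> {}" "count_space UNIV" n, THEN predE]) simp
  then show ?thesis by (simp add: approx_def)
qed

lemma hits_sets: "hits C \<in> sets Q"
proof -
  have "hits C = (\<Inter>n. {q \<in> space Q. approx n q \<inter> C \<noteq> {}})" by (auto simp: hits_def)
  then show ?thesis using approx_hit_sets by (simp add: sets.countable_INT)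
qed

text \<open>For fixed \<open>n\<close>, the windows whose candidates meet \<open>C\<close> include those of all \<open>y\<close> with \<open>(F ^^ n) y\<close> in \<open>C\<close>,
and these \<open>y\<close> have the measure of \<open>C\<close> by invariance. The events decrease in \<open>n\<close>.\<close>

lemma hits_measure:
  assumes C: "C \<inter> Y \<in> sets \<mu>c"
  shows "emeasure \<mu>c (C \<inter> Y) \<le> emeasure Q (hits C)"
proof -
  interpret Q: prob_space Q by (rule prob_Q)
  let ?A = "\<lambda>n. {q \<in> space Q. approx n q \<inter> C \<noteq> {}}"
  have "emeasure \<mu>c (C \<inter> Y) \<le> emeasure Q (?A n)" for n
  proof -
    define U where "U = {u \<in> lists \<alpha>. length u = 2 * n + 1 \<and> (F ^^ n) ` cyl u \<inter> C \<noteq> {}}"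
    have "(F ^^ n) -` (C \<inter> Y) \<inter> Y \<subseteq> (\<Union>u\<in>U. cyl u)"
    proof
      fix y assume y: "y \<in> (F ^^ n) -` (C \<inter> Y) \<inter> Y"
      then obtain u where "u \<in> lists \<alpha>" "length u = 2 * n + 1" "y \<in> cyl u"
        using itinerary_exists[of y "2 * n + 1"] by blast
      then show "y \<in> (\<Union>u\<in>U. cyl u)" using y by (auto simp: U_def)
    qed
    moreover have "(\<Union>u\<in>U. cyl u) \<in> sets \<mu>c"
      using countable_subset[OF _ countable_itineraries, of U] cyl_sets
      by (intro sets.countable_UN') (auto simp: U_def)
    ultimately have "emeasure \<mu>c ((F ^^ n) -` (C \<inter> Y) \<inter> Y) \<le> emeasure \<mu>c (\<Union>u\<in>U. cyl u)"
      by (rule emeasure_mono)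
    also have "\<dots> = emeasure Q {q \<in> space Q. itin (2 * n + 1) ((S' ^^ n) q) \<in> U}"
      by (rule emeasure_itin_window[symmetric]) (auto simp: U_def)
    also have "{q \<in> space Q. itin (2 * n + 1) ((S' ^^ n) q) \<in> U} = ?A n"
      unfolding window_def[symmetric] U_def approx_def using window_in_lists by auto
    finally show ?thesis unfolding emeasure_funpow_F[OF C] .
  qed
  then have "emeasure \<mu>c (C \<inter> Y) \<le> (INF n. emeasure Q (?A n))" by (intro INF_greatest)
  also have "\<dots> = emeasure Q (\<Inter>n. ?A n)"
  proof (intro INF_emeasure_decseq)
    show "decseq ?A"
      unfolding decseq_Suc_iff using approx_Suc_subset by blast
  qed (use approx_hit_sets in auto)
  also have "(\<Inter>n. ?A n) = hits C" by (auto simp: hits_def)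
  finally show ?thesis .
qed

text \<open>A subsequence of candidates in \<open>C\<close> converges, and its limit is within the diameter bound of
every candidate set.\<close>

lemma hits_near:
  assumes C: "compact C" and q: "q \<in> hits C"
  shows "near q (point q)" "point q \<in> C"
proof -
  have qQ: "q \<in> space Q" using q by (simp add: hits_def)
  have "\<forall>n. \<exists>x. x \<in> approx n q \<inter> C" using q by (auto simp: hits_def)
  then obtain p where "\<forall>n. p n \<in> approx n q \<inter> C" by (rule choice[THEN exE])
  then have p: "\<And>n. p n \<in> approx n q" "\<And>n. p n \<in> C" by blast+
  obtain y r where y: "y \<in> C" "strict_mono r" "(p \<circ> r) \<longlonglongrightarrow> y"
    using C p(2) unfolding compact_def by metis
  have "near q y"
    unfolding near_def
  proof (intro allI ballI)
    fix n x assume x: "x \<in> approx n q"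
    have "eventually (\<lambda>k. dist ((p \<circ> r) k) x \<le> 2 * K * \<gamma> ^ n) sequentially"
    proof (rule eventually_sequentiallyI[of n])
      fix k assume "n \<le> k"
      then have "n \<le> r k" using seq_suble[OF y(2), of k] by simp
      then have "p (r k) \<in> approx n q" using approx_mono[OF qQ] p(1) by blast
      then show "dist ((p \<circ> r) k) x \<le> 2 * K * \<gamma> ^ n" using approx_diameter[OF qQ _ x] by simp
    qed
    moreover have "(\<lambda>k. dist ((p \<circ> r) k) x) \<longlonglongrightarrow> dist y x"
      using y(3) by (intro tendsto_dist tendsto_const)
    ultimately show "dist y x \<le> 2 * K * \<gamma> ^ n" by (intro tendsto_upperbound) auto
  qed
  then show "near q (point q)" "point q \<in> C" using point_eq[OF qQ] y(1) by auto
qed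

text \<open>A fixed choice of compact sets with measure tending to one, so that a union over them stays countable.\<close>

definition core :: "nat \<Rightarrow> 'a set" where
  "core k = (SOME C. compact C \<and> C \<subseteq> Y \<and> 1 - inverse (real (Suc k)) < measure \<mu>c C \<and>
     (\<forall>a\<in>\<alpha>. closed (C \<inter> a)) \<and> continuous_on C F)"

lemma core: "compact (core k)" "core k \<subseteq> Y" "1 - inverse (real (Suc k)) < measure \<mu>c (core k)"
    "\<forall>a\<in>\<alpha>. closed (core k \<inter> a)" "continuous_on (core k) F"
proof -
  have "0 < inverse (real (Suc k))" by simp
  from lusin_F[OF this] have "\<exists>C. compact C \<and> C \<subseteq> Y \<and> 1 - inverse (real (Suc k)) < measure \<mu>c C \<and>
     (\<forall>a\<in>\<alpha>. closed (C \<inter> a)) \<and> continuous_on C F" by metis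
  from someI_ex[OF this, folded core_def]
  show "compact (core k)" "core k \<subseteq> Y" "1 - inverse (real (Suc k)) < measure \<mu>c (core k)"
    "\<forall>a\<in>\<alpha>. closed (core k \<inter> a)" "continuous_on (core k) F" by blast+
qed

definition located :: "'b set" where "located = (\<Union>k. hits (core k))"

lemma located_sets [measurable]: "located \<in> sets Q"
  unfolding located_def using hits_sets by blast

lemma located_space: "q \<in> located \<Longrightarrow> q \<in> space Q"
  by (auto simp: located_def hits_def)

lemma compact_sets: "compact C \<Longrightarrow> C \<inter> Y \<in> sets \<mu>c"
  by (intro sets_completionI_sets borel_in_\<mu>) (simp add: compact_imp_closed)

lemma AE_located: "AE q in Q. q \<in> located"
proof -
  interpret Q: prob_space Q by (rule prob_Q)
  interpret \<mu>c: prob_space \<mu>c by (rule prob_\<mu>c)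
  have "1 - inverse (real (Suc k)) \<le> measure Q located" for k
  proof -
    have "core k \<inter> Y = core k" using core(2)[of k] by auto
    then have "emeasure \<mu>c (core k) \<le> emeasure Q (hits (core k))"
      using hits_measure[OF compact_sets[OF core(1)], of k] by simp
    also have "\<dots> \<le> emeasure Q located"
      by (intro emeasure_mono located_sets) (auto simp: located_def)
    finally have "measure \<mu>c (core k) \<le> measure Q located"
      by (simp add: Q.emeasure_eq_measure \<mu>c.emeasure_eq_measure)
    then show ?thesis using core(3)[of k] by simp
  qed
  moreover have "(\<lambda>k. 1 - inverse (real (Suc k))) \<longlonglongrightarrow> 1 - 0"
    by (intro tendsto_diff tendsto_const LIMSEQ_inverse_real_of_nat)
  ultimately have "1 \<le> measure Q located"
    by (intro LIMSEQ_le_const2[of "\<lambda>k. 1 - inverse (real (Suc k))"]) auto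
  then show ?thesis
    using Q.prob_le_1[of located] by (simp add: Q.AE_in_set_eq_1)
qed

lemma located_near: "q \<in> located \<Longrightarrow> near q (point q)"
  using hits_near(1)[OF core(1)] unfolding located_def by blast

lemma near_limit:
  assumes q: "near q y" and p: "\<And>n. p n \<in> approx n q"
  shows "p \<longlonglongrightarrow> y"
proof (rule metric_tendsto_imp_tendsto[OF decay[of "2 * K"]])
  show "eventually (\<lambda>n. dist (p n) y \<le> dist (2 * K * \<gamma> ^ n) 0) sequentially"
  proof (intro always_eventually allI)
    fix n
    have "dist y (p n) \<le> 2 * K * \<gamma> ^ n" using q p[of n] by (auto simp: near_def)
    then show "dist (p n) y \<le> dist (2 * K * \<gamma> ^ n) 0" by (simp add: dist_commute)
  qed
qed

lemma approx_letter: 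
  assumes q: "q \<in> space Q"
  shows "approx n q \<subseteq> \<ll> q"
proof
  fix x assume "x \<in> approx n q"
  then obtain z where z: "z \<in> cyl (window n q)" "x = (F ^^ n) z" by (auto simp: approx_def)
  then show "x \<in> \<ll> q" using cyl_nth[OF window_in_lists[OF q] z(1), of n] window_nth[OF q] by simp
qed

lemma located_sequence:
  assumes "q \<in> located"
  shows "\<exists>k p. (\<forall>n. p n \<in> approx n q \<and> p n \<in> core k) \<and> point q \<in> core k"
proof -
  obtain k where k: "q \<in> hits (core k)" using assms by (auto simp: located_def)
  then have "\<forall>n. \<exists>x. x \<in> approx n q \<inter> core k" by (auto simp: hits_def)
  then obtain p where "\<forall>n. p n \<in> approx n q \<inter> core k" by (rule choice[THEN exE])
  moreover have "point q \<in> core k" by (rule hits_near(2)[OF core(1) k])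
  ultimately show ?thesis by auto
qed

lemma point_in_letter:
  assumes q: "q \<in> located"
  shows "point q \<in> \<ll> q"
proof -
  obtain k p where "\<forall>n. p n \<in> approx n q \<and> p n \<in> core k" "point q \<in> core k"
    using located_sequence[OF q] by blast
  then have p: "\<And>n. p n \<in> approx n q" "\<And>n. p n \<in> core k" "point q \<in> core k" by blast+
  have qQ: "q \<in> space Q" by (rule located_space[OF q])
  have "closed (core k \<inter> \<ll> q)" using core(4) letter_in[OF qQ] by blast
  moreover have "p n \<in> core k \<inter> \<ll> q" for n using p approx_letter[OF qQ] by blast
  ultimately have "point q \<in> core k \<inter> \<ll> q"
    using near_limit[OF located_near[OF q] p(1)] by (rule closed_sequentially)
  then show ?thesis by simp
qed

text \<open>Candidates for \<open>q\<close> that lie in one compact set converge to \<open>point q\<close>, so their images converge to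
\<open>F (point q)\<close>. The images are close to candidates for \<open>S q\<close>, since the window of \<open>S q\<close> contains the
letters of the window of \<open>q\<close>.\<close>

lemma F_point:
  assumes q: "q \<in> located" and Sq: "S q \<in> located"
  shows "F (point q) = point (S q)"
proof -
  obtain k p where "\<forall>n. p n \<in> approx n q \<and> p n \<in> core k" "point q \<in> core k"
    using located_sequence[OF q] by blast
  then have p: "\<And>n. p n \<in> approx n q" "\<And>n. p n \<in> core k" "point q \<in> core k" by blast+
  have qQ: "q \<in> space Q" by (rule located_space[OF q])
  have lim: "(\<lambda>n. F (p n)) \<longlonglongrightarrow> F (point q)"
    by (rule continuous_on_tendsto_compose[OF core(5)[of k] near_limit[OF located_near[OF q] p(1)] p(3)])
      (simp add: p(2))
  have "dist (F (p n)) (point (S q)) \<le> 4 * K * \<gamma> ^ n" for n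
  proof -
    obtain z where z: "z \<in> cyl (window n q)" "p n = (F ^^ n) z" using p(1)[of n] by (auto simp: approx_def)
    obtain x where x: "x \<in> approx (Suc n) (S q)" using approx_nonempty[OF S_space[OF qQ]] by blast
    then obtain z' where z': "z' \<in> cyl (window (Suc n) (S q))" "x = (F ^^ Suc n) z'"
      unfolding approx_def by blast
    have "(S' ^^ Suc n) (S q) = (S' ^^ n) q"
      using S'_S[OF qQ] by (simp add: funpow_swap1)
    then have "window (Suc n) (S q) = itin ((2 * n + 1) + 2) ((S' ^^ n) q)"
      by (simp add: window_def)
    also have "\<dots> = window n q @ itin 2 ((S ^^ (2 * n + 1)) ((S' ^^ n) q))"
      unfolding window_def by (rule itin_add)
    finally have "z' \<in> cyl (window n q @ itin 2 ((S ^^ (2 * n + 1)) ((S' ^^ n) q)))"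
      using z'(1) by (simp only:)
    moreover have "itin 2 ((S ^^ (2 * n + 1)) ((S' ^^ n) q)) \<in> lists \<alpha>"
      by (intro itin_in_lists funpow_S_space funpow_S'_space qQ)
    ultimately have "z' \<in> cyl (window n q)"
      using cyl_append[OF window_in_lists[OF qQ]] by blast
    note contraction[OF window_in_lists[OF qQ] z(1) this, of "Suc n"]
    then have "dist (F (p n)) x \<le> K * (\<gamma> ^ n + \<gamma> ^ Suc n)"
      using z(2) z'(2) by (simp add: numeral_2_eq_2)
    also have "\<dots> \<le> K * (\<gamma> ^ n + \<gamma> ^ n)"
      using K_ge_1 \<gamma>_bounds by (intro mult_left_mono add_left_mono power_decreasing) auto
    finally have "dist (F (p n)) x \<le> 2 * K * \<gamma> ^ n" by simp
    moreover have "dist (point (S q)) x \<le> 2 * K * \<gamma> ^ Suc n"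
      using located_near[OF Sq] x unfolding near_def by blast
    moreover have "2 * K * \<gamma> ^ Suc n \<le> 2 * K * \<gamma> ^ n"
      using K_ge_1 \<gamma>_bounds by (intro mult_left_mono power_decreasing) auto
    ultimately show ?thesis using dist_triangle2[of "F (p n)" "point (S q)" x] by linarith
  qed
  then have "(\<lambda>n. F (p n)) \<longlonglongrightarrow> point (S q)"
    using K_ge_1 \<gamma>_bounds
    by (intro metric_tendsto_imp_tendsto[OF decay[of "4 * K"]] always_eventually) auto
  then show ?thesis using lim LIMSEQ_unique by blast
qed

lemma dist_point_le:
  assumes q: "q \<in> located" "q' \<in> located" and w: "window n q = window n q'"
  shows "dist (point q) (point q') \<le> 4 * K * \<gamma> ^ n"
proof -
  obtain x where x: "x \<in> approx n q" using approx_nonempty[OF located_space[OF q(1)]] by blast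
  then have "x \<in> approx n q'" using w by (simp add: approx_def)
  then have "dist (point q) x \<le> 2 * K * \<gamma> ^ n" "dist (point q') x \<le> 2 * K * \<gamma> ^ n"
    using x located_near[OF q(1)] located_near[OF q(2)] by (auto simp: near_def)
  then show ?thesis using dist_triangle2[of "point q" "point q'" x] by simp
qed

text \<open>The point is a limit of functions of the window, which take countably many values. Off \<open>located\<close> the
limit may fail to exist, whence the constant value there.\<close>

lemma point_measurable: "(\<lambda>q. if q \<in> located then point q else y0) \<in> borel_measurable Q"
proof (rule borel_measurable_LIMSEQ_metric)
  define z where "z n u = (F ^^ n) (SOME y. y \<in> cyl u)" for n u
  have "(\<lambda>q. z n (window n q)) \<in> borel_measurable Q" for n
    by (rule measurable_compose[OF window_measurable]) simp
  then show "(\<lambda>q. if q \<in> located then z n (window n q) else y0) \<in> borel_measurable Q" for n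
    by measurable
  fix q assume q: "q \<in> space Q"
  have "z n (window n q) \<in> approx n q" for n
    using someI_ex[of "\<lambda>y. y \<in> cyl (window n q)"] cyl_nonempty[OF window_in_lists[OF q]]
    by (auto simp: z_def approx_def)
  then show "(\<lambda>n. if q \<in> located then z n (window n q) else y0) \<longlonglongrightarrow> (if q \<in> located then point q else y0)"
    using near_limit[OF located_near] by auto
qed

text \<open>Compact subsets of \<open>a \<inter> B\<close> give one inequality for \<open>B\<close> and another one for its complement; both are
equalities because their sums over \<open>B\<close> and its complement agree.\<close>

lemma point_law:
  assumes a: "a \<in> \<alpha>" and B: "B \<in> sets borel"
  shows "emeasure Q {q \<in> located. \<ll> q = a \<and> point q \<in> B} = emeasure \<mu>c (a \<inter> B)"
proof -
  interpret Q: prob_space Q by (rule prob_Q)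
  interpret \<mu>c: prob_space \<mu>c by (rule prob_\<mu>c)
  let ?E = "\<lambda>B. {q \<in> located. \<ll> q = a \<and> point q \<in> B}"
  have E_sets: "?E B \<in> sets Q" if B: "B \<in> sets borel" for B
  proof -
    have "{q \<in> space Q. (if q \<in> located then point q else undefined) \<in> B} \<in> sets Q"
      using measurable_sets[OF point_measurable B] by (simp add: vimage_def Int_def conj_commute)
    moreover have "{q \<in> space Q. \<ll> q = a} \<in> sets Q" by measurable
    ultimately have "located \<inter> {q \<in> space Q. \<ll> q = a} \<inter>
        {q \<in> space Q. (if q \<in> located then point q else undefined) \<in> B} \<in> sets Q"
      by (intro sets.Int located_sets)
    moreover have "located \<inter> {q \<in> space Q. \<ll> q = a} \<inter>
        {q \<in> space Q. (if q \<in> located then point q else undefined) \<in> B} = ?E B"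
      using located_space by auto
    ultimately show ?thesis by simp
  qed
  have ge: "measure \<mu>c (a \<inter> B) \<le> measure Q (?E B)" if B: "B \<in> sets borel" for B
  proof (rule field_le_epsilon)
    fix e :: real assume e: "0 < e"
    have aB: "a \<inter> B \<in> sets \<mu>c" using letter_inter_sets[OF a B, of 0] by simp
    obtain C where C: "compact C" "C \<subseteq> a \<inter> B" "measure \<mu>c (a \<inter> B) - e < measure \<mu>c C"
      by (rule inner_compact[OF aB e])
    have "C \<inter> Y = C" using C(2) \<alpha>_subset[OF a] by auto
    then have "emeasure \<mu>c C \<le> emeasure Q (hits C)"
      using hits_measure[OF compact_sets[OF C(1)]] by simp
    also have "\<dots> \<le> emeasure Q (?E B)"
    proof (rule emeasure_mono_AE)
      show "AE q in Q. q \<in> hits C \<longrightarrow> q \<in> ?E B"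
        using AE_located
      proof eventually_elim
        fix q assume q: "q \<in> located"
        show "q \<in> hits C \<longrightarrow> q \<in> ?E B"
        proof
          assume "q \<in> hits C"
          then have "point q \<in> a \<inter> B" using hits_near(2)[OF C(1)] C(2) by blast
          moreover then have "\<ll> q = a"
            using point_in_letter[OF q] \<alpha>_disjoint[OF letter_in[OF located_space[OF q]] a] by blast
          ultimately show "q \<in> ?E B" using q by blast
        qed
      qed
    qed (rule E_sets[OF B])
    finally have "measure \<mu>c C \<le> measure Q (?E B)"
      by (simp add: Q.emeasure_eq_measure \<mu>c.emeasure_eq_measure)
    then show "measure \<mu>c (a \<inter> B) \<le> measure Q (?E B) + e" using C(3) by simp
  qed
  have nB: "- B \<in> sets borel" using B by auto
  have s: "a \<inter> B \<in> sets \<mu>c" "a \<inter> - B \<in> sets \<mu>c"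
    using letter_inter_sets[OF a B, of 0] letter_inter_sets[OF a nB, of 0] by simp_all
  have "measure Q (?E B) + measure Q (?E (- B)) = measure Q (?E B \<union> ?E (- B))"
    using E_sets[OF B] E_sets[OF nB] by (intro Q.finite_measure_Union[symmetric]) auto
  also have "\<dots> \<le> measure Q {q \<in> space Q. map (\<lambda>i. \<ll> ((S ^^ i) q)) [0..<length [a]] = [a]}"
    using located_space by (intro Q.finite_measure_mono) auto
  also have "\<dots> = lam [a]"
    using law[of "[a]"] a by (simp add: Q.emeasure_eq_measure lam_def del: cyl.simps)
  also have "cyl [a] = (a \<inter> B) \<union> (a \<inter> - B)" using return \<alpha>_subset[OF a] by auto
  then have "lam [a] = measure \<mu>c ((a \<inter> B) \<union> (a \<inter> - B))" by (simp only: lam_def)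
  also have "\<dots> = measure \<mu>c (a \<inter> B) + measure \<mu>c (a \<inter> - B)"
    using s by (intro \<mu>c.finite_measure_Union) auto
  finally have "measure Q (?E B) = measure \<mu>c (a \<inter> B)"
    using ge[OF B] ge[OF nB] by linarith
  then show ?thesis by (simp add: Q.emeasure_eq_measure \<mu>c.emeasure_eq_measure)
qed

end

section \<open>The tower over the hyperbolic map\<close>

context gibbs_words
begin

text \<open>The \<open>i\<close>-th letter exists with probability \<open>(1 - \<epsilon>) ^ i\<close> and then has the law of a first letter.\<close>

lemma nn_integral_word_sum:
  fixes f :: "nat \<Rightarrow> 'l \<Rightarrow> ennreal"
  shows "(\<integral>\<^sup>+ w. (\<Sum>i<length w. f i (w ! i)) \<partial>word_pmf) =
    (\<Sum>i. ennreal ((1 - \<epsilon>) ^ i) * (\<integral>\<^sup>+ b. f i b * ennreal (lam [b]) \<partial>count_space \<alpha>))"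
proof -
  let ?A = "\<lambda>i b. {w. i < length w \<and> w ! i = b}"
  have "(\<integral>\<^sup>+ w. (\<Sum>i<length w. f i (w ! i)) \<partial>word_pmf) =
      (\<integral>\<^sup>+ w. (\<Sum>i. \<integral>\<^sup>+ b. f i b * indicator (?A i b) w \<partial>count_space \<alpha>) \<partial>word_pmf)"
  proof (intro nn_integral_cong_AE AE_pmfI)
    fix w assume "w \<in> set_pmf word_pmf"
    then have w: "w \<in> lists \<alpha>" using set_word_pmf by blast
    have 1: "(\<integral>\<^sup>+ b. f i b * indicator (?A i b) w \<partial>count_space \<alpha>) =
        (if i < length w then f i (w ! i) else 0)" for i
    proof (cases "i < length w")
      case True
      then have "w ! i \<in> \<alpha>" using w by (auto simp: in_lists_conv_set)
      have "(\<integral>\<^sup>+ b. f i b * indicator (?A i b) w \<partial>count_space \<alpha>) =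
        (\<integral>\<^sup>+ b. f i (w ! i) * indicator {w ! i} b \<partial>count_space \<alpha>)"
        using True by (intro nn_integral_cong) (auto simp: indicator_def)
      also have "\<dots> = f i (w ! i)"
        using \<open>w ! i \<in> \<alpha>\<close> by (subst nn_integral_cmult_indicator) auto
      finally show ?thesis using True by simp
    qed simp
    have "(\<Sum>i. if i < length w then f i (w ! i) else 0) =
        (\<Sum>i<length w. if i < length w then f i (w ! i) else 0)"
      by (intro suminf_finite) auto
    then show "(\<Sum>i<length w. f i (w ! i)) =
        (\<Sum>i. \<integral>\<^sup>+ b. f i b * indicator (?A i b) w \<partial>count_space \<alpha>)"
      unfolding 1 by simp
  qed
  also have "\<dots> = (\<Sum>i. \<integral>\<^sup>+ w. \<integral>\<^sup>+ b. f i b * indicator (?A i b) w \<partial>count_space \<alpha> \<partial>word_pmf)"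
    by (intro nn_integral_suminf) simp
  also have "\<dots> = (\<Sum>i. \<integral>\<^sup>+ b. \<integral>\<^sup>+ w. f i b * indicator (?A i b) w \<partial>word_pmf \<partial>count_space \<alpha>)"
    by (intro suminf_cong nn_integral_count_space_nn_integral countable_alphabet) simp
  also have "\<dots> = (\<Sum>i. \<integral>\<^sup>+ b. ennreal ((1 - \<epsilon>) ^ i) * (f i b * ennreal (lam [b])) \<partial>count_space \<alpha>)"
  proof (intro suminf_cong nn_integral_cong)
    fix i b assume "b \<in> space (count_space \<alpha>)"
    then have b: "b \<in> \<alpha>" by simp
    have "(\<integral>\<^sup>+ w. f i b * indicator (?A i b) w \<partial>word_pmf) = f i b * emeasure word_pmf (?A i b)"
      by (intro nn_integral_cmult_indicator) simp
    moreover have "ennreal ((1 - \<epsilon>) ^ i * lam [b]) = ennreal ((1 - \<epsilon>) ^ i) * ennreal (lam [b])"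
      using \<epsilon>_less_1 lam_pos[of "[b]"] b by (simp add: ennreal_mult less_imp_le)
    ultimately show "(\<integral>\<^sup>+ w. f i b * indicator (?A i b) w \<partial>word_pmf) =
        ennreal ((1 - \<epsilon>) ^ i) * (f i b * ennreal (lam [b]))"
      unfolding emeasure_word_letter[OF b] by (simp only: ac_simps)
  qed
  also have "\<dots> = (\<Sum>i. ennreal ((1 - \<epsilon>) ^ i) * (\<integral>\<^sup>+ b. f i b * ennreal (lam [b]) \<partial>count_space \<alpha>))"
    by (intro suminf_cong nn_integral_cmult) simp
  finally show ?thesis .
qed

lemma geometric_series: "(\<Sum>i. ennreal ((1 - \<epsilon>) ^ i)) = ennreal (1 / \<epsilon>)"
proof (rule suminf_ennreal_eq)
  show "(\<lambda>i. (1 - \<epsilon>) ^ i) sums (1 / \<epsilon>)"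
    using geometric_sums[of "1 - \<epsilon>"] \<epsilon>_pos \<epsilon>_less_1 by simp
qed (use \<epsilon>_less_1 in simp)

lemma funpow_S_level: "k \<le> word_length (x 0) \<Longrightarrow>
  (S ^^ k) (x, 0) = (if k < word_length (x 0) then (x, k) else (left_shift x, 0))"
proof (induction k)
  case 0
  then show ?case using word_in_words[of "x 0"] by (simp add: words_def)
qed (auto simp: tower_map_def shift_height_def)

lemma reads_iff: "reads u q \<longleftrightarrow> map (\<lambda>i. letter ((S ^^ i) q)) [0..<length u] = u"
proof (induction u arbitrary: q)
  case (Cons b u)
  have "map (\<lambda>i. letter ((S ^^ i) q)) [0..<length (b # u)] =
      letter q # map (\<lambda>i. letter ((S ^^ i) (S q))) [0..<length u]"
    by (simp add: upt_rec[of 0] map_Suc_upt[symmetric] funpow_swap1 o_def del: upt_Suc)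
  then show ?case using Cons.IH[of "S q"] by simp
qed simp

end

context nonuniformly_hyperbolic
begin

lemma nn_integral_letters:
  fixes f :: "'a set \<Rightarrow> ennreal"
  assumes g: "\<And>a y. a \<in> \<alpha> \<Longrightarrow> y \<in> a \<Longrightarrow> g y = f a"
  shows "(\<integral>\<^sup>+ y. g y \<partial>\<mu>c) = (\<integral>\<^sup>+ a. f a * ennreal (lam [a]) \<partial>count_space \<alpha>)"
proof -
  have "(\<integral>\<^sup>+ y. g y \<partial>\<mu>c) = (\<integral>\<^sup>+ y. \<integral>\<^sup>+ a. f a * indicator a y \<partial>count_space \<alpha> \<partial>\<mu>c)"
  proof (rule nn_integral_cong)
    fix y assume "y \<in> space \<mu>c"
    then obtain a where a: "a \<in> \<alpha>" "y \<in> a" using \<alpha>_cover by (auto simp: space_\<mu>)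
    have "(\<integral>\<^sup>+ b. f b * indicator b y \<partial>count_space \<alpha>) = (\<integral>\<^sup>+ b. f a * indicator {a} b \<partial>count_space \<alpha>)"
      using a \<alpha>_disjoint by (intro nn_integral_cong) (auto simp: indicator_def)
    also have "\<dots> = g y" using a g by (subst nn_integral_cmult_indicator) auto
    finally show "g y = (\<integral>\<^sup>+ b. f b * indicator b y \<partial>count_space \<alpha>)" ..
  qed
  also have "\<dots> = (\<integral>\<^sup>+ a. \<integral>\<^sup>+ y. f a * indicator a y \<partial>\<mu>c \<partial>count_space \<alpha>)"
    using \<alpha>_measurable by (intro nn_integral_count_space_nn_integral \<alpha>_countable) auto
  also have "\<dots> = (\<integral>\<^sup>+ a. f a * ennreal (lam [a]) \<partial>count_space \<alpha>)"
  proof (intro nn_integral_cong)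
    fix a assume "a \<in> space (count_space \<alpha>)"
    then have a: "a \<in> \<alpha>" by simp
    have "a = cyl [a]" using \<alpha>_subset[OF a] return by auto
    then have "emeasure \<mu>c a = ennreal (lam [a])" using emeasure_cyl[of "[a]"] by (simp only:)
    then show "(\<integral>\<^sup>+ y. f a * indicator a y \<partial>\<mu>c) = f a * ennreal (lam [a])"
      using \<alpha>_measurable[OF a] by (simp add: nn_integral_cmult_indicator)
  qed
  finally show ?thesis .
qed

definition height :: "nat \<Rightarrow> nat" where
  "height c = (\<Sum>a\<leftarrow>gibbs.word c. value_on \<tau> a)"

lemma word_letter: "k < length (gibbs.word c) \<Longrightarrow> gibbs.word c ! k \<in> \<alpha>"
  using gibbs.word_in_words[of c] by (auto simp: gibbs.words_def in_lists_conv_set)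

lemma height_eq: "height c = (\<Sum>k<length (gibbs.word c). value_on \<tau> (gibbs.word c ! k))"
  by (simp add: height_def sum_list_sum_nth atLeast0LessThan)

lemma height_pos: "1 \<le> height c"
proof -
  have "gibbs.word c \<noteq> []" using gibbs.word_in_words[of c] by (auto simp: gibbs.words_def)
  then have 0: "0 < length (gibbs.word c)" by simp
  then have "1 \<le> value_on \<tau> (gibbs.word c ! 0)" by (intro value_on_\<tau>_pos word_letter)
  also have "\<dots> = (\<Sum>k\<in>{0}. value_on \<tau> (gibbs.word c ! k))" by simp
  also have "\<dots> \<le> height c" unfolding height_eq using 0 by (intro sum_mono2) auto
  finally show ?thesis .
qed

lemma nn_integral_height:
  "(\<integral>\<^sup>+ c. of_nat (height c) \<partial>gibbs.code_pmf) = ennreal (1 / gibbs.\<epsilon>) * mean_return"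
proof -
  have "(\<integral>\<^sup>+ c. of_nat (height c) \<partial>gibbs.code_pmf) =
      (\<integral>\<^sup>+ w. (\<Sum>i<length w. of_nat (value_on \<tau> (w ! i))) \<partial>map_pmf gibbs.word gibbs.code_pmf)"
    by (simp add: height_eq)
  also have "\<dots> = (\<Sum>i. ennreal ((1 - gibbs.\<epsilon>) ^ i) *
      (\<integral>\<^sup>+ a. of_nat (value_on \<tau> a) * ennreal (lam [a]) \<partial>count_space \<alpha>))"
    unfolding gibbs.map_word_code_pmf by (rule gibbs.nn_integral_word_sum)
  also have "\<dots> = (\<Sum>i. ennreal ((1 - gibbs.\<epsilon>) ^ i)) *
      (\<integral>\<^sup>+ a. of_nat (value_on \<tau> a) * ennreal (lam [a]) \<partial>count_space \<alpha>)"
    by (rule ennreal_suminf_multc)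
  also have "(\<integral>\<^sup>+ a. of_nat (value_on \<tau> a) * ennreal (lam [a]) \<partial>count_space \<alpha>) = mean_return"
    by (rule nn_integral_letters[symmetric]) (simp add: value_on_\<tau>)
  finally show ?thesis by (simp add: gibbs.geometric_series)
qed

lemma tower_height: "markov_shift_tower (measure_pmf gibbs.code_pmf) height \<gamma>"
proof
  have "(\<integral>\<^sup>+ c. of_nat (height c) \<partial>gibbs.code_pmf) < \<infinity>"
    unfolding nn_integral_height using \<tau>_integrable by (simp add: ennreal_mult_less_top)
  then show "integrable (measure_pmf gibbs.code_pmf) (\<lambda>a. real (height a))"
    by (simp add: integrable_iff_bounded ennreal_of_nat_eq_real_of_nat)
qed (use height_pos \<gamma>_bounds in auto)

end

sublocale nonuniformly_hyperbolic \<subseteq> tall: markov_shift_tower "measure_pmf gibbs.code_pmf" height \<gamma>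
  by (rule tower_height)

sublocale nonuniformly_hyperbolic \<subseteq> symb: symbolic_model m T Y \<alpha> \<tau> \<mu> W K \<gamma> gibbs.Q gibbs.S
  "tower_map_inv gibbs.word_length" gibbs.letter
proof (intro symbolic_model.intro symbolic_model_axioms.intro)
  show "nonuniformly_hyperbolic m T Y \<alpha> \<tau> \<mu> W K \<gamma>" by (rule nonuniformly_hyperbolic_axioms)
  show "prob_space gibbs.Q" by (rule gibbs.word.prob_tower_measure)
  show "gibbs.S \<in> gibbs.Q \<rightarrow>\<^sub>M gibbs.Q" by (rule gibbs.word.measurable_tower_map)
  show "distr gibbs.Q gibbs.Q gibbs.S = gibbs.Q" by (rule gibbs.word.distr_tower_map)
  show "tower_map_inv gibbs.word_length \<in> gibbs.Q \<rightarrow>\<^sub>M gibbs.Q" by (rule gibbs.word.measurable_tower_map_inv)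
  show "gibbs.S (tower_map_inv gibbs.word_length q) = q" if "q \<in> space gibbs.Q" for q
    using that by (intro gibbs.word.tower_map_tower_map_inv) (simp only: gibbs.word.space_tower_measure)
  show "tower_map_inv gibbs.word_length (gibbs.S q) = q" if "q \<in> space gibbs.Q" for q
    using that by (intro gibbs.word.tower_map_inv_tower_map) (simp only: gibbs.word.space_tower_measure)
  show "gibbs.letter \<in> gibbs.Q \<rightarrow>\<^sub>M count_space UNIV" by (rule gibbs.measurable_letter)
  show "gibbs.letter q \<in> \<alpha>" if "q \<in> space gibbs.Q" for q by (rule gibbs.letter_in_alphabet[OF that])
  show "emeasure gibbs.Q {q \<in> space gibbs.Q. map (\<lambda>i. gibbs.letter ((gibbs.S ^^ i) q)) [0..<length u] = u} =
      ennreal (lam u)" if "u \<in> lists \<alpha>" for u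
    using gibbs.emeasure_Q_reads[OF that] unfolding gibbs.reads_iff .
qed

context nonuniformly_hyperbolic
begin

abbreviation prev :: "(int \<Rightarrow> nat) \<times> nat \<Rightarrow> (int \<Rightarrow> nat) \<times> nat" where
  "prev \<equiv> tower_map_inv gibbs.word_length"

abbreviation PA :: "nat measure" where "PA \<equiv> measure_pmf gibbs.code_pmf"

text \<open>All forward iterates are required to be located, so that the base is mapped into itself and the
points along one word are successive iterates under \<open>F\<close>.\<close>

definition base :: "(int \<Rightarrow> nat) set" where
  "base = {x. \<forall>i. (gibbs.S ^^ i) (x, 0) \<in> symb.located}"

definition domain :: "((int \<Rightarrow> nat) \<times> nat) set" where
  "domain = {(x, l). x \<in> base \<and> l < height (x 0)}"

definition foot :: "(int \<Rightarrow> nat) \<Rightarrow> 'a" where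
  "foot x = symb.point (x, 0)"

definition proj :: "(int \<Rightarrow> nat) \<times> nat \<Rightarrow> 'a" where
  "proj = (\<lambda>(x, l). (T ^^ l) (foot x))"

lemma word_length_pos: "0 < gibbs.word_length c"
  using gibbs.word_in_words[of c] by (auto simp: gibbs.words_def)

lemma level_zero_measurable: "(\<lambda>x. (x, 0)) \<in> gibbs.P \<rightarrow>\<^sub>M gibbs.Q"
  using word_length_pos
  by (intro gibbs.word.measurable_into_tower) (auto simp: tower_def gibbs.space_P shift_height_def)

lemma base_sets: "base \<in> sets gibbs.P"
proof -
  have "(\<lambda>x. (gibbs.S ^^ i) (x, 0)) -` symb.located \<inter> space gibbs.P \<in> sets gibbs.P" for i
    by (rule measurable_sets[OF measurable_compose[OF level_zero_measurable symb.funpow_S_measurable]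
          symb.located_sets])
  then have "(\<Inter>i. (\<lambda>x. (gibbs.S ^^ i) (x, 0)) -` symb.located \<inter> space gibbs.P) \<in> sets gibbs.P"
    by (intro sets.countable_INT) auto
  also have "(\<Inter>i. (\<lambda>x. (gibbs.S ^^ i) (x, 0)) -` symb.located \<inter> space gibbs.P) = base"
    by (auto simp: base_def gibbs.space_P)
  finally show ?thesis .
qed

lemma AE_base: "AE x in gibbs.P. x \<in> base"
proof -
  have "AE q in gibbs.Q. (gibbs.S ^^ i) q \<in> symb.located" for i
  proof (induction i)
    case 0
    then show ?case using symb.AE_located by simp
  next
    case (Suc i)
    have m: "{q \<in> space gibbs.Q. (gibbs.S ^^ i) q \<in> symb.located} \<in> sets gibbs.Q"
      using measurable_sets[OF symb.funpow_S_measurable symb.located_sets, of i]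
      by (simp add: vimage_def Int_def conj_commute)
    have "AE q in distr gibbs.Q gibbs.Q gibbs.S. (gibbs.S ^^ i) q \<in> symb.located"
      by (subst gibbs.word.distr_tower_map) (rule Suc)
    then have "AE q in gibbs.Q. (gibbs.S ^^ i) (gibbs.S q) \<in> symb.located"
      using m by (subst (asm) AE_distr_iff) (auto simp: symb.S_measurable)
    then show ?case by (simp add: funpow_swap1)
  qed
  then have ae: "AE q in gibbs.Q. \<forall>i. (gibbs.S ^^ i) q \<in> symb.located" by (subst AE_all_countable) simp
  \<comment> \<open>Level 0 is one of the countably many slices whose measures add up to that of the null set.\<close>
  then obtain N where N: "N \<in> null_sets gibbs.Q"
    "{q \<in> space gibbs.Q. \<not> (\<forall>i. (gibbs.S ^^ i) q \<in> symb.located)} \<subseteq> N"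
    by (rule AE_E) (auto simp: null_sets_def)
  have "0 = inverse gibbs.word.mean_height * (\<Sum>k. emeasure gibbs.P {x \<in> space gibbs.P. (x, k) \<in> N})"
    using N(1) gibbs.word.emeasure_tower[of N] by (auto simp: null_sets_def)
  then have "(\<Sum>k. emeasure gibbs.P {x \<in> space gibbs.P. (x, k) \<in> N}) = 0"
    using gibbs.word.mean_height_finite by (auto simp: ennreal_inverse_eq_0_iff)
  then have "emeasure gibbs.P {x \<in> space gibbs.P. (x, 0) \<in> N} = 0"
    by (subst (asm) suminf_eq_zero_iff) auto
  moreover have "{x \<in> space gibbs.P. (x, 0) \<in> N} \<in> sets gibbs.P"
    using N(1) by (intro gibbs.word.sets_tower_level) (auto simp: null_sets_def)
  ultimately have null: "{x \<in> space gibbs.P. (x, 0) \<in> N} \<in> null_sets gibbs.P" by (simp add: null_sets_def)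
  show ?thesis
  proof (rule AE_I'[OF null], intro subsetI)
    fix x assume "x \<in> {x \<in> space gibbs.P. x \<notin> base}"
    then show "x \<in> {x \<in> space gibbs.P. (x, 0) \<in> N}"
      using N(2) word_length_pos by (auto simp: base_def gibbs.space_Q)
  qed
qed

lemma base_orbit: "x \<in> base \<Longrightarrow> (gibbs.S ^^ i) (x, 0) \<in> symb.located"
  unfolding base_def by blast

lemma base_located: "x \<in> base \<Longrightarrow> k < gibbs.word_length (x 0) \<Longrightarrow> (x, k) \<in> symb.located"
  using gibbs.funpow_S_level[of k x] base_orbit[of x k] by simp

lemma base_left_shift: "x \<in> base \<Longrightarrow> left_shift x \<in> base"
proof -
  assume x: "x \<in> base"
  have "(gibbs.S ^^ (i + gibbs.word_length (x 0))) (x, 0) = (gibbs.S ^^ i) (left_shift x, 0)" for i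
    using gibbs.funpow_S_level[of "gibbs.word_length (x 0)" x] by (simp add: funpow_add)
  then have "(gibbs.S ^^ i) (left_shift x, 0) \<in> symb.located" for i
    using base_orbit[OF x, of "i + gibbs.word_length (x 0)"] by (simp only:)
  then show ?thesis by (simp add: base_def)
qed

text \<open>The level in the tower at which the excursion of the \<open>k\<close>-th letter of the first word starts.\<close>

definition stop :: "(int \<Rightarrow> nat) \<Rightarrow> nat \<Rightarrow> nat" where
  "stop x k = (\<Sum>i<k. value_on \<tau> (gibbs.word (x 0) ! i))"

lemma stop_word_length: "stop x (gibbs.word_length (x 0)) = height (x 0)"
  by (simp add: stop_def height_eq)

lemma return_time_point:
  assumes x: "x \<in> base" and k: "k < gibbs.word_length (x 0)"
  shows "\<tau> (symb.point (x, k)) = value_on \<tau> (gibbs.word (x 0) ! k)"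
proof -
  have "symb.point (x, k) \<in> gibbs.letter (x, k)"
    by (rule symb.point_in_letter[OF base_located[OF x k]])
  then have "symb.point (x, k) \<in> gibbs.word (x 0) ! k" by (simp add: gibbs.letter_def)
  then show ?thesis using value_on_\<tau>[OF word_letter[OF k]] by simp
qed

lemma T_stop:
  assumes x: "x \<in> base"
  shows "k \<le> gibbs.word_length (x 0) \<Longrightarrow> (T ^^ stop x k) (foot x) = symb.point ((gibbs.S ^^ k) (x, 0))"
proof (induction k)
  case 0
  then show ?case by (simp add: stop_def foot_def)
next
  case (Suc k)
  then have k: "k < gibbs.word_length (x 0)" by simp
  let ?q = "(gibbs.S ^^ k) (x, 0)"
  have q: "?q = (x, k)" using gibbs.funpow_S_level[of k x] k by simp
  have "stop x (Suc k) = value_on \<tau> (gibbs.word (x 0) ! k) + stop x k" by (simp add: stop_def)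
  then have "(T ^^ stop x (Suc k)) (foot x) = (T ^^ value_on \<tau> (gibbs.word (x 0) ! k)) (symb.point ?q)"
    using Suc k by (simp add: funpow_add)
  also have "\<dots> = F (symb.point ?q)"
    unfolding q induced_map_def return_time_point[OF x k] ..
  also have "\<dots> = symb.point (gibbs.S ?q)"
    using base_orbit[OF x, of k] base_orbit[OF x, of "Suc k"] by (intro symb.F_point) simp_all
  finally show ?case by simp
qed

lemma foot_left_shift: "x \<in> base \<Longrightarrow> (T ^^ height (x 0)) (foot x) = foot (left_shift x)"
  using T_stop[of x "gibbs.word_length (x 0)"] gibbs.funpow_S_level[of "gibbs.word_length (x 0)" x]
  by (simp add: stop_word_length foot_def)

lemma domain_invariant: "p \<in> domain \<Longrightarrow> tower_map height p \<in> domain"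
  using base_left_shift height_pos[of "fst p 1"]
  by (cases p) (auto simp: domain_def tower_map_def shift_height_def left_shift_def Suc_le_eq)

lemma proj_semiconjugacy:
  assumes "p \<in> domain"
  shows "proj (tower_map height p) = T (proj p)"
proof -
  obtain x l where p: "p = (x, l)" "x \<in> base" "l < height (x 0)" using assms by (auto simp: domain_def)
  show ?thesis
  proof (cases "l < height (x 0) - 1")
    case True
    then show ?thesis using p by (simp add: proj_def tower_map_def shift_height_def)
  next
    case False
    then have "Suc l = height (x 0)" using p by simp
    then have "T (proj p) = foot (left_shift x)"
      using foot_left_shift[OF p(2)] p(1) by (simp add: proj_def flip: funpow.simps(2))
        (metis comp_apply funpow.simps(2))
    then show ?thesis using False p by (simp add: proj_def tower_map_def shift_height_def)
  qed
qed

lemma stop_split: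
  fixes f :: "nat \<Rightarrow> nat"
  assumes "l < (\<Sum>i<n. f i)"
  shows "\<exists>k<n. \<exists>j<f k. l = (\<Sum>i<k. f i) + j"
  using assms
proof (induction n)
  case (Suc n)
  show ?case
  proof (cases "l < (\<Sum>i<n. f i)")
    case True
    then show ?thesis using Suc.IH less_SucI by blast
  next
    case False
    then have "l - (\<Sum>i<n. f i) < f n" "l = (\<Sum>i<n. f i) + (l - (\<Sum>i<n. f i))" using Suc.prems by auto
    then show ?thesis by blast
  qed
qed simp

text \<open>The two tower points sit at the same level and see the same symbols from \<open>- p\<close> to \<open>r\<close>. A step along
the tower uses up at most one symbol on the side to which it moves.\<close>

definition agree :: "int \<Rightarrow> int \<Rightarrow> (int \<Rightarrow> nat) \<times> nat \<Rightarrow> (int \<Rightarrow> nat) \<times> nat \<Rightarrow> bool" where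
  "agree p r q q' \<longleftrightarrow> snd q = snd q' \<and> (\<forall>j. - p \<le> j \<and> j \<le> r \<longrightarrow> fst q j = fst q' j)"

lemma agree_S: "agree p r q q' \<Longrightarrow> 0 \<le> p \<Longrightarrow> 1 \<le> r \<Longrightarrow> agree p (r - 1) (gibbs.S q) (gibbs.S q')"
  by (cases q; cases q') (auto simp: agree_def tower_map_def shift_height_def left_shift_def)

lemma agree_prev: "agree p r q q' \<Longrightarrow> 1 \<le> p \<Longrightarrow> 0 \<le> r \<Longrightarrow> agree (p - 1) r (prev q) (prev q')"
  by (cases q; cases q') (auto simp: agree_def tower_map_inv_def right_shift_def)

lemma agree_funpow_S:
  "agree p r q q' \<Longrightarrow> 0 \<le> p \<Longrightarrow> int n \<le> r \<Longrightarrow> agree p (r - int n) ((gibbs.S ^^ n) q) ((gibbs.S ^^ n) q')"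
proof (induction n)
  case (Suc n)
  then have "agree p (r - int n) ((gibbs.S ^^ n) q) ((gibbs.S ^^ n) q')" by simp
  from agree_S[OF this] show ?case using Suc.prems by (simp add: algebra_simps)
qed simp

lemma agree_funpow_prev:
  "agree p r q q' \<Longrightarrow> 0 \<le> r \<Longrightarrow> int n \<le> p \<Longrightarrow> agree (p - int n) r ((prev ^^ n) q) ((prev ^^ n) q')"
proof (induction n)
  case (Suc n)
  then have "agree (p - int n) r ((prev ^^ n) q) ((prev ^^ n) q')" by simp
  from agree_prev[OF this] show ?case using Suc.prems by (simp add: algebra_simps)
qed simp

lemma agree_letter: "agree p r q q' \<Longrightarrow> 0 \<le> p \<Longrightarrow> 0 \<le> r \<Longrightarrow> gibbs.letter q = gibbs.letter q'"
  by (auto simp: agree_def gibbs.letter_def)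

text \<open>Moving back and then forward again must not be counted as forward moves: up to time 0 the letters of
the window lie on the backward orbit.\<close>

lemma agree_window:
  assumes a: "agree p r q q'" and q: "q \<in> space gibbs.Q" "q' \<in> space gibbs.Q"
    and N: "int N \<le> p" "int N \<le> r"
  shows "symb.window N q = symb.window N q'"
proof (rule nth_equalityI)
  fix i assume "i < length (symb.window N q)"
  then have i: "i < 2 * N + 1" by simp
  have eq: "(gibbs.S ^^ i) ((prev ^^ N) q) =
      (if i \<le> N then (prev ^^ (N - i)) q else (gibbs.S ^^ (i - N)) q)" if "q \<in> space gibbs.Q" for q
  proof (cases "i \<le> N")
    case True
    have "(prev ^^ N) q = (prev ^^ (i + (N - i))) q" using True by simp
    also have "\<dots> = (prev ^^ i) ((prev ^^ (N - i)) q)" by (simp only: funpow_add comp_apply)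
    finally show ?thesis using True symb.funpow_S_S'[OF symb.funpow_S'_space[OF that]] by simp
  next
    case False
    have "(gibbs.S ^^ i) ((prev ^^ N) q) = (gibbs.S ^^ ((i - N) + N)) ((prev ^^ N) q)" using False by simp
    also have "\<dots> = (gibbs.S ^^ (i - N)) ((gibbs.S ^^ N) ((prev ^^ N) q))" by (simp only: funpow_add comp_apply)
    finally show ?thesis using False symb.funpow_S_S'[OF that] by simp
  qed
  have "gibbs.letter ((gibbs.S ^^ i) ((prev ^^ N) q)) = gibbs.letter ((gibbs.S ^^ i) ((prev ^^ N) q'))"
  proof (cases "i \<le> N")
    case True
    have "agree (p - int (N - i)) r ((prev ^^ (N - i)) q) ((prev ^^ (N - i)) q')"
      using N by (intro agree_funpow_prev[OF a]) auto
    then show ?thesis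
      using True eq[OF q(1)] eq[OF q(2)] N by (simp add: agree_letter)
  next
    case False
    have "agree p (r - int (i - N)) ((gibbs.S ^^ (i - N)) q) ((gibbs.S ^^ (i - N)) q')"
      using N i by (intro agree_funpow_S[OF a]) auto
    moreover have "0 \<le> r - int (i - N)" using N i by linarith
    moreover have "0 \<le> p" using N by linarith
    ultimately show ?thesis using False eq[OF q(1)] eq[OF q(2)] agree_letter by simp
  qed
  then show "symb.window N q ! i = symb.window N q' ! i"
    unfolding symb.window_def symb.itin_def using i by (simp del: upt_Suc add: nth_map)
qed simp

lemma symbolic_separation_agree:
  assumes "enat n \<le> symbolic_separation x y" "\<bar>j\<bar> < int n"
  shows "x j = y j"
proof (rule ccontr)
  assume "x j \<noteq> y j"
  then have "x (int (nat \<bar>j\<bar>)) \<noteq> y (int (nat \<bar>j\<bar>)) \<or> x (- int (nat \<bar>j\<bar>)) \<noteq> y (- int (nat \<bar>j\<bar>))"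
    by (cases "0 \<le> j") auto
  then have "symbolic_separation x y \<le> enat (nat \<bar>j\<bar>)"
    unfolding symbolic_separation_def by (intro Inf_lower) auto
  then have "enat n \<le> enat (nat \<bar>j\<bar>)" using assms(1) by (rule order_trans[rotated])
  then show False using assms(2) by simp
qed

text \<open>The two points are at the same stage \<open>j\<close> of an excursion from the same letter. The start and the end
of the excursion are points whose windows of radius \<open>n\<close> agree; the end may lie in the next word, which
is why \<open>n + 2\<close> symbols are needed.\<close>

lemma proj_lipschitz_level:
  assumes x: "x \<in> base" "x' \<in> base" and l: "l < height (x 0)"
    and n: "\<And>j. \<bar>j\<bar> < int (n + 2) \<Longrightarrow> x j = x' j"
  shows "dist (proj (x, l)) (proj (x', l)) \<le> 8 * K ^ 2 * \<gamma> ^ n"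
proof -
  have x0: "x 0 = x' 0" using n by simp
  let ?w = "gibbs.word (x 0)"
  obtain k j where kj: "k < length ?w" "j < value_on \<tau> (?w ! k)" "l = stop x k + j"
    using stop_split[of l "\<lambda>i. value_on \<tau> (?w ! i)" "length ?w"] l by (auto simp: height_eq stop_def)
  have stop: "stop x' k = stop x k" by (simp add: stop_def x0)
  have lev: "(gibbs.S ^^ k) (x, 0) = (x, k)" "(gibbs.S ^^ k) (x', 0) = (x', k)"
    using gibbs.funpow_S_level[of k x] gibbs.funpow_S_level[of k x'] kj(1) x0 by simp_all
  let ?y = "symb.point (x, k)" and ?y' = "symb.point (x', k)"
  have proj: "proj (x, l) = (T ^^ j) ?y" "proj (x', l) = (T ^^ j) ?y'"
    using T_stop[OF x(1), of k] T_stop[OF x(2), of k] kj(1,3) lev stop x0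
    by (simp_all add: proj_def add.commute[of _ j] funpow_add)
  have loc: "(x, k) \<in> symb.located" "(x', k) \<in> symb.located"
    using base_located[OF x(1), of k] base_located[OF x(2), of k] kj(1) x0 by auto
  have S_loc: "gibbs.S (x, k) \<in> symb.located" "gibbs.S (x', k) \<in> symb.located"
    using base_orbit[OF x(1), of "Suc k"] base_orbit[OF x(2), of "Suc k"] lev by simp_all
  have y: "?y \<in> ?w ! k" "?y' \<in> ?w ! k"
    using symb.point_in_letter[OF loc(1)] symb.point_in_letter[OF loc(2)] x0 by (simp_all add: gibbs.letter_def)
  have a: "agree (int (Suc n)) (int (Suc n)) (x, k) (x', k)"
    using n by (auto simp: agree_def)
  have "symb.window n (x, k) = symb.window n (x', k)"
    using symb.located_space[OF loc(1)] symb.located_space[OF loc(2)] by (intro agree_window[OF a]) auto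
  then have d1: "dist ?y ?y' \<le> 4 * K * \<gamma> ^ n" by (rule symb.dist_point_le[OF loc])
  have "agree (int (Suc n)) (int (Suc n) - 1) (gibbs.S (x, k)) (gibbs.S (x', k))"
    by (rule agree_S[OF a]) auto
  then have "symb.window n (gibbs.S (x, k)) = symb.window n (gibbs.S (x', k))"
    using symb.located_space[OF S_loc(1)] symb.located_space[OF S_loc(2)] by (intro agree_window) auto
  then have "dist (symb.point (gibbs.S (x, k))) (symb.point (gibbs.S (x', k))) \<le> 4 * K * \<gamma> ^ n"
    by (rule symb.dist_point_le[OF S_loc])
  then have d2: "dist (F ?y) (F ?y') \<le> 4 * K * \<gamma> ^ n"
    using symb.F_point[OF loc(1) S_loc(1)] symb.F_point[OF loc(2) S_loc(2)] by simp
  have "dist ((T ^^ j) ?y) ((T ^^ j) ?y') \<le> K * (dist ?y ?y' + dist (F ?y) (F ?y'))"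
    using kj(2) y by (intro excursion[OF word_letter[OF kj(1)]]) auto
  also have "\<dots> \<le> K * (4 * K * \<gamma> ^ n + 4 * K * \<gamma> ^ n)"
    using d1 d2 K_ge_1 by (intro mult_left_mono add_mono) auto
  finally show ?thesis unfolding proj by (simp add: power2_eq_square algebra_simps)
qed

text \<open>Comparing \<open>\<gamma> ^ (n - 2)\<close> with \<open>\<gamma> ^ n\<close> puts \<open>\<gamma> ^ 2\<close> into the constant; separation times below 2 are
covered by the diameter \<open>B\<close> of the space.\<close>

lemma proj_lipschitz:
  "\<exists>C\<ge>0. \<forall>p\<in>domain. \<forall>q\<in>domain. dist (proj p) (proj q) \<le> C * tower_dist \<gamma> p q"
proof -
  obtain B where B: "\<And>x y :: 'a. dist x y \<le> B"
    using bounded_space by (auto simp: bounded_two_points)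
  have B0: "0 \<le> B" using B[of undefined undefined] by simp
  define C where "C = (B + 8 * K ^ 2) / \<gamma> ^ 2"
  have \<gamma>2: "0 < \<gamma> ^ 2" using \<gamma>_bounds by simp
  have C1: "B \<le> C * \<gamma> ^ n" if "n \<le> 1" for n
  proof -
    have "\<gamma> ^ 2 \<le> \<gamma> ^ n" using that \<gamma>_bounds by (intro power_decreasing) auto
    then have "C * \<gamma> ^ 2 \<le> C * \<gamma> ^ n"
      using B0 \<gamma>2 by (intro mult_left_mono) (auto simp: C_def)
    moreover have "C * \<gamma> ^ 2 = B + 8 * K ^ 2" using \<gamma>2 by (simp add: C_def)
    ultimately show ?thesis by (smt (verit) zero_le_power2)
  qed
  have "dist (proj p) (proj q) \<le> C * tower_dist \<gamma> p q" if p: "p \<in> domain" and q: "q \<in> domain" for p q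
  proof -
    obtain x l where pp: "p = (x, l)" "x \<in> base" "l < height (x 0)" using p by (auto simp: domain_def)
    obtain x' l' where qq: "q = (x', l')" "x' \<in> base" "l' < height (x' 0)" using q by (auto simp: domain_def)
    show ?thesis
    proof (cases "l = l'")
      case False
      then have "tower_dist \<gamma> p q = 1" using pp qq by (simp add: tower_dist_def)
      then show ?thesis using C1[of 0] B[of "proj p" "proj q"] by simp
    next
      case l: True
      then have td: "tower_dist \<gamma> p q = gap_power \<gamma> (symbolic_separation x x') 0"
        using pp qq by (simp add: tower_dist_def shift_dist_def)
      show ?thesis
      proof (cases "symbolic_separation x x'")
        case infinity
        have "x j = x' j" for j
          using symbolic_separation_agree[of "nat \<bar>j\<bar> + 1" x x' j] infinity by simp
        then have "x = x'" by auto
        then have "p = q" using pp(1) qq(1) l by simp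
        then show ?thesis using infinity td by (simp add: gap_power_def)
      next
        case (enat n)
        then have td: "tower_dist \<gamma> p q = \<gamma> ^ n" using td by (simp add: gap_power_def)
        show ?thesis
        proof (cases "n \<le> 1")
          case True
          then show ?thesis using C1[OF True] B[of "proj p" "proj q"] td by simp
        next
          case False
          then obtain k where k: "n = k + 2" by (metis add.commute le_Suc_ex not_less_eq_eq one_add_one plus_1_eq_Suc)
          have "dist (proj p) (proj q) \<le> 8 * K ^ 2 * \<gamma> ^ k"
            unfolding pp(1) qq(1) l[symmetric]
          proof (rule proj_lipschitz_level[OF pp(2) qq(2) pp(3)])
            show "x j = x' j" if "\<bar>j\<bar> < int (k + 2)" for j
              using symbolic_separation_agree[of n x x' j] that enat k by simp
          qed
          also have "\<dots> \<le> (B + 8 * K ^ 2) * \<gamma> ^ k"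
            using B0 \<gamma>_bounds by (intro mult_right_mono) auto
          also have "\<dots> = C * \<gamma> ^ n" using \<gamma>_bounds(1) by (simp add: C_def k power2_eq_square)
          finally show ?thesis using td by simp
        qed
      qed
    qed
  qed
  moreover have "0 \<le> C" using B0 by (simp add: C_def)
  ultimately show ?thesis by blast
qed

definition letter_event :: "'a set \<Rightarrow> 'a set \<Rightarrow> ((int \<Rightarrow> nat) \<times> nat) set" where
  "letter_event a B = {q \<in> symb.located. gibbs.letter q = a \<and> symb.point q \<in> B}"

lemma letter_event_sets:
  assumes B: "B \<in> sets borel"
  shows "letter_event a B \<in> sets gibbs.Q"
proof -
  let ?p = "\<lambda>q. if q \<in> symb.located then symb.point q else undefined"
  have 1: "?p -` B \<inter> space gibbs.Q \<in> sets gibbs.Q"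
    by (rule measurable_sets[OF symb.point_measurable B])
  have 2: "gibbs.letter -` {a} \<inter> space gibbs.Q \<in> sets gibbs.Q"
    by (rule measurable_sets[OF gibbs.measurable_letter]) simp
  have "symb.located \<inter> (gibbs.letter -` {a} \<inter> space gibbs.Q) \<inter> (?p -` B \<inter> space gibbs.Q) \<in> sets gibbs.Q"
    by (rule sets.Int[OF sets.Int[OF symb.located_sets 2] 1])
  also have "symb.located \<inter> (gibbs.letter -` {a} \<inter> space gibbs.Q) \<inter> (?p -` B \<inter> space gibbs.Q) =
      letter_event a B"
    using symb.located_space by (auto simp: letter_event_def)
  finally show ?thesis .
qed

lemma level_sum:
  assumes a: "a \<in> \<alpha>" and B: "B \<in> sets borel"
  shows "(\<integral>\<^sup>+ x. (\<Sum>k<gibbs.word_length (x 0). indicator (letter_event a B) (x, k)) \<partial>gibbs.P) =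
    ennreal (1 / gibbs.\<epsilon>) * emeasure \<mu>c (a \<inter> B)"
proof -
  have mh: "gibbs.word.mean_height = ennreal (1 / gibbs.\<epsilon>)"
    unfolding gibbs.word.mean_height_eq by (rule gibbs.nn_integral_word_length)
  let ?I = "\<integral>\<^sup>+ x. (\<Sum>k<gibbs.word_length (x 0). indicator (letter_event a B) (x, k)) \<partial>gibbs.P"
  have "emeasure \<mu>c (a \<inter> B) = emeasure gibbs.Q (letter_event a B)"
    unfolding letter_event_def using symb.point_law[OF a B] ..
  also have "\<dots> = inverse gibbs.word.mean_height * ?I"
    using gibbs.word.emeasure_tower'[OF letter_event_sets[OF B]] by (simp add: shift_height_def)
  finally have "gibbs.word.mean_height * emeasure \<mu>c (a \<inter> B) =
      (inverse gibbs.word.mean_height * gibbs.word.mean_height) * ?I"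
    by (simp add: ac_simps)
  then show ?thesis unfolding gibbs.word.mean_height_inverse by (simp add: mh)
qed

lemma sum_stops:
  fixes f :: "nat \<Rightarrow> nat" and g :: "nat \<Rightarrow> 'z :: comm_monoid_add"
  shows "(\<Sum>l<(\<Sum>i<n. f i). g l) = (\<Sum>k<n. \<Sum>j<f k. g ((\<Sum>i<k. f i) + j))"
proof (induction n)
  case (Suc n)
  have "(\<Sum>l<a + b. g l) = (\<Sum>l<a. g l) + (\<Sum>j<b. g (a + j))" for a b
    by (induction b) (auto simp: add.assoc)
  then show ?case using Suc by simp
qed simp

text \<open>The levels over \<open>x\<close> are grouped by the letter in whose excursion they lie.\<close>

lemma fiber_count:
  assumes x: "x \<in> base" and E: "E \<in> sets borel"
  shows "(\<Sum>l<height (x 0). indicator E (proj (x, l)) :: ennreal) =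
    (\<integral>\<^sup>+ a. (\<Sum>j<value_on \<tau> a. \<Sum>k<gibbs.word_length (x 0).
        indicator (letter_event a ((T ^^ j) -` E)) (x, k)) \<partial>count_space \<alpha>)"
proof -
  let ?w = "gibbs.word (x 0)"
  have "(\<Sum>l<height (x 0). indicator E (proj (x, l)) :: ennreal) =
      (\<Sum>k<length ?w. \<Sum>j<value_on \<tau> (?w ! k). indicator E (proj (x, stop x k + j)))"
    unfolding height_eq stop_def by (rule sum_stops)
  also have "\<dots> = (\<Sum>k<length ?w. \<integral>\<^sup>+ a. (\<Sum>j<value_on \<tau> a.
      indicator (letter_event a ((T ^^ j) -` E)) (x, k)) \<partial>count_space \<alpha>)"
  proof (rule sum.cong[OF refl])
    fix k assume "k \<in> {..<length ?w}"
    then have k: "k < length ?w" by simp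
    have lev: "(gibbs.S ^^ k) (x, 0) = (x, k)" using gibbs.funpow_S_level[of k x] k by simp
    have pr: "proj (x, stop x k + j) = (T ^^ j) (symb.point (x, k))" for j
      using T_stop[OF x, of k] k lev by (simp add: proj_def add.commute[of _ j] funpow_add)
    have ev: "indicator (letter_event a ((T ^^ j) -` E)) (x, k) =
        (indicator E (proj (x, stop x k + j)) * indicator {?w ! k} a :: ennreal)" for a j
      using base_located[OF x k] by (auto simp: letter_event_def gibbs.letter_def indicator_def pr)
    have "(\<integral>\<^sup>+ a. (\<Sum>j<value_on \<tau> a. indicator (letter_event a ((T ^^ j) -` E)) (x, k)) \<partial>count_space \<alpha>) =
      (\<integral>\<^sup>+ a. (\<Sum>j<value_on \<tau> (?w ! k). indicator E (proj (x, stop x k + j))) * indicator {?w ! k} a \<partial>count_space \<alpha>)"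
      unfolding ev by (intro nn_integral_cong) (auto simp: indicator_def)
    also have "\<dots> = (\<Sum>j<value_on \<tau> (?w ! k). indicator E (proj (x, stop x k + j)))"
      using word_letter[OF k] by (subst nn_integral_cmult_indicator) auto
    finally show "(\<Sum>j<value_on \<tau> (?w ! k). indicator E (proj (x, stop x k + j))) =
        (\<integral>\<^sup>+ a. (\<Sum>j<value_on \<tau> a. indicator (letter_event a ((T ^^ j) -` E)) (x, k)) \<partial>count_space \<alpha>)"
      by simp
  qed
  also have "\<dots> = (\<integral>\<^sup>+ a. (\<Sum>k<length ?w. \<Sum>j<value_on \<tau> a.
      indicator (letter_event a ((T ^^ j) -` E)) (x, k)) \<partial>count_space \<alpha>)"
    by (rule nn_integral_sum[symmetric]) simp
  also have "\<dots> = (\<integral>\<^sup>+ a. (\<Sum>j<value_on \<tau> a. \<Sum>k<length ?w.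
      indicator (letter_event a ((T ^^ j) -` E)) (x, k)) \<partial>count_space \<alpha>)"
    by (intro nn_integral_cong sum.swap)
  finally show ?thesis .
qed

lemma fiber_integral:
  assumes E: "E \<in> sets borel"
  shows "(\<integral>\<^sup>+ x. (\<Sum>l<height (x 0). indicator E (proj (x, l))) \<partial>gibbs.P) =
    ennreal (1 / gibbs.\<epsilon>) * mean_return * emeasure m E"
proof -
  have pre: "(T ^^ j) -` E \<in> sets borel" for j
    using measurable_sets[OF funpow_T_measurable E] by simp
  let ?f = "\<lambda>a j x. \<Sum>k<gibbs.word_length (x 0). indicator (letter_event a ((T ^^ j) -` E)) (x, k) :: ennreal"
  have meas: "?f a j \<in> borel_measurable gibbs.P" for a j
    using gibbs.word.measurable_fiber_sum[OF letter_event_sets[OF pre]] by (simp add: shift_height_def)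
  have "(\<integral>\<^sup>+ x. (\<Sum>l<height (x 0). indicator E (proj (x, l))) \<partial>gibbs.P) =
      (\<integral>\<^sup>+ x. \<integral>\<^sup>+ a. (\<Sum>j<value_on \<tau> a. ?f a j x) \<partial>count_space \<alpha> \<partial>gibbs.P)"
    using AE_base by (intro nn_integral_cong_AE) (auto elim!: eventually_mono simp: fiber_count[OF _ E])
  also have "\<dots> = (\<integral>\<^sup>+ a. \<integral>\<^sup>+ x. (\<Sum>j<value_on \<tau> a. ?f a j x) \<partial>gibbs.P \<partial>count_space \<alpha>)"
    using meas by (intro nn_integral_count_space_nn_integral \<alpha>_countable borel_measurable_sum)
  also have "\<dots> = (\<integral>\<^sup>+ a. (\<Sum>j<value_on \<tau> a. \<integral>\<^sup>+ x. ?f a j x \<partial>gibbs.P) \<partial>count_space \<alpha>)"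
    by (intro nn_integral_cong nn_integral_sum meas)
  also have "\<dots> = (\<integral>\<^sup>+ a. ennreal (1 / gibbs.\<epsilon>) * (\<Sum>j<value_on \<tau> a. emeasure \<mu>c (a \<inter> (T ^^ j) -` E)) \<partial>count_space \<alpha>)"
    by (intro nn_integral_cong) (simp add: level_sum[OF _ pre] sum_distrib_left)
  also have "\<dots> = ennreal (1 / gibbs.\<epsilon>) *
      (\<integral>\<^sup>+ a. (\<Sum>j<value_on \<tau> a. emeasure \<mu>c (a \<inter> (T ^^ j) -` E)) \<partial>count_space \<alpha>)"
    by (rule nn_integral_cmult) simp
  also have "(\<integral>\<^sup>+ a. (\<Sum>j<value_on \<tau> a. emeasure \<mu>c (a \<inter> (T ^^ j) -` E)) \<partial>count_space \<alpha>) =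
      mean_return * emeasure m E"
    unfolding emeasure_m[OF E] using mean_return_ge_1 \<tau>_integrable
    by (subst ennreal_mult_divide_eq[symmetric]) (auto simp: ennreal_times_divide mult.commute)
  finally show ?thesis by (simp add: mult.assoc)
qed

abbreviation TM :: "((int \<Rightarrow> nat) \<times> nat) measure" where "TM \<equiv> tower_measure PA height"

lemma space_TM: "space TM = {(x, l). l < height (x 0)}"
  by (simp add: tall.space_tower_measure tower_def gibbs.space_P shift_height_def)

lemma domain_sets: "domain \<in> sets TM"
proof -
  have "fst -` base \<inter> space TM \<in> sets TM"
    by (rule measurable_sets[OF tall.measurable_tower_fst base_sets])
  also have "fst -` base \<inter> space TM = domain" by (auto simp: domain_def space_TM)
  finally show ?thesis .
qed

lemma AE_domain: "AE p in TM. p \<in> domain"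
proof (rule AE_I[where N = "space TM - domain"])
  show "space TM - domain \<in> sets TM" using domain_sets by simp
  have "{x \<in> space gibbs.P. (x, k) \<in> space TM - domain} \<subseteq> space gibbs.P - base" for k
    by (auto simp: domain_def space_TM)
  moreover have "space gibbs.P - base \<in> null_sets gibbs.P"
    using AE_base base_sets by (subst AE_iff_null_sets) (auto elim!: eventually_mono)
  ultimately have "emeasure gibbs.P {x \<in> space gibbs.P. (x, k) \<in> space TM - domain} = 0" for k
    using emeasure_eq_0 unfolding null_sets_def by blast
  then show "emeasure TM (space TM - domain) = 0"
    using tall.emeasure_tower[of "space TM - domain"] domain_sets by simp
qed auto

lemma proj_measurable: "proj \<in> restrict_space TM domain \<rightarrow>\<^sub>M m"
proof -
  define p where "p = (\<lambda>q. if q \<in> symb.located then symb.point q else undefined)"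
  have p: "(\<lambda>x. p (x, 0)) \<in> borel_measurable gibbs.P"
    unfolding p_def by (rule measurable_compose[OF level_zero_measurable symb.point_measurable])
  have "(\<lambda>q. (T ^^ l) (p (fst q, 0))) \<in> borel_measurable TM" for l
    by (intro measurable_compose[OF _ funpow_T_measurable] measurable_compose[OF tall.measurable_tower_fst p])
  then have "(\<lambda>q. (T ^^ snd q) (p (fst q, 0))) \<in> borel_measurable TM"
    by (rule measurable_compose_countable) (rule tall.measurable_tower_snd)
  then have "(\<lambda>q. (T ^^ snd q) (p (fst q, 0))) \<in> borel_measurable (restrict_space TM domain)"
    by (rule measurable_restrict_space1)
  also have "?this \<longleftrightarrow> proj \<in> borel_measurable (restrict_space TM domain)"
  proof (rule measurable_cong)
    fix q assume "q \<in> space (restrict_space TM domain)"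
    then have "fst q \<in> base" by (auto simp: space_restrict_space domain_def)
    then have "(fst q, 0) \<in> symb.located" using base_orbit[of "fst q" 0] by simp
    then show "(T ^^ snd q) (p (fst q, 0)) = proj q"
      by (simp add: proj_def p_def foot_def split_beta')
  qed
  finally show ?thesis by (simp cong: measurable_cong_sets add: sets_m)
qed

lemma proj_preserving: "distr (restrict_space TM domain) m proj = m"
proof (rule measure_eqI)
  fix E assume "E \<in> sets (distr (restrict_space TM domain) m proj)"
  then have E: "E \<in> sets m" and Eb: "E \<in> sets borel" by (auto simp: sets_m)
  have sub: "domain \<subseteq> space TM" by (auto simp: domain_def space_TM)
  have sp: "space (restrict_space TM domain) = domain" using sub by (auto simp: space_restrict_space)
  define A where "A = proj -` E \<inter> domain"
  have "A \<in> sets (restrict_space TM domain)"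
    using measurable_sets[OF proj_measurable E] by (simp add: sp A_def)
  then have A: "A \<in> sets TM" using domain_sets sub by (auto simp: sets_restrict_space_iff)
  have mh: "tall.mean_height = ennreal (1 / gibbs.\<epsilon>) * mean_return"
    unfolding tall.mean_height_eq by (rule nn_integral_height)
  have "emeasure (distr (restrict_space TM domain) m proj) E = emeasure (restrict_space TM domain) A"
    using E by (subst emeasure_distr[OF proj_measurable]) (simp_all add: sp A_def)
  also have "\<dots> = emeasure TM A"
    using domain_sets sub by (intro emeasure_restrict_space) (auto simp: A_def)
  also have "\<dots> = inverse tall.mean_height *
      (\<integral>\<^sup>+ x. (\<Sum>l<shift_height height x. indicator A (x, l)) \<partial>gibbs.P)"
    by (rule tall.emeasure_tower'[OF A])
  also have "(\<integral>\<^sup>+ x. (\<Sum>l<shift_height height x. indicator A (x, l)) \<partial>gibbs.P) =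
      (\<integral>\<^sup>+ x. (\<Sum>l<height (x 0). indicator E (proj (x, l))) \<partial>gibbs.P)"
    using AE_base
    by (intro nn_integral_cong_AE) (auto elim!: eventually_mono intro!: sum.cong
        simp: A_def domain_def shift_height_def indicator_def)
  also have "\<dots> = tall.mean_height * emeasure m E"
    unfolding fiber_integral[OF Eb] mh ..
  also have "inverse tall.mean_height * (tall.mean_height * emeasure m E) = emeasure m E"
    by (simp only: mult.assoc[symmetric] tall.mean_height_inverse mult_1)
  finally show "emeasure (distr (restrict_space TM domain) m proj) E = emeasure m E" .
qed simp

end

section \<open>Slowly varying functions and tails\<close>

text \<open>A weak form of the uniform convergence theorem. In logarithmic scale, suppose that uniformity fails
along \<open>t n\<close> and \<open>t n - u n\<close>. The shifts \<open>v\<close> in an interval of length 2 that barely change the function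
at \<open>t n\<close>, or at \<open>t n - u n\<close>, eventually have measure above \<open>3 / 2\<close>. Translating one of these sets by
\<open>u n\<close>, which is at most 1, both fit into an interval of length 3 and must meet; a common point links
the values at \<open>t n\<close> and \<open>t n - u n\<close>.\<close>

lemma slowly_varying_halving:
  assumes L: "slowly_varying L"
  obtains X where "1 \<le> X" "\<And>x. X \<le> x \<Longrightarrow> 0 < L x"
    "\<And>x y. X \<le> x \<Longrightarrow> x \<le> y \<Longrightarrow> y \<le> 2 * x \<Longrightarrow> L x \<le> 2 * L y"
proof -
  obtain X0 where pos0: "\<forall>x\<ge>X0. 0 < L x" and meas0: "L \<in> borel_measurable (restrict_space borel {X0..})"
    and lim: "\<And>c. 0 < c \<Longrightarrow> ((\<lambda>x. L (c * x) / L x) \<longlongrightarrow> 1) at_top"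
    using L unfolding slowly_varying_def by blast
  \<comment> \<open>Below \<open>T0\<close> the function \<open>L\<close> is arbitrary, so its logarithm is cut off there.\<close>
  define T0 where "T0 = ln (max X0 1)"
  have expT0: "X0 \<le> exp t" if "T0 \<le> t" for t
  proof -
    have "exp T0 = max X0 1" by (simp add: T0_def)
    moreover have "exp T0 \<le> exp t" using that by simp
    ultimately show ?thesis by simp
  qed
  define l where "l t = (if T0 \<le> t then ln (L (exp t)) else 0)" for t
  have l_meas [measurable]: "l \<in> borel_measurable borel"
  proof -
    define L' where "L' x = (if x \<in> {X0..} then L x else 1)" for x
    have [measurable]: "L' \<in> borel_measurable borel"
      unfolding L'_def using meas0 by (subst measurable_If_restrict_space_iff) (auto simp: atLeast_def)
    have "l = (\<lambda>t. if T0 \<le> t then ln (L' (exp t)) else 0)"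
      using expT0 by (auto simp: l_def L'_def)
    then show ?thesis by simp
  qed
  have l_lim: "((\<lambda>t. l (t + v) - l t) \<longlongrightarrow> 0) at_top" for v
  proof -
    have "((\<lambda>t. ln (L (exp v * exp t) / L (exp t))) \<longlongrightarrow> ln 1) at_top"
      by (intro tendsto_ln filterlim_compose[OF lim exp_at_top]) auto
    moreover have "eventually (\<lambda>t. ln (L (exp v * exp t) / L (exp t)) = l (t + v) - l t) at_top"
      using eventually_ge_at_top[of "max T0 (T0 - v)"]
    proof eventually_elim
      case (elim t)
      then have "T0 \<le> t" "T0 \<le> t + v" by auto
      then have "0 < L (exp t)" "0 < L (exp (t + v))" using expT0 pos0 by auto
      then show ?case using \<open>T0 \<le> t\<close> \<open>T0 \<le> t + v\<close>
        by (simp add: l_def ln_div exp_add mult.commute)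
    qed
    ultimately show ?thesis by (simp add: tendsto_cong)
  qed
  have "\<exists>N. \<forall>t\<ge>N. \<forall>u. 0 \<le> u \<and> u \<le> 1 \<longrightarrow> \<bar>l (t - u) - l t\<bar> < ln 2"
  proof (rule ccontr)
    assume "\<not> ?thesis"
    then have "\<forall>n :: nat. \<exists>t u. real n + 1 \<le> t \<and> 0 \<le> u \<and> u \<le> 1 \<and> ln 2 \<le> \<bar>l (t - u) - l t\<bar>"
      by (metis not_less)
    then obtain t u where t: "\<And>n :: nat. real n + 1 \<le> t n" and u: "\<And>n. 0 \<le> u n" "\<And>n. u n \<le> 1"
      and gap: "\<And>n. ln 2 \<le> \<bar>l (t n - u n) - l (t n)\<bar>" by metis
    define s where "s n = t n - u n" for n
    define \<delta> :: real where "\<delta> = ln 2 / 3"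
    have \<delta>: "0 < \<delta>" by (simp add: \<delta>_def)
    have t_top: "filterlim t at_top sequentially"
      by (rule filterlim_at_top_mono[OF filterlim_real_sequentially]) (use t in \<open>auto intro!: always_eventually order_trans[OF _ t]\<close>)
    have s_top: "filterlim s at_top sequentially"
    proof (rule filterlim_at_top_mono[OF filterlim_real_sequentially], intro always_eventually allI)
      show "real n \<le> s n" for n using t[of n] u(2)[of n] by (simp add: s_def)
    qed
    define V where "V r n = {v \<in> {0..2}. \<forall>k\<ge>n. \<bar>l (r k + v) - l (r k)\<bar> \<le> \<delta>}" for r :: "nat \<Rightarrow> real" and n
    have V_sets: "V r n \<in> sets lborel" for r n
    proof -
      have "Measurable.pred borel (\<lambda>v. \<bar>l (r k + v) - l (r k)\<bar> \<le> \<delta>)" for k by measurable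
      then show ?thesis unfolding V_def by measurable
    qed
    have V_lim: "(\<lambda>n. measure lborel (V r n)) \<longlonglongrightarrow> 2" if r: "filterlim r at_top sequentially" for r
    proof -
      have "(\<Union>n. V r n) = {0..2}"
      proof (intro equalityI subsetI)
        fix v :: real assume v: "v \<in> {0..2}"
        have "(\<lambda>k. l (r k + v) - l (r k)) \<longlonglongrightarrow> 0" by (rule filterlim_compose[OF l_lim r])
        then have "eventually (\<lambda>k. \<bar>l (r k + v) - l (r k)\<bar> < \<delta>) sequentially"
          using \<delta> by (auto simp: tendsto_iff dist_real_def)
        then obtain n where "\<forall>k\<ge>n. \<bar>l (r k + v) - l (r k)\<bar> < \<delta>" by (auto simp: eventually_sequentially)
        then show "v \<in> (\<Union>n. V r n)" using v by (force simp: V_def)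
      qed (auto simp: V_def)
      moreover have "(\<lambda>n. measure lborel (V r n)) \<longlonglongrightarrow> measure lborel (\<Union>n. V r n)"
      proof (rule Lim_measure_incseq)
        show "range (V r) \<subseteq> sets lborel" using V_sets by auto
        show "incseq (V r)" by (auto simp: incseq_def V_def)
        have "emeasure lborel (\<Union>n. V r n) \<le> emeasure lborel {0..2 :: real}"
          by (intro emeasure_mono) (auto simp: V_def)
        then show "emeasure lborel (\<Union>n. V r n) \<noteq> \<infinity>" by (auto simp: top_unique)
      qed
      ultimately show ?thesis by simp
    qed
    have "eventually (\<lambda>n. 3 / 2 < measure lborel (V t n)) sequentially"
      "eventually (\<lambda>n. 3 / 2 < measure lborel (V s n)) sequentially"
      using order_tendstoD(1)[OF V_lim[OF t_top], of "3 / 2"] order_tendstoD(1)[OF V_lim[OF s_top], of "3 / 2"] by simp_all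
    then have "eventually (\<lambda>n. 3 / 2 < measure lborel (V t n) \<and> 3 / 2 < measure lborel (V s n)) sequentially"
      by eventually_elim simp
    then obtain n where n: "3 / 2 < measure lborel (V t n)" "3 / 2 < measure lborel (V s n)"
      by (auto simp: eventually_sequentially)
    \<comment> \<open>The shifts that work for \<open>s\<close>, translated by \<open>u n\<close>, live in the same interval of length 3 as those for \<open>t\<close>.\<close>
    define V' where "V' = (\<lambda>v. u n + v) -` V s n"
    have V'_sets: "V' \<in> sets lborel"
      unfolding V'_def using measurable_sets[of "\<lambda>v. u n + v" borel borel "V s n"] V_sets[of s n] by simp
    have "lborel = distr lborel borel ((+) (u n))"
      using lborel_affine[of 1 "u n"] by (simp add: density_1)
    then have "emeasure lborel (V s n) = emeasure (distr lborel borel ((+) (u n))) (V s n)" by simp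
    also have "\<dots> = emeasure lborel V'"
      using V_sets[of s n] by (subst emeasure_distr) (auto simp: V'_def)
    finally have V'_meas: "measure lborel V' = measure lborel (V s n)" by (simp add: measure_def)
    have "V t n \<inter> V' \<noteq> {}"
    proof
      assume e: "V t n \<inter> V' = {}"
      have fin: "emeasure lborel A \<noteq> \<infinity>" if "A \<subseteq> {-1..2}" for A :: "real set"
        using emeasure_mono[OF that, of lborel] by (auto simp: top_unique)
      have sub: "V t n \<subseteq> {-1..2}" "V' \<subseteq> {-1..2}" using u[of n] by (auto simp: V_def V'_def)
      have "measure lborel (V t n) + measure lborel V' = measure lborel (V t n \<union> V')"
        using V_sets V'_sets fin[OF sub(1)] fin[OF sub(2)] e by (intro measure_Union[symmetric]) auto
      also have "\<dots> \<le> measure lborel {-1..2 :: real}"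
        using sub V_sets V'_sets fin[of "{-1..2}"] by (intro measure_mono_fmeasurable) (auto simp: fmeasurable_def less_top)
      also have "\<dots> = 3" by simp
      finally show False using n V'_meas by simp
    qed
    then obtain v where "v \<in> V t n" "u n + v \<in> V s n" by (auto simp: V'_def)
    then have "\<bar>l (t n + v) - l (t n)\<bar> \<le> \<delta>" "\<bar>l (s n + (u n + v)) - l (s n)\<bar> \<le> \<delta>" by (auto simp: V_def)
    moreover have "s n + (u n + v) = t n + v" by (simp add: s_def)
    ultimately have "\<bar>l (s n) - l (t n)\<bar> \<le> 2 * \<delta>" by simp
    moreover have "ln 2 \<le> \<bar>l (s n) - l (t n)\<bar>" using gap[of n] by (simp add: s_def)
    moreover have "0 < ln (2 :: real)" by simp
    ultimately show False unfolding \<delta>_def by linarith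
  qed
  then obtain N where N: "\<And>t u. N \<le> t \<Longrightarrow> 0 \<le> u \<Longrightarrow> u \<le> 1 \<Longrightarrow> \<bar>l (t - u) - l t\<bar> < ln 2" by blast
  define X where "X = exp (max N (max T0 0))"
  have X: "1 \<le> X" "N \<le> ln x \<and> T0 \<le> ln x" if "X \<le> x" for x
  proof -
    show "1 \<le> X" by (simp add: X_def)
    then have "0 < x" using that by simp
    then have "max N (max T0 0) \<le> ln x" using that by (simp only: X_def ln_ge_iff)
    then show "N \<le> ln x \<and> T0 \<le> ln x" by simp
  qed
  show thesis
  proof
    show "1 \<le> X" using X(1)[of X] by simp
    then have x0: "0 < x" if "X \<le> x" for x using that by simp
    show pos: "0 < L x" if "X \<le> x" for x
      using expT0[of "ln x"] X(2)[OF that] pos0 x0[OF that] by simp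
    fix x y assume xy: "X \<le> x" "x \<le> y" "y \<le> 2 * x"
    have x: "0 < x" using x0[OF xy(1)] .
    have y: "X \<le> y" "0 < y" using xy x by auto
    have u: "0 \<le> ln y - ln x" "ln y - ln x \<le> 1"
    proof -
      show "0 \<le> ln y - ln x" using x xy by simp
      have "ln y \<le> ln (2 * x)" using y xy by simp
      also have "\<dots> = ln 2 + ln x" using x by (simp add: ln_mult)
      finally show "ln y - ln x \<le> 1" using ln_2_less_1 by simp
    qed
    have "\<bar>l (ln y - (ln y - ln x)) - l (ln y)\<bar> < ln 2"
      using X(2)[OF y(1)] u by (intro N) auto
    then have "\<bar>l (ln x) - l (ln y)\<bar> < ln 2" by simp
    then have "ln (L x) < ln 2 + ln (L y)"
      using X(2)[OF xy(1)] X(2)[OF y(1)] x y by (simp add: l_def)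
    also have "\<dots> = ln (2 * L y)" using pos[OF y(1)] by (simp add: ln_mult)
    finally show "L x \<le> 2 * L y" using pos[OF xy(1)] pos[OF y(1)] by simp
  qed
qed

text \<open>Halving repeatedly gives a Potter bound with exponent one.\<close>

lemma slowly_varying_linear_bound:
  assumes L: "slowly_varying L"
  obtains X where "1 \<le> X" "\<And>x. X \<le> x \<Longrightarrow> 0 < L x"
    "\<And>x y. X \<le> x \<Longrightarrow> x \<le> y \<Longrightarrow> L x \<le> 2 * (y / x) * L y"
proof -
  obtain X where X: "1 \<le> X" and pos: "\<And>x. X \<le> x \<Longrightarrow> 0 < L x"
    and half: "\<And>x y. X \<le> x \<Longrightarrow> x \<le> y \<Longrightarrow> y \<le> 2 * x \<Longrightarrow> L x \<le> 2 * L y"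
    by (rule slowly_varying_halving[OF L]) blast
  have bound: "L x \<le> 2 * (y / x) * L y" if "X \<le> x" "x \<le> y" "y \<le> 2 ^ j * x" for x y j
    using that
  proof (induction j arbitrary: y)
    case 0
    then have "x = y" "0 < x" using X by auto
    then show ?case using pos[of y] 0 by simp
  next
    case (Suc j)
    have x: "0 < x" using X Suc.prems by simp
    have Ly: "0 < L y" using pos Suc.prems by simp
    show ?case
    proof (cases "y \<le> 2 * x")
      case True
      have "L x \<le> 2 * 1 * L y" using half Suc.prems True by simp
      also have "\<dots> \<le> 2 * (y / x) * L y"
        using x Suc.prems Ly by (intro mult_right_mono mult_left_mono) auto
      finally show ?thesis .
    next
      case False
      then have "L x \<le> 2 * (y / 2 / x) * L (y / 2)" using Suc.prems by (intro Suc.IH) auto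
      also have "\<dots> \<le> 2 * (y / 2 / x) * (2 * L y)"
        using False Suc.prems x by (intro mult_left_mono half) auto
      finally show ?thesis by (simp add: algebra_simps)
    qed
  qed
  show thesis
  proof
    show "1 \<le> X" "\<And>x. X \<le> x \<Longrightarrow> 0 < L x" by (fact X, fact pos)
    fix x y assume xy: "X \<le> x" "x \<le> y"
    then have x: "0 < x" using X by simp
    obtain j where "y / x < 2 ^ j" using real_arch_pow[of 2 "y / x"] by auto
    then have "y \<le> 2 ^ j * x" using x by (simp add: field_simps)
    then show "L x \<le> 2 * (y / x) * L y" by (rule bound[OF xy])
  qed
qed

text \<open>The tail at \<open>n / k\<close>, rounded up, is compared with the bound at \<open>n\<close> uniformly in \<open>k\<close>. If \<open>n / k\<close> is so
small that nothing is known about the tail, then \<open>k\<close> is at least of the order of \<open>n\<close> and the trivial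
bound 1 suffices, since \<open>L\<close> decays at most like \<open>1 / n\<close>.\<close>

lemma regularly_varying_tail_scaling:
  fixes tail :: "nat \<Rightarrow> real" and \<beta> :: real
  assumes L: "slowly_varying L" and \<beta>: "0 < \<beta>"
    and tail: "\<And>n. 0 \<le> tail n" "\<And>n. tail n \<le> 1"
    and O: "tail \<in> O(\<lambda>n. real n powr (- \<beta>) * L (real n))"
  obtains C n0 where "0 \<le> C" "\<And>n. n0 \<le> n \<Longrightarrow> 0 < L (real n)" 
    "\<And>n k. n0 \<le> n \<Longrightarrow> 1 \<le> k \<Longrightarrow> 
      tail ((n + k - 1) div k) \<le> C * real k powr (\<beta> + 1) * (real n powr (- \<beta>) * L (real n))"
proof -
  obtain X0 where X0: "1 \<le> X0" and pos0: "\<And>x. X0 \<le> x \<Longrightarrow> 0 < L x"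
    and lin0: "\<And>x y. X0 \<le> x \<Longrightarrow> x \<le> y \<Longrightarrow> L x \<le> 2 * (y / x) * L y"
    by (rule slowly_varying_linear_bound[OF L]) blast
  obtain c where c: "0 < c" "eventually (\<lambda>n. norm (tail n) \<le> c * norm (real n powr (- \<beta>) * L (real n))) sequentially"
    using O by (auto elim: landau_o.bigE)
  then obtain N where N: "\<And>n. N \<le> n \<Longrightarrow> norm (tail n) \<le> c * norm (real n powr (- \<beta>) * L (real n))"
    by (auto simp: eventually_sequentially)
  define n0 where "n0 = max N (nat \<lceil>X0\<rceil>)"
  define X where "X = real n0"
  have "X0 \<le> real (nat \<lceil>X0\<rceil>)" by (rule real_nat_ceiling_ge)
  also have "\<dots> \<le> X" by (simp add: X_def n0_def)
  finally have X: "X0 \<le> X" "1 \<le> X" using X0 by simp_all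
  have pos: "0 < L x" if "X \<le> x" for x using pos0 that X by simp
  have lin: "L x \<le> 2 * (y / x) * L y" if "X \<le> x" "x \<le> y" for x y using lin0 that X by simp
  \<comment> \<open>The two summands serve the two ranges of \<open>n / k\<close>.\<close>
  define C where "C = 2 * c + 2 / L X * X powr \<beta>"
  have C: "0 \<le> C" using c pos[of X] by (simp add: C_def)
  have main: "tail ((n + k - 1) div k) \<le> C * real k powr (\<beta> + 1) * (real n powr (- \<beta>) * L (real n))"
    if n: "n0 \<le> n" and k: "1 \<le> k" for n k
  proof -
    define d where "d = (n + k - 1) div k"
    have nX: "X \<le> real n" "1 \<le> real n" using n X by (auto simp: X_def)
    have Ln: "0 < L (real n)" by (rule pos[OF nX(1)])
    have dk: "n \<le> d * k"
    proof -
      have "n + k - 1 < (d + 1) * k" unfolding d_def using k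
        by (metis Suc_eq_plus1 dividend_less_div_times less_le_trans mult.commute mult_Suc add.commute zero_less_one)
      then show ?thesis using k by (simp add: algebra_simps)
    qed
    then have d1: "1 \<le> d" using nX by (cases d) auto
    have dn: "d \<le> n"
    proof -
      have "n + k - 1 \<le> n * k" using k nX by (cases n; cases k) (auto simp: algebra_simps)
      then show ?thesis unfolding d_def using k by (metis div_le_mono nonzero_mult_div_cancel_right not_one_le_zero)
    qed
    have rk: "real n \<le> real d * real k" using dk by (metis of_nat_le_iff of_nat_mult)
    have k0: "1 \<le> real k" "1 \<le> real d" using k d1 by auto
    let ?g = "real n powr (- \<beta>) * L (real n)"
    have g0: "0 \<le> ?g" using Ln by simp
    show ?thesis
    proof (cases "n0 \<le> d")
      case True
      then have dX: "X \<le> real d" by (simp add: X_def)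
      have "tail d \<le> c * (real d powr (- \<beta>) * L (real d))"
        using N[of d] True tail(1)[of d] pos[OF dX] by (simp add: n0_def)
      also have "\<dots> \<le> c * ((real n powr (- \<beta>) * real k powr \<beta>) * (2 * real k * L (real n)))"
      proof (intro mult_left_mono mult_mono)
        have "real d powr (- \<beta>) \<le> (real n / real k) powr (- \<beta>)"
          using rk k0 nX \<beta> by (intro powr_mono2') (auto simp: field_simps)
        also have "\<dots> = real n powr (- \<beta>) * real k powr \<beta>"
          using k0 nX by (simp add: powr_divide powr_minus field_simps)
        finally show "real d powr (- \<beta>) \<le> real n powr (- \<beta>) * real k powr \<beta>" .
        have "L (real d) \<le> 2 * (real n / real d) * L (real n)"
          using dX dn by (intro lin) auto
        also have "\<dots> \<le> 2 * real k * L (real n)"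
          using rk k0 Ln by (intro mult_right_mono mult_left_mono) (auto simp: field_simps)
        finally show "L (real d) \<le> 2 * real k * L (real n)" .
      qed (use c pos[OF dX] in auto)
      also have "\<dots> = 2 * c * real k powr (\<beta> + 1) * ?g"
        using k0 by (simp add: powr_add)
      also have "\<dots> \<le> C * real k powr (\<beta> + 1) * ?g"
        using g0 pos[of X] by (intro mult_right_mono) (auto simp: C_def)
      finally show ?thesis by (simp add: d_def)
    next
      case False
      then have "real d \<le> X" by (simp add: X_def)
      then have nk: "real n \<le> X * real k" using rk k0 by (meson mult_right_mono order_trans of_nat_0_le_iff)
      have LX: "0 < L X" by (rule pos) simp
      have "L X \<le> 2 * (real n / X) * L (real n)" by (rule lin) (use nX in auto)
      then have "L X / L X \<le> 2 * (real n / X) * L (real n) / L X" using LX by (intro divide_right_mono) auto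
      then have "1 \<le> 2 / L X * (real n / X) * L (real n)" using LX by (simp add: ac_simps)
      also have "\<dots> = 2 / L X * (real n / X) * (real n powr \<beta> * real n powr (- \<beta>)) * L (real n)"
        using nX by (simp flip: powr_add)
      also have "\<dots> = 2 / L X * (real n / X * real n powr \<beta>) * ?g" by simp
      also have "\<dots> \<le> 2 / L X * (real k * (X * real k) powr \<beta>) * ?g"
        using nk g0 LX X \<beta> nX
        by (intro mult_right_mono mult_left_mono mult_mono powr_mono2) (auto simp: field_simps)
      also have "\<dots> = 2 / L X * X powr \<beta> * real k powr (\<beta> + 1) * ?g"
        using k0 X by (simp add: powr_add powr_mult)
      also have "\<dots> \<le> C * real k powr (\<beta> + 1) * ?g"
        using g0 c by (intro mult_right_mono) (auto simp: C_def)
      finally show ?thesis using tail(2)[of d] by (simp add: d_def)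
    qed
  qed
  show thesis
    by (rule that[OF C _ main, of n0]) (auto simp: X_def intro!: pos)
qed

definition weight :: "nat \<Rightarrow> nat" where "weight i = (i + 1) * (i + 2)"

lemma weight_pos: "1 \<le> weight i" by (simp add: weight_def)

text \<open>The reciprocals of the weights sum to less than one by telescoping.\<close>

lemma heavy_letter:
  fixes t :: "nat \<Rightarrow> real"
  assumes t: "\<And>i. i < n \<Longrightarrow> 0 \<le> t i" and n: "0 < n"
  shows "\<exists>i<n. (\<Sum>i<n. t i) \<le> real (weight i) * t i"
proof (rule ccontr)
  assume "\<not> ?thesis"
  then have less: "real (weight i) * t i < (\<Sum>i<n. t i)" if "i < n" for i using that by force
  let ?h = "\<Sum>i<n. t i"
  have diff: "1 / real (weight i) = 1 / real (i + 1) - 1 / real (i + 2)" for i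
    by (simp add: weight_def field_simps)
  have tel: "(\<Sum>i<k. 1 / real (weight i)) = 1 - 1 / real (k + 1)" for k
    unfolding diff by (induction k) (simp_all add: add.commute)
  have h: "0 \<le> ?h" using t by (intro sum_nonneg) auto
  have "?h < (\<Sum>i<n. ?h * (1 / real (weight i)))"
  proof (intro sum_strict_mono)
    fix i assume "i \<in> {..<n}"
    then show "t i < ?h * (1 / real (weight i))"
      using less[of i] weight_pos[of i] by (simp add: field_simps)
  qed (use n in auto)
  also have "\<dots> = ?h * (1 - 1 / real (n + 1))" by (simp only: tel flip: sum_distrib_left)
  also have "\<dots> \<le> ?h" using h by (simp add: mult_left_le)
  finally show False by simp
qed

lemma summable_weight_powr:
  fixes p x :: real
  assumes x: "0 < x" "x < 1"
  shows "summable (\<lambda>i. real (weight i) powr p * x ^ i)"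
proof (rule summable_comparison_test_bigo)
  \<comment> \<open>Half of the geometric decay beats the power, the other half is summable.\<close>
  let ?y = "sqrt x"
  have y: "0 < ?y" "?y < 1" using x by auto
  show "summable (\<lambda>i. norm (?y ^ i))" using y by (simp add: summable_geometric norm_power)
  have "x ^ i = ?y ^ i * ?y ^ i" for i using x by (simp flip: power_mult_distrib)
  moreover have "(\<lambda>i. real (weight i) powr p * ?y ^ i) \<in> O(\<lambda>_. 1)"
    unfolding weight_def using y by real_asymp
  ultimately show "(\<lambda>i. real (weight i) powr p * x ^ i) \<in> O(\<lambda>i. ?y ^ i)"
    using landau_o.big.mult[of "\<lambda>i. real (weight i) powr p * ?y ^ i" sequentially "\<lambda>_. 1" "\<lambda>i. ?y ^ i" "\<lambda>i. ?y ^ i"]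
    by (simp add: mult.assoc)
qed

lemma powr_add_le:
  fixes a b :: real
  assumes "0 \<le> a" "0 \<le> b" "0 < d" "d \<le> 1"
  shows "(a + b) powr d \<le> a powr d + b powr d"
proof (cases "a + b = 0")
  case True
  then show ?thesis using assms by simp
next
  case False
  let ?s = "a + b"
  have s: "0 < ?s" using False assms by simp
  have le: "c / ?s \<le> (c / ?s) powr d" if "0 \<le> c" "c \<le> ?s" for c
  proof (cases "c = 0")
    case False
    then have "(c / ?s) powr 1 \<le> (c / ?s) powr d"
      using that s assms by (intro powr_mono') auto
    then show ?thesis using that s by simp
  qed simp
  have "1 = a / ?s + b / ?s" using s by (simp flip: add_divide_distrib)
  also have "\<dots> \<le> (a / ?s) powr d + (b / ?s) powr d" using assms by (intro add_mono le) auto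
  also have "\<dots> = (a powr d + b powr d) / ?s powr d"
    using assms s by (simp add: powr_divide add_divide_distrib)
  finally show ?thesis using s by (simp add: field_simps)
qed

lemma powr_sum_list_le:
  fixes xs :: "'a list" and f :: "'a \<Rightarrow> nat"
  assumes d: "0 < d" "d \<le> 1"
  shows "real (\<Sum>x\<leftarrow>xs. f x) powr d \<le> (\<Sum>x\<leftarrow>xs. real (f x) powr d)"
proof (induction xs)
  case (Cons x xs)
  have "real (\<Sum>x\<leftarrow>x # xs. f x) powr d \<le> real (f x) powr d + real (\<Sum>x\<leftarrow>xs. f x) powr d"
    using powr_add_le[of "real (f x)" "real (\<Sum>x\<leftarrow>xs. f x)" d] d by simp
  then show ?case using Cons by simp
qed simp

context nonuniformly_hyperbolic
begin

lemma \<tau>_measurable: "\<tau> \<in> \<mu>c \<rightarrow>\<^sub>M count_space UNIV"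
proof (rule measurableI)
  fix B :: "nat set"
  have "\<tau> -` B \<inter> space \<mu>c = (\<Union>a\<in>{a \<in> \<alpha>. value_on \<tau> a \<in> B}. a)"
    using \<alpha>_cover \<alpha>_subset value_on_\<tau> by (force simp: space_\<mu>)
  also have "\<dots> \<in> sets \<mu>c"
    using countable_subset[OF _ \<alpha>_countable] \<alpha>_measurable by (intro sets.countable_UN') auto
  finally show "\<tau> -` B \<inter> space \<mu>c \<in> sets \<mu>c" .
qed simp

lemma nn_integral_code: "(\<integral>\<^sup>+ c. g (gibbs.word c) \<partial>PA) = (\<integral>\<^sup>+ w. g w \<partial>gibbs.word_pmf)"
  by (simp flip: gibbs.map_word_code_pmf)

lemma nn_integral_height_le:
  fixes f :: "nat \<Rightarrow> ennreal" and g :: "nat \<Rightarrow> nat \<Rightarrow> ennreal"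
  assumes le: "\<And>i n t. n \<le> weight i * t \<Longrightarrow> f n \<le> g i t"
  shows "(\<integral>\<^sup>+ c. f (height c) \<partial>PA) \<le>
    (\<Sum>i. ennreal ((1 - gibbs.\<epsilon>) ^ i) * (\<integral>\<^sup>+ y. g i (\<tau> y) \<partial>\<mu>c))"
proof -
  have "f (height c) \<le> (\<Sum>i<length (gibbs.word c). g i (value_on \<tau> (gibbs.word c ! i)))" for c
  proof -
    obtain i where i: "i < length (gibbs.word c)"
      "(\<Sum>i<length (gibbs.word c). real (value_on \<tau> (gibbs.word c ! i))) \<le>
       real (weight i) * real (value_on \<tau> (gibbs.word c ! i))"
      using heavy_letter[of "length (gibbs.word c)" "\<lambda>i. real (value_on \<tau> (gibbs.word c ! i))"] word_length_pos
      by auto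
    then have "real (height c) \<le> real (weight i * value_on \<tau> (gibbs.word c ! i))"
      by (simp add: height_eq)
    then have "height c \<le> weight i * value_on \<tau> (gibbs.word c ! i)" by (simp only: of_nat_le_iff)
    then have "f (height c) \<le> (\<Sum>i\<in>{i}. g i (value_on \<tau> (gibbs.word c ! i)))" using le by simp
    also have "\<dots> \<le> (\<Sum>i<length (gibbs.word c). g i (value_on \<tau> (gibbs.word c ! i)))"
      using i(1) by (intro sum_mono2) auto
    finally show ?thesis .
  qed
  then have "(\<integral>\<^sup>+ c. f (height c) \<partial>PA) \<le>
      (\<integral>\<^sup>+ c. (\<Sum>i<length (gibbs.word c). g i (value_on \<tau> (gibbs.word c ! i))) \<partial>PA)"
    by (intro nn_integral_mono)
  also have "\<dots> = (\<integral>\<^sup>+ w. (\<Sum>i<length w. g i (value_on \<tau> (w ! i))) \<partial>gibbs.word_pmf)"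
    by (rule nn_integral_code)
  also have "\<dots> = (\<Sum>i. ennreal ((1 - gibbs.\<epsilon>) ^ i) *
      (\<integral>\<^sup>+ a. g i (value_on \<tau> a) * ennreal (lam [a]) \<partial>count_space \<alpha>))"
    by (rule gibbs.nn_integral_word_sum)
  also have "\<dots> = (\<Sum>i. ennreal ((1 - gibbs.\<epsilon>) ^ i) * (\<integral>\<^sup>+ y. g i (\<tau> y) \<partial>\<mu>c))"
    by (intro suminf_cong arg_cong2[where f = "(*)"] refl nn_integral_letters[symmetric]) (simp add: value_on_\<tau>)
  finally show ?thesis .
qed

lemma height_moment:
  assumes \<beta>: "0 < \<beta>" and fin: "(\<integral>\<^sup>+ y. ennreal (real (\<tau> y) powr \<beta>) \<partial>\<mu>c) < \<infinity>"
  shows "(\<integral>\<^sup>+ c. ennreal (real (height c) powr \<beta>) \<partial>PA) < \<infinity>"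
proof -
  let ?I = "\<integral>\<^sup>+ y. ennreal (real (\<tau> y) powr \<beta>) \<partial>\<mu>c" and ?q = "1 - gibbs.\<epsilon>"
  have q: "0 < ?q" "?q < 1" using gibbs.\<epsilon>_pos gibbs.\<epsilon>_less_1 by auto
  have \<tau>_meas: "(\<lambda>y. ennreal (real (\<tau> y) powr \<beta>)) \<in> borel_measurable \<mu>c"
    by (rule measurable_compose[OF \<tau>_measurable]) simp
  have "(\<integral>\<^sup>+ c. ennreal (real (height c) powr \<beta>) \<partial>PA) \<le>
      (\<Sum>i. ennreal (?q ^ i) * (\<integral>\<^sup>+ y. ennreal (real (weight i) powr \<beta>) * ennreal (real (\<tau> y) powr \<beta>) \<partial>\<mu>c))"
  proof (rule nn_integral_height_le)
    fix i n t :: nat assume "n \<le> weight i * t"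
    then have "real n \<le> real (weight i) * real t" by (metis of_nat_le_iff of_nat_mult)
    then have "real n powr \<beta> \<le> (real (weight i) * real t) powr \<beta>" using \<beta> by (intro powr_mono2) auto
    then show "ennreal (real n powr \<beta>) \<le> ennreal (real (weight i) powr \<beta>) * ennreal (real t powr \<beta>)"
      by (simp add: powr_mult ennreal_leI flip: ennreal_mult)
  qed
  also have "\<dots> = (\<Sum>i. ennreal (real (weight i) powr \<beta> * ?q ^ i) * ?I)"
    using q by (intro suminf_cong) (simp add: nn_integral_cmult[OF \<tau>_meas] ennreal_mult mult.assoc mult.left_commute)
  also have "\<dots> = (\<Sum>i. ennreal (real (weight i) powr \<beta> * ?q ^ i)) * ?I" by (rule ennreal_suminf_multc)
  also have "\<dots> < \<infinity>"
  proof -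
    have "(\<Sum>i. ennreal (real (weight i) powr \<beta> * ?q ^ i)) = ennreal (\<Sum>i. real (weight i) powr \<beta> * ?q ^ i)"
      using q by (intro suminf_ennreal2 summable_weight_powr) auto
    then show ?thesis using fin by (simp add: ennreal_mult_less_top)
  qed
  finally show ?thesis .
qed

lemma height_tail:
  assumes \<beta>: "0 < \<beta>" and L: "slowly_varying L"
    and O: "(\<lambda>n. measure \<mu>c {y \<in> Y. n \<le> \<tau> y}) \<in> O(\<lambda>n. real n powr (- \<beta>) * L (real n))"
  shows "(\<lambda>n. measure PA {c. n \<le> height c}) \<in> O(\<lambda>n. real n powr (- \<beta>) * L (real n))"
proof -
  interpret \<mu>c: prob_space \<mu>c by (rule prob_\<mu>c)
  let ?q = "1 - gibbs.\<epsilon>" and ?g = "\<lambda>n. real n powr (- \<beta>) * L (real n)"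
  have q: "0 < ?q" "?q < 1" using gibbs.\<epsilon>_pos gibbs.\<epsilon>_less_1 by auto
  define tail where "tail n = measure \<mu>c {y \<in> Y. n \<le> \<tau> y}" for n
  obtain C n0 where C: "0 \<le> C" and Lpos: "\<And>n. n0 \<le> n \<Longrightarrow> 0 < L (real n)"
    and scale: "\<And>n k. n0 \<le> n \<Longrightarrow> 1 \<le> k \<Longrightarrow> tail ((n + k - 1) div k) \<le> C * real k powr (\<beta> + 1) * ?g n"
    by (rule regularly_varying_tail_scaling[OF L \<beta>, of tail])
      (use O in \<open>auto simp: tail_def[abs_def] \<mu>c.prob_le_1\<close>)
  define D where "D = (\<Sum>i. real (weight i) powr (\<beta> + 1) * ?q ^ i)"
  have sm: "summable (\<lambda>i. real (weight i) powr (\<beta> + 1) * ?q ^ i)" by (rule summable_weight_powr[OF q])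
  have bound: "measure PA {c. n \<le> height c} \<le> C * D * ?g n" if n: "n0 \<le> n" for n
  proof -
    have g0: "0 \<le> ?g n" using Lpos[OF n] by simp
    have "emeasure PA {c. n \<le> height c} = (\<integral>\<^sup>+ c. indicator {c. n \<le> height c} c \<partial>PA)"
      by simp
    also have "\<dots> = (\<integral>\<^sup>+ c. indicator {n..} (height c) \<partial>PA)"
      by (intro nn_integral_cong) (auto simp: indicator_def)
    also have "\<dots> \<le> (\<Sum>i. ennreal (?q ^ i) * (\<integral>\<^sup>+ y. indicator {(n + weight i - 1) div weight i..} (\<tau> y) \<partial>\<mu>c))"
    proof (rule nn_integral_height_le)
      fix i k t :: nat assume kt: "k \<le> weight i * t"
      show "indicator {n..} k \<le> (indicator {(n + weight i - 1) div weight i..} t :: ennreal)"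
      proof (cases "n \<le> k")
        case True
        have "n + weight i - 1 < weight i * t + weight i" using True kt weight_pos[of i] by linarith
        then have "(n + weight i - 1) div weight i < t + 1"
          using weight_pos[of i] by (intro div_less_iff_less_mult[THEN iffD2]) (auto simp: algebra_simps)
        then show ?thesis by (simp add: indicator_def)
      qed simp
    qed
    also have "\<dots> = (\<Sum>i. ennreal (?q ^ i) * ennreal (tail ((n + weight i - 1) div weight i)))"
    proof (intro suminf_cong arg_cong2[where f = "(*)"] refl)
      fix i
      let ?d = "(n + weight i - 1) div weight i"
      have "{y \<in> Y. ?d \<le> \<tau> y} \<in> sets \<mu>c"
        using measurable_sets[OF \<tau>_measurable, of "{?d..}"] by (simp add: vimage_def Int_def conj_commute space_\<mu>)
      then have "(\<integral>\<^sup>+ y. indicator {y \<in> Y. ?d \<le> \<tau> y} y \<partial>\<mu>c) = emeasure \<mu>c {y \<in> Y. ?d \<le> \<tau> y}"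
        by (rule nn_integral_indicator)
      moreover have "(\<integral>\<^sup>+ y. indicator {?d..} (\<tau> y) \<partial>\<mu>c) = (\<integral>\<^sup>+ y. indicator {y \<in> Y. ?d \<le> \<tau> y} y \<partial>\<mu>c)"
        by (intro nn_integral_cong) (auto simp: indicator_def space_\<mu>)
      ultimately show "(\<integral>\<^sup>+ y. indicator {?d..} (\<tau> y) \<partial>\<mu>c) = ennreal (tail ?d)"
        by (simp add: tail_def \<mu>c.emeasure_eq_measure)
    qed
    also have "\<dots> \<le> (\<Sum>i. ennreal (C * ?g n * (real (weight i) powr (\<beta> + 1) * ?q ^ i)))"
    proof (intro suminf_le summableI)
      fix i
      have "?q ^ i * tail ((n + weight i - 1) div weight i) \<le> ?q ^ i * (C * real (weight i) powr (\<beta> + 1) * ?g n)"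
        using q by (intro mult_left_mono scale n weight_pos) auto
      then show "ennreal (?q ^ i) * ennreal (tail ((n + weight i - 1) div weight i)) \<le>
          ennreal (C * ?g n * (real (weight i) powr (\<beta> + 1) * ?q ^ i))"
        using q by (simp add: tail_def ac_simps ennreal_leI flip: ennreal_mult)
    qed
    also have "\<dots> = ennreal (\<Sum>i. C * ?g n * (real (weight i) powr (\<beta> + 1) * ?q ^ i))"
      using q C g0 by (intro suminf_ennreal2 summable_mult sm) auto
    also have "(\<Sum>i. C * ?g n * (real (weight i) powr (\<beta> + 1) * ?q ^ i)) = C * ?g n * D"
      unfolding D_def by (rule suminf_mult[OF sm])
    finally have "ennreal (measure PA {c. n \<le> height c}) \<le> ennreal (C * ?g n * D)"
      by (simp add: measure_pmf.emeasure_eq_measure)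
    moreover have "0 \<le> D" unfolding D_def using q by (intro suminf_nonneg sm) auto
    ultimately show ?thesis using C g0 by (simp add: ac_simps)
  qed
  show ?thesis
  proof (rule landau_o.bigI[of "max 1 (C * D)"])
    show "eventually (\<lambda>n. norm (measure PA {c. n \<le> height c}) \<le> max 1 (C * D) * norm (?g n)) sequentially"
    proof (rule eventually_sequentiallyI[of n0])
      fix n assume n: "n0 \<le> n"
      have "0 \<le> ?g n" using Lpos[OF n] by simp
      then have "C * D * ?g n \<le> max 1 (C * D) * ?g n" by (intro mult_right_mono) auto
      then show "norm (measure PA {c. n \<le> height c}) \<le> max 1 (C * D) * norm (?g n)"
        using bound[OF n] \<open>0 \<le> ?g n\<close> by simp
    qed
  qed simp
qed

text \<open>By convexity, multiplying the exponent by \<open>s\<close> bounds the moment of one letter by \<open>1 + s\<close> times the full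
moment; given any history the law of a letter is at most \<open>exp R\<close> times that of a first letter. For
small \<open>s\<close> each letter thus contributes a factor at most \<open>1 + \<epsilon>\<close>, against a probability \<open>1 - \<epsilon>\<close> of
continuing the word.\<close>

lemma height_exponential:
  assumes \<beta>: "0 < \<beta>" and \<delta>: "0 < \<delta>" "\<delta> \<le> 1"
    and fin: "(\<integral>\<^sup>+ y. ennreal (exp (\<beta> * real (\<tau> y) powr \<delta>)) \<partial>\<mu>c) < \<infinity>"
  shows "\<exists>\<beta>'. 0 < \<beta>' \<and> \<beta>' \<le> \<beta> \<and> (\<integral>\<^sup>+ c. ennreal (exp (\<beta>' * real (height c) powr \<delta>)) \<partial>PA) < \<infinity>"
proof -
  define g where "g s a = exp (s * \<beta> * real (value_on \<tau> a) powr \<delta>)" for s a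
  define M where "M = enn2real (\<integral>\<^sup>+ y. ennreal (exp (\<beta> * real (\<tau> y) powr \<delta>)) \<partial>\<mu>c)"
  have M: "(\<integral>\<^sup>+ a. ennreal (g 1 a) * ennreal (lam [a]) \<partial>count_space \<alpha>) = ennreal M"
  proof -
    have "(\<integral>\<^sup>+ y. ennreal (exp (\<beta> * real (\<tau> y) powr \<delta>)) \<partial>\<mu>c) =
        (\<integral>\<^sup>+ a. ennreal (g 1 a) * ennreal (lam [a]) \<partial>count_space \<alpha>)"
      by (rule nn_integral_letters) (simp add: g_def value_on_\<tau>)
    then show ?thesis using fin by (simp add: M_def)
  qed
  have M0: "0 \<le> M" by (simp add: M_def)
  let ?R = "exp gibbs.R" and ?e = gibbs.\<epsilon>
  \<comment> \<open>Chosen so that \<open>s * (exp R * M)\<close> is at most \<open>\<epsilon>\<close>; adding 1 to \<open>M\<close> also gives \<open>s \<le> 1\<close>.\<close>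
  define s where "s = ?e / (?R * (M + 1))"
  have s0: "0 < s" unfolding s_def using gibbs.\<epsilon>_pos M0 by (intro divide_pos_pos mult_pos_pos) auto
  have s1: "s \<le> 1"
  proof -
    have "1 * 1 \<le> ?R * (M + 1)" using gibbs.R_ge_1 M0 by (intro mult_mono) auto
    then show ?thesis unfolding s_def using gibbs.\<epsilon>_less_1 by simp
  qed
  have conv: "g s a \<le> 1 + s * g 1 a" for a
  proof -
    let ?y = "\<beta> * real (value_on \<tau> a) powr \<delta>"
    have "exp ((1 - s) *\<^sub>R 0 + s *\<^sub>R ?y) \<le> (1 - s) * exp 0 + s * exp ?y"
      using s0 s1 by (intro convex_onD[OF exp_convex]) auto
    then show ?thesis using s0 by (simp add: g_def mult.assoc)
  qed
  have step: "(\<integral>\<^sup>+ b. ennreal (g s b) \<partial>gibbs.next_letter v) \<le> ennreal (1 + ?e)" if v: "v \<in> lists \<alpha>" for v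
  proof -
    have "(\<integral>\<^sup>+ b. ennreal (g s b) \<partial>gibbs.next_letter v) \<le> (\<integral>\<^sup>+ b. 1 + ennreal s * ennreal (g 1 b) \<partial>gibbs.next_letter v)"
      using conv s0 by (intro nn_integral_mono) (auto simp: g_def ennreal_leI simp flip: ennreal_mult ennreal_plus ennreal_1)
    also have "\<dots> = 1 + ennreal s * (\<integral>\<^sup>+ b. ennreal (g 1 b) \<partial>gibbs.next_letter v)"
      by (simp add: nn_integral_add nn_integral_cmult measure_pmf.emeasure_space_1[simplified])
    also have "(\<integral>\<^sup>+ b. ennreal (g 1 b) \<partial>gibbs.next_letter v) \<le> ennreal (?R * M)"
    proof -
      have "(\<integral>\<^sup>+ b. ennreal (g 1 b) \<partial>gibbs.next_letter v) =
          (\<integral>\<^sup>+ b. ennreal (pmf (gibbs.next_letter v) b) * ennreal (g 1 b) \<partial>count_space UNIV)"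
        by (rule nn_integral_measure_pmf)
      also have "\<dots> = (\<integral>\<^sup>+ b. ennreal (gibbs.future v [b]) * ennreal (g 1 b) \<partial>count_space \<alpha>)"
        by (subst nn_integral_count_space_indicator)
          (auto intro!: nn_integral_cong simp: indicator_def gibbs.pmf_next_letter[OF v])
      also have "\<dots> \<le> (\<integral>\<^sup>+ b. ennreal ?R * (ennreal (g 1 b) * ennreal (lam [b])) \<partial>count_space \<alpha>)"
      proof (intro nn_integral_mono)
        fix b assume "b \<in> space (count_space \<alpha>)"
        then have "gibbs.future v [b] \<le> ?R * lam [b]"
          using gibbs.regular_le[OF gibbs.regular_future[OF v], of "[b]"] by simp
        then have "ennreal (gibbs.future v [b]) * ennreal (g 1 b) \<le> ennreal (?R * lam [b]) * ennreal (g 1 b)"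
          by (intro mult_right_mono ennreal_leI) auto
        moreover have "ennreal (?R * lam [b]) = ennreal ?R * ennreal (lam [b])" by (rule ennreal_mult') simp
        ultimately show "ennreal (gibbs.future v [b]) * ennreal (g 1 b) \<le> ennreal ?R * (ennreal (g 1 b) * ennreal (lam [b]))"
          by (simp only: ac_simps)
      qed
      also have "\<dots> = ennreal (?R * M)"
        using M M0 by (simp add: nn_integral_cmult ennreal_mult)
      finally show ?thesis .
    qed
    then have "1 + ennreal s * (\<integral>\<^sup>+ b. ennreal (g 1 b) \<partial>gibbs.next_letter v) \<le> 1 + ennreal s * ennreal (?R * M)"
      by (intro add_left_mono mult_left_mono) auto
    also have "\<dots> = ennreal (1 + s * (?R * M))"
      using s0 M0 by (simp flip: ennreal_mult ennreal_plus ennreal_1)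
    also have "\<dots> \<le> ennreal (1 + ?e)"
    proof (intro ennreal_leI add_left_mono)
      have "s * (?R * M) \<le> s * (?R * (M + 1))" using s0 by simp
      also have "\<dots> = ?e" using M0 by (simp add: s_def)
      finally show "s * (?R * M) \<le> ?e" .
    qed
    finally show ?thesis .
  qed
  have "(\<integral>\<^sup>+ c. ennreal (exp (s * \<beta> * real (height c) powr \<delta>)) \<partial>PA) \<le>
      (\<integral>\<^sup>+ c. ennreal (\<Prod>b\<leftarrow>gibbs.word c. g s b) \<partial>PA)"
  proof (intro nn_integral_mono ennreal_leI)
    fix c
    have "s * \<beta> * real (height c) powr \<delta> \<le> s * \<beta> * (\<Sum>a\<leftarrow>gibbs.word c. real (value_on \<tau> a) powr \<delta>)"
      unfolding height_def using s0 \<beta> \<delta> by (intro mult_left_mono powr_sum_list_le) auto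
    then have "exp (s * \<beta> * real (height c) powr \<delta>) \<le> exp (s * \<beta> * (\<Sum>a\<leftarrow>gibbs.word c. real (value_on \<tau> a) powr \<delta>))"
      by simp
    also have "exp (s * \<beta> * (\<Sum>a\<leftarrow>w. real (value_on \<tau> a) powr \<delta>)) = (\<Prod>a\<leftarrow>w. g s a)" for w
      by (induction w) (auto simp: g_def distrib_left exp_add)
    finally show "exp (s * \<beta> * real (height c) powr \<delta>) \<le> (\<Prod>b\<leftarrow>gibbs.word c. g s b)" .
  qed
  also have "\<dots> = (\<integral>\<^sup>+ w. ennreal (\<Prod>b\<leftarrow>w. g s b) \<partial>gibbs.word_pmf)"
    by (rule nn_integral_code)
  also have "\<dots> < \<infinity>"
  proof (rule gibbs.nn_integral_word_prod[OF step])
    show "(1 - ?e) * (1 + ?e) < 1" using gibbs.\<epsilon>_pos by (simp add: algebra_simps)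
  qed (use gibbs.\<epsilon>_pos in \<open>auto simp: g_def\<close>)
  finally show ?thesis using s0 s1 \<beta> by (intro exI[of _ "s * \<beta>"]) (auto simp: mult_left_le_one_le)
qed

end

theorem theorem2p4:
  fixes m :: "'a::metric_space measure" and T :: "'a \<Rightarrow> 'a"
    and Y :: "'a set" and \<alpha> :: "'a set set" and \<tau> :: "'a \<Rightarrow> nat" and \<mu> :: "'a measure"
    and W :: "'a set set" and K \<gamma> :: real
  assumes "nonuniformly_hyperbolic m T Y \<alpha> \<tau> \<mu> W K \<gamma>"
  shows "\<exists>(PA :: nat measure) (hA :: nat \<Rightarrow> nat) (\<xi> :: real).
    markov_shift_tower PA hA \<xi> \<and>
    (\<exists>(D :: ((int \<Rightarrow> nat) \<times> nat) set) (\<pi> :: (int \<Rightarrow> nat) \<times> nat \<Rightarrow> 'a).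
       D \<in> sets (tower_measure PA hA) \<and>
       (AE p in tower_measure PA hA. p \<in> D) \<and>
       (\<forall>p\<in>D. tower_map hA p \<in> D \<and> \<pi> (tower_map hA p) = T (\<pi> p)) \<and>
       \<pi> \<in> restrict_space (tower_measure PA hA) D \<rightarrow>\<^sub>M m \<and>
       distr (restrict_space (tower_measure PA hA) D) m \<pi> = m \<and>
       (\<exists>C\<ge>0. \<forall>p\<in>D. \<forall>q\<in>D. dist (\<pi> p) (\<pi> q) \<le> C * tower_dist \<xi> p q)) \<and>
    (\<forall>\<beta> L. \<beta> > 0 \<longrightarrow> slowly_varying L \<longrightarrow>
       (\<lambda>n::nat. measure (completion \<mu>) {y \<in> Y. \<tau> y \<ge> n})
         \<in> O(\<lambda>n. real n powr (- \<beta>) * L (real n)) \<longrightarrow>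
       (\<lambda>n::nat. measure PA {a \<in> space PA. hA a \<ge> n})
         \<in> O(\<lambda>n. real n powr (- \<beta>) * L (real n))) \<and>
    (\<forall>\<beta>>0.
       (\<integral>\<^sup>+ y. ennreal (real (\<tau> y) powr \<beta>) \<partial>completion \<mu>) < \<infinity> \<longrightarrow>
       (\<integral>\<^sup>+ a. ennreal (real (hA a) powr \<beta>) \<partial>PA) < \<infinity>) \<and>
    (\<forall>\<beta> \<delta>. \<beta> > 0 \<longrightarrow> 0 < \<delta> \<longrightarrow> \<delta> \<le> 1 \<longrightarrow>
       (\<integral>\<^sup>+ y. ennreal (exp (\<beta> * real (\<tau> y) powr \<delta>)) \<partial>completion \<mu>) < \<infinity> \<longrightarrow>
       (\<exists>\<beta>'. 0 < \<beta>' \<and> \<beta>' \<le> \<beta> \<and>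
          (\<integral>\<^sup>+ a. ennreal (exp (\<beta>' * real (hA a) powr \<delta>)) \<partial>PA) < \<infinity>))"
proof -
  interpret nonuniformly_hyperbolic m T Y \<alpha> \<tau> \<mu> W K \<gamma> by (rule assms)
  show ?thesis
  proof (intro exI[of _ PA] exI[of _ height] exI[of _ \<gamma>] conjI)
    show "markov_shift_tower PA height \<gamma>" by (rule tower_height)
    show "\<exists>D \<pi>. D \<in> sets TM \<and> (AE p in TM. p \<in> D) \<and>
       (\<forall>p\<in>D. tower_map height p \<in> D \<and> \<pi> (tower_map height p) = T (\<pi> p)) \<and>
       \<pi> \<in> restrict_space TM D \<rightarrow>\<^sub>M m \<and> distr (restrict_space TM D) m \<pi> = m \<and>
       (\<exists>C\<ge>0. \<forall>p\<in>D. \<forall>q\<in>D. dist (\<pi> p) (\<pi> q) \<le> C * tower_dist \<gamma> p q)"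
      by (intro exI[of _ domain] exI[of _ proj] conjI ballI domain_sets AE_domain domain_invariant
          proj_semiconjugacy proj_measurable proj_preserving proj_lipschitz)
    show "\<forall>\<beta> L. \<beta> > 0 \<longrightarrow> slowly_varying L \<longrightarrow>
       (\<lambda>n::nat. measure \<mu>c {y \<in> Y. \<tau> y \<ge> n}) \<in> O(\<lambda>n. real n powr (- \<beta>) * L (real n)) \<longrightarrow>
       (\<lambda>n::nat. measure PA {a \<in> space PA. height a \<ge> n}) \<in> O(\<lambda>n. real n powr (- \<beta>) * L (real n))"
      using height_tail by simp
  qed (intro allI impI height_moment height_exponential; assumption)+
qed

end
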